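(* Let $T=(1,2,\ldots,d,t_d,\ldots,t_{\mathsf j},0)$ with $d\ge t_d\ge\cdots\ge t_{\mathsf j}>0$, and for $d\le i\le\mathsf j$ let $T_i=(1,2,\ldots,t_{i-1}-t_{i+1},\,t_i-t_{i+1},0)$, where $t_{d-1}=d$ and $t_{\mathsf j+1}=0$. For a Hilbert function $T'$ and an integer $k$, let $\mu(T',k)$ denote the number of partitions $P$ of diagonal lengths $T'$ with $\kappa(P)=k$. Then for every positive integer $k$, $$\mu(T,k)=\sum_{(k_d,\ldots,k_{\mathsf j})\in Q_k}\ \prod_{i=d}^{\mathsf j}\mu(T_i,k_i),$$ where $Q_k=\{(k_d,\ldots,k_{\mathsf j})\in\mathbb Z^{\mathsf j+1-d}\mid k_d+\cdots+k_{\mathsf j}=k+(t_d-d)-(t_{\mathsf j}-\mathsf j)\}$.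
   Context: Let $R=\mathsf k[x,y]$ with its standard grading, where the field $\mathsf k$ has characteristic zero, or is infinite of characteristic $p>\mathsf j$. For a partition $P=(p_1\ge\cdots\ge p_m)$ let $C_P$ be the set of monomials $x^ay^b$ with $0\le b<m$, $0\le a<p_{b+1}$, and $E_P$ the set of monomials not in $C_P$, and also the monomial ideal they generate. The diagonal lengths of $P$ is the Hilbert function of $R/E_P$. The initial monomial of a form is its monomial of highest $y$-degree with nonzero coefficient; $\mathrm{in}(I)$ is generated by the initial monomials of elements of $I$; the Jordan cell $\mathbb V(E_P)$ is the affine variety (an affine space) parametrizing all graded ideals $I\subset R$ with $\mathrm{in}(I)=E_P$. $\kappa(P)$ is the minimum number of generators of a generic ideal $I\in\mathbb V(E_P)$ (generic: in a suitable nonempty Zariski-open dense subset). If $t_{i-1}=t_{i+1}$ then $T_i$ is the zero sequence, whose only partition is the empty one, with $E_\emptyset=R$ and $\kappa(\emptyset)=1$. If $t_i=t_{i+1}$, then $T_i=(1,2,\ldots,t_{i-1}-t_i,0)$. *)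

theory Defs
  imports "HOL-Analysis.Analysis" "HOL-Library.Poly_Mapping"
begin

text \<open>
  The ring $k[x,y]$ is the type \<open>(nat \<times> nat) \<Rightarrow>\<^sub>0 'k\<close> of finitely supported functions with
  convolution product; the exponent pair \<open>(a, b)\<close> stands for $x^a y^b$.
\<close>

type_synonym 'k bipoly = "(nat \<times> nat) \<Rightarrow>\<^sub>0 'k"

definition monomial :: "nat \<times> nat \<Rightarrow> 'k::field bipoly" where
  "monomial m = Poly_Mapping.single m 1"

definition forms :: "nat \<Rightarrow> 'k::field bipoly set" where
  "forms n = {f. \<forall>(a, b) \<in> Poly_Mapping.keys f. a + b = n}"

text \<open>An ideal is a submodule of the ring over itself, and the ideal generated by a set is its span.\<close>

abbreviation ideal_generated_by :: "'a::comm_ring_1 set \<Rightarrow> 'a set" where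
  "ideal_generated_by S \<equiv> module.span (*) S"

definition graded_ideal :: "'k::field bipoly set \<Rightarrow> bool" where
  "graded_ideal I \<longleftrightarrow> (\<exists>S \<subseteq> (\<Union>n. forms n). I = ideal_generated_by S)"

text \<open>The monomials of a form have the same total degree, so the one of highest $y$-degree is unique.\<close>

definition initial_monomial :: "'k::field bipoly \<Rightarrow> 'k bipoly" where
  "initial_monomial f = monomial (arg_max_on snd (Poly_Mapping.keys f))"

definition initial_ideal :: "'k::field bipoly set \<Rightarrow> 'k bipoly set" where
  "initial_ideal I = ideal_generated_by (initial_monomial ` (I \<inter> (\<Union>n. forms n) - {0}))"

definition min_generators :: "'a::comm_ring_1 set \<Rightarrow> nat" where
  "min_generators I = (LEAST n. \<exists>S. finite S \<and> card S = n \<and> ideal_generated_by S = I)"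

text \<open>
  \<open>hilbert_function I n\<close> is the dimension of $(R/I)_n = R_n / I_n$, for a graded ideal \<open>I\<close>.
\<close>

abbreviation scale :: "'k::field \<Rightarrow> 'k bipoly \<Rightarrow> 'k bipoly" where
  "scale c f \<equiv> Poly_Mapping.single 0 c * f"

definition hilbert_function :: "'k::field bipoly set \<Rightarrow> nat \<Rightarrow> nat" where
  "hilbert_function I n =
     vector_space.dim scale (forms n :: 'k bipoly set) - vector_space.dim scale (I \<inter> forms n)"

definition is_partition :: "nat list \<Rightarrow> bool" where
  "is_partition P \<longleftrightarrow> sorted_wrt (\<ge>) P \<and> (\<forall>p \<in> set P. 0 < p)"

definition C_set :: "nat list \<Rightarrow> (nat \<times> nat) set" where
  "C_set P = {(a, b). b < length P \<and> a < P ! b}"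

definition E_ideal :: "nat list \<Rightarrow> 'k::field bipoly set" where
  "E_ideal P = ideal_generated_by (monomial ` (- C_set P))"

definition diagonal_lengths :: "'k::field itself \<Rightarrow> nat list \<Rightarrow> nat \<Rightarrow> nat" where
  "diagonal_lengths K P = hilbert_function (E_ideal P :: 'k bipoly set)"

definition jordan_cell :: "nat list \<Rightarrow> 'k::field bipoly set set" where
  "jordan_cell P = {I. graded_ideal I \<and> initial_ideal I = E_ideal P}"

text \<open>
  Affine coordinates on the Jordan cell. Each \<open>I\<close> in the cell contains, for every monomial \<open>m\<close>
  outside \<open>C_set P\<close>, exactly one polynomial of the form \<open>m + (linear combination of C_set P)\<close>, and
  these polynomials determine \<open>I\<close>. Their coefficients are the entries of the reduced row echelon
  bases of the graded pieces of \<open>I\<close>, that is, the standard coordinates on the Schubert cells of the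
  Grassmannians in which these pieces lie. Coefficients at monomials of a degree
  other than that of \<open>m\<close> vanish identically.
\<close>

definition cell_coordinate ::
    "nat list \<Rightarrow> nat \<times> nat \<Rightarrow> nat \<times> nat \<Rightarrow> 'k::field bipoly set \<Rightarrow> 'k" where
  "cell_coordinate P m m' I =
     Poly_Mapping.lookup
       (THE f. f \<in> I \<and> Poly_Mapping.keys f \<subseteq> insert m (C_set P) \<and> Poly_Mapping.lookup f m = 1) m'"

inductive_set polynomial_functions :: "nat list \<Rightarrow> ('k::field bipoly set \<Rightarrow> 'k) set"
  for P :: "nat list" where
  const: "(\<lambda>I. c) \<in> polynomial_functions P"
| coordinate: "m \<notin> C_set P \<Longrightarrow> m' \<in> C_set P \<Longrightarrow> cell_coordinate P m m' \<in> polynomial_functions P"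
| add: "g \<in> polynomial_functions P \<Longrightarrow> h \<in> polynomial_functions P \<Longrightarrow>
    (\<lambda>I. g I + h I) \<in> polynomial_functions P"
| mult: "g \<in> polynomial_functions P \<Longrightarrow> h \<in> polynomial_functions P \<Longrightarrow>
    (\<lambda>I. g I * h I) \<in> polynomial_functions P"

definition zariski_topology :: "nat list \<Rightarrow> 'k::field bipoly set topology" where
  "zariski_topology P =
     topology_generated_by {{I \<in> jordan_cell P. g I \<noteq> 0} | g. g \<in> polynomial_functions P}"

text \<open>
  The common value of \<open>min_generators\<close> on some nonempty dense open subset of the cell. At most one
  value qualifies, because two such subsets meet.
\<close>

definition kappa :: "'k::field itself \<Rightarrow> nat list \<Rightarrow> nat" where
  "kappa K P = (THE n. \<exists>U :: 'k bipoly set set.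
      openin (zariski_topology P) U \<and> U \<noteq> {} \<and>
      zariski_topology P closure_of U = jordan_cell P \<and>
      (\<forall>I \<in> U. min_generators I = n))"

definition mu :: "'k::field itself \<Rightarrow> (nat \<Rightarrow> nat) \<Rightarrow> int \<Rightarrow> nat" where
  "mu K T k = card {P. is_partition P \<and> diagonal_lengths K P = T \<and> int (kappa K P) = k}"

text \<open>
  Finite sequences are extended by zero to functions on \<open>nat\<close>. If \<open>T (i - 1) = T (i + 1)\<close>, the
  monotonicity of \<open>T\<close> makes the following the zero sequence.
\<close>

definition T_component :: "(nat \<Rightarrow> nat) \<Rightarrow> nat \<Rightarrow> nat \<Rightarrow> nat" where
  "T_component T i n =
     (let e = T (i - 1) - T (i + 1) in
      if n < e then n + 1 else if n = e then T i - T (i + 1) else 0)"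

text \<open>
  The tuples indexed by \<open>{d..j}\<close>; this set is infinite when \<open>d < j\<close>. A sum over it of products
  \<open>\<Prod>i = d..j. mu K (T_component T i) (\<kappa> i)\<close> has only finitely many nonzero terms, since
  only finitely many partitions have given diagonal lengths; \<open>infsum\<close>, taken in the discrete
  space \<open>nat\<close>, is therefore the sum of the nonzero terms.
\<close>

definition Q_set :: "(nat \<Rightarrow> nat) \<Rightarrow> nat \<Rightarrow> nat \<Rightarrow> int \<Rightarrow> (nat \<Rightarrow> int) set" where
  "Q_set T d j k =
     {\<kappa> \<in> {d..j} \<rightarrow>\<^sub>E UNIV.
        (\<Sum>i = d..j. \<kappa> i) = k + (int (T d) - int d) - (int (T j) - int j)}"

end

theory Submission
  imports Defs "HOL-Computational_Algebra.Polynomial"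
begin

text \<open>
  Setting $x = 1$ turns a form of degree $n$ into a polynomial in $y$ of degree at most $n$, and a
  graded ideal $I$ into a chain of spaces $V_n \subseteq k[y]$ with $V_n \subseteq V_{n+1}$ and $y
  V_n \subseteq V_{n+1}$. The initial monomials of $I$ are then the degrees of the elements of the
  $V_n$. For a partition $P$ with parts $q_0 \ge q_1 \ge \cdots$, extended by zeros, put $D_b =
  q_b + b$. This is the degree of the generator $x^{q_b} y^b$ of $E_P$, and $I$ lies in the cell
  of $P$ iff the degrees occurring in $V_n$ are the $b$ with $D_b \le n$
  (\<open>jordan_cell_iff\<close>). In this case there are monic $g_b$ of degree $b$ such that
  $V_n$ is spanned by the $g_b$ with $D_b \le n$, and
  \[ y g_b = g_{b+1} + \sum_{l \le b} \alpha_{l,b} g_l, \qquad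
     \alpha_{l,b} = 0 \mbox{ whenever } D_l > D_b + 1. \]
  Conversely every choice of such scalars $\alpha$ defines an ideal in the cell
  (\<open>cell_chain_flag_chain\<close>, \<open>cell_chain_is_flag_chain\<close>). Hence the cell
  is parametrized, with redundancy, by the linear space of these $\alpha$. A line in that space is
  mapped to a curve on which all coordinates of the cell are polynomials in the parameter, and
  this gives irreducibility (\<open>jordan_cell_irreducible\<close>).

  By the graded Nakayama lemma, $I$ needs $\dim V_{n+1} - \dim (V_n + y V_n)$ generators in degree
  $n + 1$ (\<open>min_generators_ideal_of\<close>). Modulo $V_n$ the space $V_n + y V_n$ is
  spanned by the columns of a matrix with rows $\{l \mid D_l = n+1\}$ and columns $\{b \mid D_b =
  n\}$, whose entry at $(l, b)$ is $\alpha_{l,b}$ for $l \le b$, one for $l = b + 1$ and zero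
  below that. Each $\alpha_{l,b}$ with $D_l = D_b + 1$ enters exactly one of these matrices, so
  all of them attain their maximal rank simultaneously, and they do so on a nonempty open set.
  This maximal rank depends only on the relative position of the letters $n$ and $n+1$ in the word
  $D_0 D_1 D_2 \cdots$. Therefore $\kappa(P)$ is the number of letters $d$ plus a sum over $n$ of
  contributions of the subwords on the letters $n, n+1$ (\<open>kappa_eq_word\<close>).

  Fixing the diagonal lengths $T$ means prescribing how often each letter occurs in the word,
  namely $1 + t_{n-1} - t_n$ times, with $t_{d-1} = d$. The only other conditions are that letters
  increase by at most one from each position to the next and that the largest letter, $\mathsf j +
  1$, comes last. Such a word is determined by its subwords on the letters $i, i+1$ for $d \le i
  \le \mathsf j$, and these can be prescribed arbitrarily, subject to the multiplicities and to
  ending in $i+1$ (\<open>words_projections_inject\<close>,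
  \<open>words_projections_surject\<close>). Up to a shift of the letters, the subwords on $i,
  i+1$ are exactly the words of the partitions of diagonal lengths $T_i$
  (\<open>mu_component\<close>). In $\sum_i \kappa(P_i)$ the numbers of letters $i$ for all $i$
  are added, while $\kappa(P)$ counts only the letters $d$; the difference is the shift in the
  definition of $Q_k$.
\<close>

section \<open>Forms in two variables as polynomials in one\<close>

interpretation ring_module: module "(*) :: 'a::comm_ring_1 \<Rightarrow> 'a \<Rightarrow> 'a"
  by unfold_locales (simp_all add: algebra_simps)

interpretation bipoly: vector_space "scale :: 'k::field \<Rightarrow> 'k bipoly \<Rightarrow> 'k bipoly"
  by unfold_locales
    (simp_all add: distrib_left distrib_right single_add mult_single flip: mult.assoc)

interpretation upoly: vector_space "smult :: 'k::field \<Rightarrow> 'k poly \<Rightarrow> 'k poly"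
  by unfold_locales (simp_all add: smult_add_left smult_add_right)

abbreviation var_x :: "'k::field bipoly" where "var_x \<equiv> Poly_Mapping.single (Suc 0, 0) 1"
abbreviation var_y :: "'k::field bipoly" where "var_y \<equiv> Poly_Mapping.single (0, Suc 0) 1"

text \<open>
  The two directions of dehomogenization: the coefficient of $y^b$ is that of $x^{n-b} y^b$. Terms
  of degree other than \<open>n\<close> are dropped by \<open>slice n\<close>.
\<close>
definition slice :: "nat \<Rightarrow> 'k::field bipoly \<Rightarrow> 'k poly" where
  "slice n f = (\<Sum>b\<le>n. monom (Poly_Mapping.lookup f (n - b, b)) b)"

definition homogenization :: "nat \<Rightarrow> 'k::field poly \<Rightarrow> 'k bipoly" where
  "homogenization n p = (\<Sum>b\<le>n. Poly_Mapping.single (n - b, b) (coeff p b))"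

lemma coeff_slice:
  "coeff (slice n f) b = (if b \<le> n then Poly_Mapping.lookup f (n - b, b) else 0)"
  by (simp add: slice_def coeff_sum)

lemma lookup_homogenization:
  "Poly_Mapping.lookup (homogenization n p) (a, b) = (if a + b = n then coeff p b else 0)"
proof -
  have "Poly_Mapping.lookup (homogenization n p) (a, b)
      = (\<Sum>b'\<le>n. if b' = b then (if a + b = n then coeff p b else 0) else 0)"
    unfolding homogenization_def lookup_sum
    by (rule sum.cong) (auto simp: lookup_single when_def)
  then show ?thesis by simp
qed

lemma degree_slice: "degree (slice n f) \<le> n"
  by (rule degree_le) (simp add: coeff_slice)

lemma slice_add: "slice n (f + g) = slice n f + slice n g"
  by (rule poly_eqI) (simp add: coeff_slice lookup_add)

lemma slice_0 [simp]: "slice n 0 = 0"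
  by (rule poly_eqI) (simp add: coeff_slice)

lemma slice_sum: "slice n (sum f A) = (\<Sum>a\<in>A. slice n (f a))"
  by (induction A rule: infinite_finite_induct) (simp_all add: slice_add)

lemma homogenization_0 [simp]: "homogenization n 0 = 0"
  by (simp add: homogenization_def)

lemma homogenization_add:
  "homogenization n (p + q) = homogenization n p + homogenization n q"
  by (simp add: homogenization_def single_add sum.distrib)

lemma lookup_single_times:
  fixes g :: "(nat \<times> nat) \<Rightarrow>\<^sub>0 'k::field"
  shows "Poly_Mapping.lookup (Poly_Mapping.single (i, l) c * g) (a, b) =
    (if i \<le> a \<and> l \<le> b then c * Poly_Mapping.lookup g (a - i, b - l) else 0)"
proof (induction g rule: update_induct)
  case const
  show ?case by simp
next
  case (update f k d)
  have "Poly_Mapping.update k d f = f + Poly_Mapping.single k d"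
    using update.hyps by (intro poly_mapping_eqI)
      (auto simp: lookup_update lookup_add lookup_single when_def in_keys_iff)
  then show ?case
    using update.IH
    by (cases k) (auto simp: algebra_simps lookup_add mult_single lookup_single when_def)
qed

lemma slice_scale: "slice n (scale c f) = smult c (slice n f)"
  by (rule poly_eqI) (simp add: coeff_slice lookup_single_times zero_prod_def)

lemma slice_times_x: "slice (Suc n) (var_x * f) = slice n f"
  by (rule poly_eqI) (auto simp: coeff_slice lookup_single_times Suc_diff_le le_Suc_eq)

lemma slice_times_y: "slice (Suc n) (var_y * f) = pCons 0 (slice n f)"
  by (rule poly_eqI) (auto simp: coeff_slice lookup_single_times coeff_pCons split: nat.split)

lemma slice_0_times [simp]: "slice 0 (var_x * f) = 0" "slice 0 (var_y * f) = 0"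
  by (rule poly_eqI; auto simp: coeff_slice lookup_single_times)+

lemma homogenization_scale: "homogenization n (smult c p) = scale c (homogenization n p)"
proof (rule poly_mapping_eqI)
  fix k show "Poly_Mapping.lookup (homogenization n (smult c p)) k =
      Poly_Mapping.lookup (scale c (homogenization n p)) k"
    by (cases k) (simp add: zero_prod_def lookup_homogenization lookup_single_times)
qed

lemma homogenization_x:
  assumes "degree p \<le> n"
  shows "homogenization (Suc n) p = var_x * homogenization n p"
proof (rule poly_mapping_eqI)
  fix k :: "nat \<times> nat"
  obtain a b where k: "k = (a, b)" by fastforce
  have "coeff p (Suc n) = 0" using assms by (simp add: coeff_eq_0)
  then show "Poly_Mapping.lookup (homogenization (Suc n) p) k =
      Poly_Mapping.lookup (var_x * homogenization n p) k"
    by (cases a) (simp_all add: k lookup_homogenization lookup_single_times)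
qed

lemma homogenization_y: "homogenization (Suc n) (pCons 0 p) = var_y * homogenization n p"
proof (rule poly_mapping_eqI)
  fix k :: "nat \<times> nat"
  obtain a b where k: "k = (a, b)" by fastforce
  show "Poly_Mapping.lookup (homogenization (Suc n) (pCons 0 p)) k =
      Poly_Mapping.lookup (var_y * homogenization n p) k"
    by (cases b) (simp_all add: k lookup_homogenization lookup_single_times coeff_pCons)
qed

lemma slice_homogenization:
  assumes "degree p \<le> n"
  shows "slice m (homogenization n p) = (if m = n then p else 0)"
proof (rule poly_eqI)
  fix b
  have "coeff p b = 0" if "n < b" using assms that by (intro coeff_eq_0) simp
  then show "coeff (slice m (homogenization n p)) b = coeff (if m = n then p else 0) b"
    by (simp add: coeff_slice lookup_homogenization)
qed

lemma forms_iff: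
  "f \<in> forms n \<longleftrightarrow> (\<forall>a b. Poly_Mapping.lookup f (a, b) \<noteq> 0 \<longrightarrow> a + b = n)"
  unfolding forms_def Ball_def in_keys_iff by simp

lemma homogenization_in_forms [simp]: "homogenization n p \<in> forms n"
  by (simp add: forms_iff lookup_homogenization)

lemma homogenization_slice:
  assumes "f \<in> forms n"
  shows "homogenization n (slice n f) = f"
proof (rule poly_mapping_eqI)
  fix k :: "nat \<times> nat"
  obtain a b where k: "k = (a, b)" by fastforce
  have "Poly_Mapping.lookup f (a, b) \<noteq> 0 \<Longrightarrow> a + b = n"
    using assms unfolding forms_iff by blast
  then show "Poly_Mapping.lookup (homogenization n (slice n f)) k = Poly_Mapping.lookup f k"
    by (cases "Poly_Mapping.lookup f (a, b) = 0") (auto simp: k lookup_homogenization coeff_slice)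
qed

lemma slice_of_form:
  assumes "f \<in> forms n" "m \<noteq> n"
  shows "slice m f = 0"
proof (rule poly_eqI)
  fix b
  have "Poly_Mapping.lookup f (m - b, b) \<noteq> 0 \<Longrightarrow> m - b + b = n"
    using assms(1) unfolding forms_iff by blast
  then show "coeff (slice m f) b = coeff 0 b"
    using assms(2) by (cases "Poly_Mapping.lookup f (m - b, b) = 0") (auto simp: coeff_slice)
qed

lemma sum_of_components: "\<exists>N. f = (\<Sum>n\<le>N. homogenization n (slice n f))"
proof -
  define N where "N = Max (insert 0 ((\<lambda>k. fst k + snd k) ` Poly_Mapping.keys f))"
  have N: "fst k + snd k \<le> N" if "k \<in> Poly_Mapping.keys f" for k
    unfolding N_def using that by (intro Max_ge) auto
  have "f = (\<Sum>n\<le>N. homogenization n (slice n f))"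
  proof (rule poly_mapping_eqI)
    fix k :: "nat \<times> nat" obtain a b where k: "k = (a, b)" by fastforce
    have "(\<Sum>n\<le>N. Poly_Mapping.lookup (homogenization n (slice n f)) (a, b))
        = (\<Sum>n\<le>N. if n = a + b then Poly_Mapping.lookup f (a, b) else 0)"
      by (rule sum.cong) (auto simp: lookup_homogenization coeff_slice)
    also have "\<dots> = (if a + b \<le> N then Poly_Mapping.lookup f (a, b) else 0)" by simp
    also have "\<dots> = Poly_Mapping.lookup f (a, b)"
      using N[of "(a, b)"] by (cases "Poly_Mapping.lookup f (a, b) = 0") (simp_all add: in_keys_iff)
    finally show "Poly_Mapping.lookup f k =
        Poly_Mapping.lookup (\<Sum>n\<le>N. homogenization n (slice n f)) k"
      by (simp add: lookup_sum k)
  qed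
  then show ?thesis ..
qed

section \<open>Graded ideals as chains of spaces of polynomials\<close>

text \<open>
  Multiplication by any polynomial is a combination of scalings and multiplications by the two
  variables, so these suffice to recognise an ideal.
\<close>
lemma ideal_criterion:
  fixes J :: "'k::field bipoly set"
  assumes J: "0 \<in> J" "\<And>f g. f \<in> J \<Longrightarrow> g \<in> J \<Longrightarrow> f + g \<in> J" "\<And>c f. f \<in> J \<Longrightarrow> scale c f \<in> J"
    "\<And>f. f \<in> J \<Longrightarrow> var_x * f \<in> J" "\<And>f. f \<in> J \<Longrightarrow> var_y * f \<in> J"
  shows "ring_module.subspace J"
proof (rule ring_module.subspaceI)
  fix g f assume f: "f \<in> J"
  have x: "Poly_Mapping.single (a, 0) 1 * f \<in> J" if "f \<in> J" for a f
    using that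
  proof (induction a)
    case 0 then show ?case using J(3)[of f 1] by (simp add: zero_prod_def)
  next
    case (Suc a) then show ?case
      using J(4)[OF Suc.IH[OF Suc.prems]] by (simp add: mult_single flip: mult.assoc)
  qed
  have y: "Poly_Mapping.single (0, b) 1 * f \<in> J" if "f \<in> J" for b f
    using that
  proof (induction b)
    case 0 then show ?case using J(3)[of f 1] by (simp add: zero_prod_def)
  next
    case (Suc b) then show ?case
      using J(5)[OF Suc.IH[OF Suc.prems]] by (simp add: mult_single flip: mult.assoc)
  qed
  have s: "Poly_Mapping.single k c * f \<in> J" for k c
    using J(3)[OF x[OF y[OF f]], of c "fst k" "snd k"]
    by (simp add: mult_single flip: mult.assoc)
  show "g * f \<in> J"
  proof (induction g rule: update_induct)
    case const show ?case using J(1) by simp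
  next
    case (update g k d)
    have "Poly_Mapping.update k d g = g + Poly_Mapping.single k d"
      using update.hyps by (intro poly_mapping_eqI)
        (auto simp: lookup_update lookup_add lookup_single when_def in_keys_iff)
    then show ?case using J(2)[OF update.IH s] by (simp add: algebra_simps)
  qed
qed (use J in auto)

text \<open>
  The slices of a graded ideal; multiplication by $x$ becomes inclusion and multiplication by $y$
  becomes \<open>pCons 0\<close>.
\<close>
definition form_chain :: "(nat \<Rightarrow> 'k::field poly set) \<Rightarrow> bool" where
  "form_chain V \<longleftrightarrow> (\<forall>n. upoly.subspace (V n) \<and>
     (\<forall>p \<in> V n. degree p \<le> n \<and> p \<in> V (Suc n) \<and> pCons 0 p \<in> V (Suc n)))"

definition ideal_of :: "(nat \<Rightarrow> 'k::field poly set) \<Rightarrow> 'k bipoly set" where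
  "ideal_of V = {f. \<forall>n. slice n f \<in> V n}"

lemma form_chain_subspace: "form_chain V \<Longrightarrow> upoly.subspace (V n)"
  and form_chain_degree: "form_chain V \<Longrightarrow> p \<in> V n \<Longrightarrow> degree p \<le> n"
  and form_chain_x: "form_chain V \<Longrightarrow> p \<in> V n \<Longrightarrow> p \<in> V (Suc n)"
  and form_chain_y: "form_chain V \<Longrightarrow> p \<in> V n \<Longrightarrow> pCons 0 p \<in> V (Suc n)"
  unfolding form_chain_def by blast+

lemma homogenization_in_ideal_of:
  assumes "form_chain V" "degree p \<le> n"
  shows "homogenization n p \<in> ideal_of V \<longleftrightarrow> p \<in> V n"
  using assms form_chain_subspace[OF assms(1), THEN upoly.subspace_0]
  by (auto simp: ideal_of_def slice_homogenization)

lemma subspace_ideal_of: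
  assumes "form_chain V"
  shows "ring_module.subspace (ideal_of V)"
proof (rule ideal_criterion)
  note sub = form_chain_subspace[OF assms]
  show "0 \<in> ideal_of V" by (simp add: ideal_of_def upoly.subspace_0[OF sub])
  show "f + g \<in> ideal_of V" if "f \<in> ideal_of V" "g \<in> ideal_of V" for f g
    using that by (simp add: ideal_of_def slice_add upoly.subspace_add[OF sub])
  show "scale c f \<in> ideal_of V" if "f \<in> ideal_of V" for c f
    using that by (simp add: ideal_of_def slice_scale upoly.subspace_scale[OF sub])
  fix f assume "f \<in> ideal_of V"
  then have f: "slice n f \<in> V n" for n by (simp add: ideal_of_def)
  have "slice n (var_x * f) \<in> V n" for n
    using form_chain_x[OF assms f] upoly.subspace_0[OF sub] by (cases n) (simp_all add: slice_times_x)
  moreover have "slice n (var_y * f) \<in> V n" for n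
    using form_chain_y[OF assms f] upoly.subspace_0[OF sub] by (cases n) (simp_all add: slice_times_y)
  ultimately show "var_x * f \<in> ideal_of V" "var_y * f \<in> ideal_of V" by (simp_all add: ideal_of_def)
qed

text \<open>
  The polynomials all of whose components lie in the ideal form an ideal, and it contains the
  homogeneous generators.
\<close>
lemma graded_ideal_component:
  assumes I: "graded_ideal I" and f: "f \<in> I"
  shows "homogenization n (slice n f) \<in> I"
proof -
  obtain S where S: "S \<subseteq> (\<Union>n. forms n)" and I: "I = ring_module.span S"
    using I by (auto simp: graded_ideal_def)
  have sub: "ring_module.subspace I" by (simp add: I)
  let ?J = "{f. \<forall>n. homogenization n (slice n f) \<in> I}"
  have "ring_module.subspace ?J"
  proof (rule ideal_criterion)
    show "0 \<in> ?J" by (simp add: ring_module.subspace_0[OF sub])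
    show "f + g \<in> ?J" if "f \<in> ?J" "g \<in> ?J" for f g
      using that by (simp add: slice_add homogenization_add ring_module.subspace_add[OF sub])
    show "scale c f \<in> ?J" if "f \<in> ?J" for c f
      using that by (simp add: slice_scale homogenization_scale ring_module.subspace_scale[OF sub])
    fix f assume "f \<in> ?J"
    then have f: "homogenization n (slice n f) \<in> I" for n by simp
    have "homogenization n (slice n (var_x * f)) \<in> I" for n
      using ring_module.subspace_scale[OF sub f] ring_module.subspace_0[OF sub]
      by (cases n) (simp_all add: slice_times_x homogenization_x degree_slice)
    moreover have "homogenization n (slice n (var_y * f)) \<in> I" for n
      using ring_module.subspace_scale[OF sub f] ring_module.subspace_0[OF sub]
      by (cases n) (simp_all add: slice_times_y homogenization_y)
    ultimately show "var_x * f \<in> ?J" "var_y * f \<in> ?J" by simp_all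
  qed
  moreover have "S \<subseteq> ?J"
  proof
    fix s assume s: "s \<in> S"
    then obtain m where m: "s \<in> forms m" using S by auto
    have "homogenization n (slice n s) \<in> I" for n
      using s m ring_module.subspace_0[OF sub] ring_module.span_base[of s S]
      by (cases "n = m") (auto simp: homogenization_slice slice_of_form I)
    then show "s \<in> ?J" by simp
  qed
  ultimately have "I \<subseteq> ?J" unfolding I by (intro ring_module.span_minimal)
  then show ?thesis using f by blast
qed

lemma graded_ideal_iff: "graded_ideal I \<longleftrightarrow> (\<exists>V. form_chain V \<and> I = ideal_of V)"
proof
  assume I: "graded_ideal I"
  then have sub: "ring_module.subspace I" by (auto simp: graded_ideal_def)
  define V where "V n = {p. degree p \<le> n \<and> homogenization n p \<in> I}" for n
  have "form_chain V"
    unfolding form_chain_def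
  proof (intro allI conjI ballI)
    fix n
    show "upoly.subspace (V n)"
    proof (rule upoly.subspaceI)
      show "0 \<in> V n" by (simp add: V_def ring_module.subspace_0[OF sub])
      show "p + q \<in> V n" if "p \<in> V n" "q \<in> V n" for p q
        using that by (simp add: V_def homogenization_add degree_add_le ring_module.subspace_add[OF sub])
      show "smult c p \<in> V n" if "p \<in> V n" for c p
        using that order_trans[OF degree_smult_le, of p n c]
        by (simp add: V_def homogenization_scale ring_module.subspace_scale[OF sub])
    qed
    fix p assume p: "p \<in> V n"
    then show "degree p \<le> n" by (simp add: V_def)
    show "p \<in> V (Suc n)"
      using p by (simp add: V_def homogenization_x ring_module.subspace_scale[OF sub])
    show "pCons 0 p \<in> V (Suc n)"
      using p by (simp add: V_def homogenization_y ring_module.subspace_scale[OF sub] degree_pCons_le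
          order_trans[OF degree_pCons_le])
  qed
  moreover have "I = ideal_of V"
  proof
    show "I \<subseteq> ideal_of V"
      using graded_ideal_component[OF I] by (simp add: ideal_of_def V_def degree_slice subset_iff)
    show "ideal_of V \<subseteq> I"
    proof
      fix f assume "f \<in> ideal_of V"
      then have "homogenization n (slice n f) \<in> I" for n by (simp add: ideal_of_def V_def)
      then have "(\<Sum>n\<le>N. homogenization n (slice n f)) \<in> I" for N
        by (intro ring_module.subspace_sum[OF sub])
      then show "f \<in> I" using sum_of_components[of f] by metis
    qed
  qed
  ultimately show "\<exists>V. form_chain V \<and> I = ideal_of V" by blast
next
  assume "\<exists>V. form_chain V \<and> I = ideal_of V"
  then obtain V where V: "form_chain V" and I: "I = ideal_of V" by blast
  have sub: "ring_module.subspace I" unfolding I by (rule subspace_ideal_of[OF V])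
  define S where "S = I \<inter> (\<Union>n. forms n)"
  have "I \<subseteq> ring_module.span S"
  proof
    fix f assume f: "f \<in> I"
    have "homogenization n (slice n f) \<in> I" for n
      unfolding I homogenization_in_ideal_of[OF V degree_slice]
      using f by (simp add: I ideal_of_def)
    then have "homogenization n (slice n f) \<in> ring_module.span S" for n
      unfolding S_def by (intro ring_module.span_base IntI UN_I[of n]) auto
    then have "(\<Sum>n\<le>N. homogenization n (slice n f)) \<in> ring_module.span S" for N
      by (intro ring_module.span_sum)
    then show "f \<in> ring_module.span S" using sum_of_components[of f] by metis
  qed
  moreover have "ring_module.span S \<subseteq> I"
    using sub by (intro ring_module.span_minimal) (auto simp: S_def)
  ultimately show "graded_ideal I" unfolding graded_ideal_def
    by (intro exI[of _ S]) (auto simp: S_def)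
qed

section \<open>Degrees occurring in a space of polynomials\<close>

definition degs :: "'k::field poly set \<Rightarrow> nat set" where
  "degs V = degree ` (V - {0})"

lemma degsI: "p \<in> V \<Longrightarrow> p \<noteq> 0 \<Longrightarrow> degree p \<in> degs V"
  by (auto simp: degs_def)

text \<open>
  Division by leading terms: subtracting a multiple of \<open>g (degree p)\<close> from
  \<open>p\<close> lowers the degree without leaving \<open>V\<close>. That no term of degree
  above \<open>degree p\<close> is needed is what makes the structure constants of adapted bases
  triangular.
\<close>
lemma expand_by_degrees:
  fixes g :: "nat \<Rightarrow> 'k::field poly"
  assumes V: "upoly.subspace V"
    and g: "\<And>b. b \<in> degs V \<Longrightarrow> g b \<in> V \<and> g b \<noteq> 0 \<and> degree (g b) = b"
    and p: "p \<in> V"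
  shows "\<exists>c. (\<forall>l. c l \<noteq> 0 \<longrightarrow> l \<in> degs V \<and> l \<le> degree p) \<and> p = (\<Sum>l\<le>degree p. smult (c l) (g l))"
  using p
proof (induction "degree p" arbitrary: p rule: less_induct)
  case less
  show ?case
  proof (cases "p = 0")
    case True
    then show ?thesis by (intro exI[of _ "\<lambda>_. 0"]) simp
  next
    case False
    define m where "m = degree p"
    have m: "m \<in> degs V" using degsI[OF less.prems False] by (simp add: m_def)
    note gm = g[OF m]
    define a where "a = lead_coeff p / lead_coeff (g m)"
    define q where "q = p - smult a (g m)"
    have qV: "q \<in> V"
      using less.prems gm V by (simp add: q_def upoly.subspace_diff upoly.subspace_scale)
    have p_eq: "p = q + smult a (g m)" by (simp add: q_def)
    have "coeff (g m) m \<noteq> 0" using gm leading_coeff_0_iff[of "g m"] by simp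
    then have "coeff q m = 0" using gm by (simp add: q_def a_def m_def)
    moreover have "degree q \<le> m"
      unfolding q_def using gm by (intro degree_diff_le) (simp_all add: m_def)
    ultimately have q: "q = 0 \<or> degree q < m"
      using le_neq_implies_less[of "degree q" m] by (metis leading_coeff_0_iff)
    show ?thesis
    proof (cases "q = 0")
      case True
      have "(\<Sum>l\<le>m. smult (if l = m then a else 0) (g l)) = (\<Sum>l\<le>m. if l = m then smult a (g m) else 0)"
        by (rule sum.cong) auto
      also have "\<dots> = p" using True p_eq by simp
      finally show ?thesis using m unfolding m_def[symmetric]
        by (intro exI[of _ "\<lambda>l. if l = m then a else 0"]) auto
    next
      case False
      then have "degree q < degree p" using q by (simp add: m_def)
      from less.hyps[OF this qV] obtain c where
        c: "\<And>l. c l \<noteq> 0 \<Longrightarrow> l \<in> degs V \<and> l \<le> degree q" and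
        qc: "q = (\<Sum>l\<le>degree q. smult (c l) (g l))" by blast
      have ql: "degree q < m" using q False by simp
      define c' where "c' = c(m := a)"
      have "(\<Sum>l\<le>m. smult (c' l) (g l)) = (\<Sum>l<m. smult (c' l) (g l)) + smult a (g m)"
        by (simp add: c'_def lessThan_Suc_atMost[symmetric])
      also have "(\<Sum>l<m. smult (c' l) (g l)) = (\<Sum>l\<le>degree q. smult (c l) (g l))"
      proof (rule sum.mono_neutral_cong_right)
        show "\<forall>i\<in>{..<m} - {..degree q}. smult (c' i) (g i) = 0"
          using c by (auto simp: c'_def)
      qed (use ql in \<open>auto simp: c'_def\<close>)
      also note qc[symmetric]
      also note p_eq[symmetric]
      finally have "p = (\<Sum>l\<le>degree p. smult (c' l) (g l))" by (simp add: m_def)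
      moreover have "l \<in> degs V \<and> l \<le> m" if "c' l \<noteq> 0" for l
        using that c[of l] ql m by (cases "l = m") (simp_all add: c'_def)
      ultimately show ?thesis unfolding m_def by blast
    qed
  qed
qed

lemma expand_in_span:
  fixes g :: "nat \<Rightarrow> 'k::field poly"
  assumes V: "upoly.subspace V"
    and g: "\<And>b. b \<in> degs V \<Longrightarrow> g b \<in> V \<and> g b \<noteq> 0 \<and> degree (g b) = b"
    and p: "p \<in> V"
  shows "p \<in> upoly.span (g ` degs V)"
proof -
  obtain c where c: "\<And>l. c l \<noteq> 0 \<Longrightarrow> l \<in> degs V" and pc: "p = (\<Sum>l\<le>degree p. smult (c l) (g l))"
    using expand_by_degrees[OF assms] by blast
  have "smult (c l) (g l) \<in> upoly.span (g ` degs V)" for l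
    using c[of l] by (cases "c l = 0") (auto intro: upoly.span_zero upoly.span_scale upoly.span_base)
  then have "(\<Sum>l\<le>degree p. smult (c l) (g l)) \<in> upoly.span (g ` degs V)"
    by (intro upoly.span_sum)
  then show ?thesis using pc by metis
qed

text \<open>
  The term of largest degree with nonzero coefficient cannot be cancelled.
\<close>
lemma combination_of_distinct_degrees:
  fixes g :: "nat \<Rightarrow> 'k::field poly"
  assumes A: "finite A" and g: "\<And>l. l \<in> A \<Longrightarrow> g l \<noteq> 0 \<and> degree (g l) = l"
    and nz: "l0 \<in> A" "c l0 \<noteq> 0"
  defines "p \<equiv> \<Sum>l\<in>A. smult (c l) (g l)"
  shows "p \<noteq> 0 \<and> degree p \<in> A"
proof -
  define m where "m = Max {l \<in> A. c l \<noteq> 0}"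
  have fin: "finite {l \<in> A. c l \<noteq> 0}" and "{l \<in> A. c l \<noteq> 0} \<noteq> {}" using A nz by auto
  then have m: "m \<in> A" "c m \<noteq> 0" unfolding m_def using Max_in by blast+
  have m_max: "l \<le> m" if "l \<in> A" "c l \<noteq> 0" for l
    unfolding m_def using fin that by (intro Max_ge) auto
  have deg: "degree p \<le> m"
    unfolding p_def
  proof (rule degree_sum_le[OF A])
    fix l assume "l \<in> A"
    then show "degree (smult (c l) (g l)) \<le> m" using g m_max by (cases "c l = 0") auto
  qed
  have "coeff p m = (\<Sum>l\<in>A. if l = m then c m * coeff (g m) m else 0)"
    unfolding p_def coeff_sum
  proof (rule sum.cong)
    fix l assume l: "l \<in> A"
    show "coeff (smult (c l) (g l)) m = (if l = m then c m * coeff (g m) m else 0)"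
    proof (cases "l = m")
      case False
      then have "c l = 0 \<or> degree (g l) < m" using g[OF l] m_max[OF l] by fastforce
      then show ?thesis using False by (auto simp: coeff_eq_0)
    qed simp
  qed simp
  also have "\<dots> = c m * coeff (g m) m" using A m by simp
  finally have "coeff p m = c m * coeff (g m) m" .
  moreover have "coeff (g m) m \<noteq> 0" using g[OF m(1)] leading_coeff_0_iff[of "g m"] by simp
  ultimately have "coeff p m \<noteq> 0" using m by simp
  then have "degree p = m" "p \<noteq> 0" using deg le_degree[of p m] by auto
  then show ?thesis using m by simp
qed

section \<open>Initial ideals\<close>

lemma sum_of_monomials:
  "f = (\<Sum>k\<in>Poly_Mapping.keys f. scale (Poly_Mapping.lookup f k) (monomial k))"
proof (rule poly_mapping_eqI)
  fix k
  show "Poly_Mapping.lookup f k = Poly_Mapping.lookup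
      (\<Sum>k\<in>Poly_Mapping.keys f. scale (Poly_Mapping.lookup f k) (monomial k)) k"
    by (simp add: lookup_sum monomial_def mult_single lookup_single when_def in_keys_iff)
qed

lemma monomial_ideal:
  assumes A: "\<And>a b. (a, b) \<in> A \<Longrightarrow> (Suc a, b) \<in> A \<and> (a, Suc b) \<in> A"
  shows "ideal_generated_by (monomial ` A) = {f :: 'k::field bipoly. Poly_Mapping.keys f \<subseteq> A}"
proof
  have "ring_module.subspace {f :: 'k bipoly. Poly_Mapping.keys f \<subseteq> A}"
  proof (rule ideal_criterion)
    fix f :: "'k bipoly" assume f: "f \<in> {f. Poly_Mapping.keys f \<subseteq> A}"
    show "var_x * f \<in> {f. Poly_Mapping.keys f \<subseteq> A}"
    proof (clarify)
      fix a b assume "(a, b) \<in> Poly_Mapping.keys (var_x * f)"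
      then have "Suc 0 \<le> a" "Poly_Mapping.lookup f (a - 1, b) \<noteq> 0"
        by (auto simp: in_keys_iff lookup_single_times split: if_splits)
      then show "(a, b) \<in> A" using f A[of "a - 1" b] by (auto simp flip: in_keys_iff)
    qed
    show "var_y * f \<in> {f. Poly_Mapping.keys f \<subseteq> A}"
    proof (clarify)
      fix a b assume "(a, b) \<in> Poly_Mapping.keys (var_y * f)"
      then have "Suc 0 \<le> b" "Poly_Mapping.lookup f (a, b - 1) \<noteq> 0"
        by (auto simp: in_keys_iff lookup_single_times split: if_splits)
      then show "(a, b) \<in> A" using f A[of a "b - 1"] by (auto simp flip: in_keys_iff)
    qed
    fix c
    show "scale c f \<in> {f. Poly_Mapping.keys f \<subseteq> A}"
    proof (clarify)
      fix a b assume "(a, b) \<in> Poly_Mapping.keys (scale c f)"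
      then have "Poly_Mapping.lookup f (a, b) \<noteq> 0"
        by (auto simp: in_keys_iff lookup_single_times zero_prod_def)
      then show "(a, b) \<in> A" using f by (auto simp flip: in_keys_iff)
    qed
    fix g assume "g \<in> {f :: 'k bipoly. Poly_Mapping.keys f \<subseteq> A}"
    then show "f + g \<in> {f. Poly_Mapping.keys f \<subseteq> A}" using f Poly_Mapping.keys_add[of f g] by auto
  qed simp
  then show "ideal_generated_by (monomial ` A) \<subseteq> {f :: 'k bipoly. Poly_Mapping.keys f \<subseteq> A}"
    by (intro ring_module.span_minimal) (auto simp: monomial_def)
  show "{f :: 'k bipoly. Poly_Mapping.keys f \<subseteq> A} \<subseteq> ideal_generated_by (monomial ` A)"
  proof
    fix f :: "'k bipoly" assume f: "f \<in> {f. Poly_Mapping.keys f \<subseteq> A}"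
    have "(\<Sum>k\<in>Poly_Mapping.keys f. scale (Poly_Mapping.lookup f k) (monomial k))
        \<in> ideal_generated_by (monomial ` A)"
      using f by (intro ring_module.span_sum ring_module.span_scale ring_module.span_base) auto
    then show "f \<in> ideal_generated_by (monomial ` A)" by (simp flip: sum_of_monomials)
  qed
qed

lemma initial_monomial_homogenization:
  assumes "p \<noteq> 0" "degree p \<le> n"
  shows "initial_monomial (homogenization n p) = monomial (n - degree p, degree p)"
proof -
  have key: "(a, b) \<in> Poly_Mapping.keys (homogenization n p) \<longleftrightarrow> a + b = n \<and> coeff p b \<noteq> 0" for a b
    by (simp add: in_keys_iff lookup_homogenization)
  have "arg_max_on snd (Poly_Mapping.keys (homogenization n p)) = (n - degree p, degree p)"
    unfolding arg_max_on_def
  proof (rule arg_maxI)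
    show top: "(n - degree p, degree p) \<in> Poly_Mapping.keys (homogenization n p)"
      using assms by (simp add: key)
    show "\<not> snd (n - degree p, degree p) < snd k" if "k \<in> Poly_Mapping.keys (homogenization n p)" for k
      using that le_degree[of p "snd k"] by (cases k) (simp add: key)
    fix k assume k: "k \<in> Poly_Mapping.keys (homogenization n p)"
      and "\<forall>y. y \<in> Poly_Mapping.keys (homogenization n p) \<longrightarrow> \<not> snd k < snd y"
    then have "degree p \<le> snd k" using top by fastforce
    moreover have "snd k \<le> degree p" "fst k + snd k = n"
      using k le_degree[of p "snd k"] by (cases k; simp add: key)+
    ultimately show "k = (n - degree p, degree p)" by (cases k) auto
  qed
  then show ?thesis by (simp add: initial_monomial_def)
qed

text \<open>
  The degrees occurring in \<open>V (a + b)\<close> are the $y$-exponents of the initial monomials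
  of that degree; the chain conditions say that these monomials are closed under multiplication by
  the variables.
\<close>
lemma initial_ideal_of_chain:
  assumes V: "form_chain V"
  shows "initial_ideal (ideal_of V) = {f. Poly_Mapping.keys f \<subseteq> {(a, b). b \<in> degs (V (a + b))}}"
proof -
  have "initial_monomial ` (ideal_of V \<inter> (\<Union>n. forms n) - {0})
      = monomial ` {(a, b). b \<in> degs (V (a + b))}" (is "?L = ?R")
  proof
    show "?L \<subseteq> ?R"
    proof
      fix m assume "m \<in> ?L"
      then obtain f n where f: "f \<in> ideal_of V" "f \<in> forms n" "f \<noteq> 0" "m = initial_monomial f"
        by blast
      define p where "p = slice n f"
      have fp: "f = homogenization n p" using f by (simp add: p_def homogenization_slice)
      have p: "p \<in> V n" "degree p \<le> n" using f by (simp_all add: p_def ideal_of_def degree_slice)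
      have "p \<noteq> 0" using fp f(3) by auto
      note p = p this
      then have "m = monomial (n - degree p, degree p)"
        unfolding f(4) fp by (intro initial_monomial_homogenization)
      moreover have "degree p \<in> degs (V n)" using p by (simp add: degsI)
      ultimately show "m \<in> ?R" using p by (intro image_eqI) auto
    qed
    show "?R \<subseteq> ?L"
    proof
      fix m :: "'a bipoly" assume "m \<in> ?R"
      then obtain a b where b: "b \<in> degs (V (a + b))" and m: "m = monomial (a, b)" by auto
      then obtain p where p: "p \<in> V (a + b)" "p \<noteq> 0" "degree p = b" by (auto simp: degs_def)
      define f where "f = homogenization (a + b) p"
      have "slice (a + b) f = p" using p by (simp add: f_def slice_homogenization)
      then have "f \<noteq> 0" using p by auto
      moreover have "f \<in> ideal_of V" unfolding f_def using p
        by (subst homogenization_in_ideal_of[OF V]) auto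
      moreover have "m = initial_monomial f"
        using p by (simp add: f_def initial_monomial_homogenization m)
      moreover have "f \<in> forms (a + b)" by (simp add: f_def)
      ultimately show "m \<in> ?L" by blast
    qed
  qed
  moreover have "ideal_generated_by (monomial ` {(a, b). b \<in> degs (V (a + b))})
     = {f :: 'a bipoly. Poly_Mapping.keys f \<subseteq> {(a, b). b \<in> degs (V (a + b))}}"
  proof (rule monomial_ideal)
    fix a b assume "(a, b) \<in> {(a, b). b \<in> degs (V (a + b))}"
    then obtain p where p: "p \<in> V (a + b)" "p \<noteq> 0" "degree p = b" by (auto simp: degs_def)
    have "b \<in> degs (V (Suc a + b))" using degsI[of p "V (Suc a + b)"] p form_chain_x[OF V p(1)] by simp
    moreover have "Suc b \<in> degs (V (a + Suc b))"
      using degsI[of "pCons 0 p" "V (a + Suc b)"] p form_chain_y[OF V p(1)] by simp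
    ultimately show "(Suc a, b) \<in> {(a, b). b \<in> degs (V (a + b))} \<and>
        (a, Suc b) \<in> {(a, b). b \<in> degs (V (a + b))}" by simp
  qed
  ultimately show ?thesis by (simp add: initial_ideal_def)
qed

text \<open>
  The degree of the generator $x^{q_b} y^b$ of $E_P$, where $q_b$ is part number \<open>b\<close>
  of \<open>P\<close>, counted from zero, and zero after the last part. A partition is the same
  thing as this sequence, and almost everything below is a statement about the sequence.
\<close>
definition generator_degree :: "nat list \<Rightarrow> nat \<Rightarrow> nat" where
  "generator_degree P b = (if b < length P then P ! b else 0) + b"

lemma C_set_iff: "(a, b) \<in> C_set P \<longleftrightarrow> a + b < generator_degree P b"
  by (auto simp: C_set_def generator_degree_def)

lemma generator_degree_ge: "b \<le> generator_degree P b"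
  by (simp add: generator_degree_def)

text \<open>
  The parts decrease weakly, so the only possible ascent of this sequence is by one.
\<close>
lemma generator_degree_Suc:
  assumes "is_partition P"
  shows "generator_degree P (Suc b) \<le> Suc (generator_degree P b)"
  using assms by (auto simp: generator_degree_def is_partition_def sorted_wrt_iff_nth_less)

lemma E_ideal_eq:
  assumes "is_partition P"
  shows "E_ideal P = {f :: 'k::field bipoly. Poly_Mapping.keys f \<subseteq> - C_set P}"
  unfolding E_ideal_def
proof (rule monomial_ideal)
  fix a b assume "(a, b) \<in> - C_set P"
  then show "(Suc a, b) \<in> - C_set P \<and> (a, Suc b) \<in> - C_set P"
    using generator_degree_Suc[OF assms, of b] by (simp add: C_set_iff)
qed

definition cell_chain :: "(nat \<Rightarrow> nat) \<Rightarrow> (nat \<Rightarrow> 'k::field poly set) \<Rightarrow> bool" where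
  "cell_chain D V \<longleftrightarrow> form_chain V \<and> (\<forall>n. degs (V n) = {b. D b \<le> n})"

lemma jordan_cell_iff:
  assumes P: "is_partition P"
  shows "I \<in> jordan_cell P \<longleftrightarrow> (\<exists>V. cell_chain (generator_degree P) V \<and> I = ideal_of V)"
proof -
  have "initial_ideal (ideal_of V) = E_ideal P \<longleftrightarrow> (\<forall>n. degs (V n) = {b. generator_degree P b \<le> n})"
    if V: "form_chain V" for V :: "nat \<Rightarrow> 'a poly set"
  proof -
    have inj: "{f :: 'a bipoly. Poly_Mapping.keys f \<subseteq> A} = {f. Poly_Mapping.keys f \<subseteq> B} \<longleftrightarrow> A = B" for A B
    proof
      assume eq: "{f :: 'a bipoly. Poly_Mapping.keys f \<subseteq> A} = {f. Poly_Mapping.keys f \<subseteq> B}"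
      have "k \<in> A \<longleftrightarrow> k \<in> B" for k
        using eq[unfolded set_eq_iff, rule_format, of "Poly_Mapping.single k 1"] by simp
      then show "A = B" by blast
    qed simp
    have "{(a, b). b \<in> degs (V (a + b))} = - C_set P \<longleftrightarrow>
        (\<forall>n. degs (V n) = {b. generator_degree P b \<le> n})" (is "?L = _ \<longleftrightarrow> ?R")
    proof
      assume eq: "?L = - C_set P"
      show ?R
      proof (intro allI set_eqI)
        fix n b
        have "b \<le> n" if "b \<in> degs (V n)" using that form_chain_degree[OF V] by (auto simp: degs_def)
        moreover have "b \<le> n" if "generator_degree P b \<le> n"
          using that generator_degree_ge[of b P] by simp
        moreover have "b \<in> degs (V n) \<longleftrightarrow> generator_degree P b \<le> n" if "b \<le> n"
          using eq[unfolded set_eq_iff, rule_format, of "(n - b, b)"] that by (simp add: C_set_iff not_less)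
        ultimately show "b \<in> degs (V n) \<longleftrightarrow> b \<in> {b. generator_degree P b \<le> n}" by blast
      qed
    next
      assume R: ?R
      show "?L = - C_set P" by (auto simp: R C_set_iff not_less)
    qed
    then show ?thesis unfolding initial_ideal_of_chain[OF V] E_ideal_eq[OF P] inj .
  qed
  then show ?thesis unfolding jordan_cell_def graded_ideal_iff cell_chain_def by blast
qed

lemma ideal_of_eq_0:
  assumes "\<And>n. slice n f = 0"
  shows "f = 0"
  using sum_of_components[of f] assms by simp

text \<open>
  An element of the reduced row echelon basis of \<open>V n\<close> with respect to descending
  powers of $y$: among the degrees occurring in \<open>V n\<close>, only \<open>b\<close> has a
  nonzero coefficient.
\<close>
definition reduced_form :: "(nat \<Rightarrow> nat) \<Rightarrow> (nat \<Rightarrow> 'k::field poly set) \<Rightarrow> nat \<Rightarrow> nat \<Rightarrow> 'k poly \<Rightarrow> bool" where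
  "reduced_form D V n b p \<longleftrightarrow> p \<in> V n \<and> coeff p b = 1 \<and>
     (\<forall>s. coeff p s \<noteq> 0 \<longrightarrow> s = b \<or> n < D s)"

text \<open>
  The polynomial selected in the definition of the coordinates is the homogenization of the
  reduced element. For uniqueness, the difference of two candidates lies in the ideal and has all
  its monomials in \<open>C_set P\<close>, hence has no initial monomial in any degree.
\<close>
lemma cell_coordinate_eq:
  assumes V: "cell_chain (generator_degree P) V"
    and p: "reduced_form (generator_degree P) V (a + b) b p"
  shows "cell_coordinate P (a, b) m (ideal_of V) = Poly_Mapping.lookup (homogenization (a + b) p) m"
proof -
  let ?Q = "\<lambda>f. f \<in> ideal_of V \<and> Poly_Mapping.keys f \<subseteq> insert (a, b) (C_set P) \<and> Poly_Mapping.lookup f (a, b) = 1"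
  have chain: "form_chain V" and degs: "degs (V n) = {b. generator_degree P b \<le> n}" for n
    using V by (auto simp: cell_chain_def)
  have pV: "p \<in> V (a + b)" and pb: "coeff p b = 1"
    and red: "\<And>s. coeff p s \<noteq> 0 \<Longrightarrow> s = b \<or> a + b < generator_degree P s"
    using p by (auto simp: reduced_form_def)
  have ex: "?Q (homogenization (a + b) p)"
  proof (intro conjI subsetI)
    show "homogenization (a + b) p \<in> ideal_of V"
      using homogenization_in_ideal_of[OF chain form_chain_degree[OF chain pV]] pV by simp
    show "Poly_Mapping.lookup (homogenization (a + b) p) (a, b) = 1"
      by (simp add: lookup_homogenization pb)
    fix k assume k: "k \<in> Poly_Mapping.keys (homogenization (a + b) p)"
    obtain a' b' where ab: "k = (a', b')" by fastforce
    have "a' + b' = a + b" "coeff p b' \<noteq> 0"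
      using k by (auto simp: ab in_keys_iff lookup_homogenization split: if_splits)
    then show "k \<in> insert (a, b) (C_set P)" using red[of b'] by (auto simp: ab C_set_iff)
  qed
  have uniq: "f = g" if f: "?Q f" and g: "?Q g" for f g
  proof -
    let ?h = "f - g"
    have h: "slice n ?h \<in> V n" for n
    proof -
      have "?h \<in> ideal_of V"
        using f g subspace_ideal_of[OF chain] by (simp add: ring_module.subspace_diff)
      then show ?thesis by (simp add: ideal_of_def)
    qed
    have keys: "k \<in> C_set P" if "Poly_Mapping.lookup ?h k \<noteq> 0" for k
    proof -
      have "k \<noteq> (a, b)" using that f g by (auto simp: lookup_minus)
      moreover have "k \<in> Poly_Mapping.keys f \<union> Poly_Mapping.keys g"
        using that by (auto simp: lookup_minus in_keys_iff)
      ultimately show ?thesis using f g by blast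
    qed
    have "slice n ?h = 0" for n
    proof (rule ccontr)
      assume nz: "slice n ?h \<noteq> 0"
      define s where "s = degree (slice n ?h)"
      have "s \<in> degs (V n)" unfolding s_def by (rule degsI[OF h nz])
      then have "generator_degree P s \<le> n" by (simp add: degs)
      moreover have "coeff (slice n ?h) s \<noteq> 0" using nz by (simp add: s_def)
      then have "s \<le> n" "Poly_Mapping.lookup ?h (n - s, s) \<noteq> 0"
        by (auto simp: coeff_slice split: if_splits)
      then have "n < generator_degree P s" using keys[of "(n - s, s)"] by (simp add: C_set_iff)
      ultimately show False by simp
    qed
    then have "?h = 0" by (rule ideal_of_eq_0)
    then show ?thesis by simp
  qed
  have "(THE f. ?Q f) = homogenization (a + b) p"
  proof (rule the_equality)
    show "?Q (homogenization (a + b) p)" by (rule ex)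
    show "f = homogenization (a + b) p" if "?Q f" for f by (rule uniq[OF that ex])
  qed
  then show ?thesis by (simp add: cell_coordinate_def)
qed

section \<open>The Hilbert function\<close>

lemma dim_monomial_forms:
  assumes A: "A \<subseteq> {..n}"
  shows "bipoly.dim {f :: 'k::field bipoly. Poly_Mapping.keys f \<subseteq> (\<lambda>b. (n - b, b)) ` A} = card A"
proof -
  let ?m = "\<lambda>b. (n - b, b)"
  have fin: "finite A" using A finite_subset by blast
  have inj: "inj_on (\<lambda>b. monomial (?m b) :: 'k bipoly) A"
  proof (rule inj_onI)
    fix x y assume "monomial (?m x) = (monomial (?m y) :: 'k bipoly)"
    then have "Poly_Mapping.keys (monomial (?m x) :: 'k bipoly) = Poly_Mapping.keys (monomial (?m y) :: 'k bipoly)"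
      by simp
    then show "x = y" by (simp add: monomial_def)
  qed
  show ?thesis
  proof (rule bipoly.dim_unique)
    let ?B = "(\<lambda>b. monomial (?m b) :: 'k bipoly) ` A"
    show "?B \<subseteq> {f. Poly_Mapping.keys f \<subseteq> ?m ` A}" by (auto simp: monomial_def)
    show "card ?B = card A" using inj by (rule card_image)
    show "{f. Poly_Mapping.keys f \<subseteq> ?m ` A} \<subseteq> bipoly.span ?B"
    proof
      fix f :: "'k bipoly" assume f: "f \<in> {f. Poly_Mapping.keys f \<subseteq> ?m ` A}"
      have "(\<Sum>k\<in>Poly_Mapping.keys f. scale (Poly_Mapping.lookup f k) (monomial k)) \<in> bipoly.span ?B"
        using f by (intro bipoly.span_sum bipoly.span_scale bipoly.span_base) auto
      then show "f \<in> bipoly.span ?B" by (simp flip: sum_of_monomials)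
    qed
    show "bipoly.independent ?B"
    proof (rule bipoly.independent_if_scalars_zero)
      fix u and x :: "'k bipoly" assume 0: "(\<Sum>x\<in>?B. scale (u x) x) = 0" and x: "x \<in> ?B"
      then obtain b where b: "b \<in> A" "x = monomial (?m b)" by blast
      have "0 = Poly_Mapping.lookup (\<Sum>b\<in>A. scale (u (monomial (?m b))) (monomial (?m b))) (?m b)"
        using 0 by (simp add: sum.reindex[OF inj])
      also have "\<dots> = (\<Sum>b'\<in>A. if b' = b then u (monomial (?m b)) else 0)"
        unfolding lookup_sum by (rule sum.cong) (auto simp: monomial_def mult_single lookup_single when_def)
      also have "\<dots> = u x" using b fin by simp
      finally show "u x = 0" by simp
    qed (use fin in simp)
  qed
qed

lemma diagonal_lengths_eq:
  assumes P: "is_partition P"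
  shows "diagonal_lengths TYPE('k::field) P n = Suc n - card {b. generator_degree P b \<le> n}"
proof -
  let ?m = "\<lambda>b. (n - b, b)" let ?S = "{b. generator_degree P b \<le> n}"
  have S: "?S \<subseteq> {..n}" using generator_degree_ge[of _ P] order_trans by fastforce
  have m: "k \<in> ?m ` {..n} \<longleftrightarrow> fst k + snd k = n" for k :: "nat \<times> nat"
    by (cases k) (auto simp: image_iff)
  have 1: "forms n = {f :: 'k bipoly. Poly_Mapping.keys f \<subseteq> ?m ` {..n}}"
    unfolding forms_def subset_iff m by auto
  have "k \<in> ?m ` ?S \<longleftrightarrow> k \<notin> C_set P \<and> fst k + snd k = n" for k :: "nat \<times> nat"
    using S by (cases k) (auto simp: image_iff C_set_iff not_less)
  then have 2: "E_ideal P \<inter> forms n = {f :: 'k bipoly. Poly_Mapping.keys f \<subseteq> ?m ` ?S}"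
    unfolding E_ideal_eq[OF P] forms_def subset_iff by auto
  have "bipoly.dim (forms n :: 'k bipoly set) = Suc n" unfolding 1 by (subst dim_monomial_forms) auto
  moreover have "bipoly.dim (E_ideal P \<inter> forms n :: 'k bipoly set) = card ?S"
    unfolding 2 by (rule dim_monomial_forms[OF S])
  ultimately show ?thesis by (simp add: diagonal_lengths_def hilbert_function_def)
qed

section \<open>Counting generators degree by degree\<close>

lemma (in vector_space) finite_span_subset:
  assumes "finite E" "E \<subseteq> span (S \<union> B)"
  shows "\<exists>B0 \<subseteq> B. finite B0 \<and> E \<subseteq> span (S \<union> B0)"
  using assms
proof (induction E rule: finite_induct)
  case empty
  then show ?case by blast
next
  case (insert e E)
  then obtain B0 where B0: "B0 \<subseteq> B" "finite B0" "E \<subseteq> span (S \<union> B0)" by blast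
  have "e \<in> span (S \<union> B)" using insert.prems by simp
  then obtain t r where t: "finite t" "t \<subseteq> S \<union> B" "e = (\<Sum>a\<in>t. scale (r a) a)"
    unfolding span_explicit by auto
  have "e \<in> span (S \<union> (B0 \<union> (t \<inter> B)))"
    unfolding t(3) using t(2) by (intro span_sum span_scale span_base) auto
  moreover have "E \<subseteq> span (S \<union> (B0 \<union> (t \<inter> B)))"
    using B0(3) span_mono[of "S \<union> B0" "S \<union> (B0 \<union> (t \<inter> B))"] by blast
  ultimately have "insert e E \<subseteq> span (S \<union> (B0 \<union> (t \<inter> B)))" by blast
  moreover have "B0 \<union> (t \<inter> B) \<subseteq> B" "finite (B0 \<union> (t \<inter> B))" using B0 t by auto
  ultimately show ?case by blast
qed

text \<open>
  The dimension bound for the quotient by \<open>U\<close>, without forming the quotient: a basis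
  of \<open>U\<close> is cut down to the finitely many vectors needed to express \<open>E\<close>,
  and the exchange lemma is applied to both sets enlarged by these.
\<close>
lemma (in vector_space) card_independent_modulo_le:
  assumes U: "subspace U" and S: "finite S" and E: "finite E" "E \<subseteq> span (S \<union> U)"
    and ind: "\<And>c e. (\<Sum>e\<in>E. scale (c e) e) \<in> U \<Longrightarrow> e \<in> E \<Longrightarrow> c e = 0"
  shows "card E \<le> card S"
proof -
  obtain B where B: "B \<subseteq> U" "independent B" "U \<subseteq> span B"
    using maximal_independent_subset[of U] by blast
  have "span (S \<union> U) \<subseteq> span (S \<union> B)"
    using B(3) span_mono[of B "S \<union> B"] span_mono[of S "S \<union> B"] span_superset[of S]
    by (intro span_minimal) (auto intro: span_base)
  then have "E \<subseteq> span (S \<union> B)" using E by blast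
  then obtain B0 where B0: "B0 \<subseteq> B" "finite B0" "E \<subseteq> span (S \<union> B0)"
    using finite_span_subset[OF E(1), of S B] by blast
  have disj: "E \<inter> B0 = {}"
  proof (rule ccontr)
    assume "E \<inter> B0 \<noteq> {}"
    then obtain e where e: "e \<in> E" "e \<in> U" using B B0 by blast
    have "(\<Sum>x\<in>E. scale (if x = e then 1 else 0) x) = (\<Sum>x\<in>E. if x = e then e else 0)"
      by (rule sum.cong) auto
    also have "\<dots> = e" using e E by simp
    finally show False using ind[of "\<lambda>x. if x = e then 1 else 0" e] e by simp
  qed
  have "independent (E \<union> B0)"
  proof (rule independent_if_scalars_zero)
    show "finite (E \<union> B0)" using E B0 by simp
    fix f x assume 0: "(\<Sum>x\<in>E \<union> B0. scale (f x) x) = 0" and x: "x \<in> E \<union> B0"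
    have "(\<Sum>x\<in>E. scale (f x) x) + (\<Sum>x\<in>B0. scale (f x) x) = 0"
      using 0 E B0 disj by (simp add: sum.union_disjoint)
    then have sum: "(\<Sum>x\<in>E. scale (f x) x) = - (\<Sum>x\<in>B0. scale (f x) x)" by (rule eq_neg_iff_add_eq_0[THEN iffD2])
    have "- (\<Sum>x\<in>B0. scale (f x) x) \<in> U"
      using B B0 by (intro subspace_neg[OF U] subspace_sum[OF U] subspace_scale[OF U]) auto
    then have zE: "f x = 0" if "x \<in> E" for x using ind[of f x] sum that by simp
    have "(\<Sum>x\<in>B0. scale (f x) x) = 0" using sum zE by simp
    then have "f x = 0" if "x \<in> B0" for x
      using independentD[OF B(2) B0(2,1), of f x] that by simp
    then show "f x = 0" using zE x by blast
  qed
  then have "card (E \<union> B0) \<le> card (S \<union> B0)"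
    using independent_span_bound[of "S \<union> B0" "E \<union> B0"] S B0 span_superset[of "S \<union> B0"] by auto
  then show ?thesis using disj E B0 card_Un_le[of S B0] by (simp add: card_Un_disjoint)
qed

text \<open>
  The part of degree \<open>n\<close> of the product of the ideal with the maximal ideal generated
  by the variables.
\<close>
definition step_space :: "(nat \<Rightarrow> 'k::field poly set) \<Rightarrow> nat \<Rightarrow> 'k poly set" where
  "step_space V n = (case n of 0 \<Rightarrow> {0} | Suc m \<Rightarrow> {p + pCons 0 q | p q. p \<in> V m \<and> q \<in> V m})"

lemma step_space_0 [simp]: "step_space V 0 = {0}"
  and step_space_Suc: "step_space V (Suc m) = {p + pCons 0 q | p q. p \<in> V m \<and> q \<in> V m}"
  by (simp_all add: step_space_def)

lemma step_space_x: "form_chain V \<Longrightarrow> p \<in> V n \<Longrightarrow> p \<in> step_space V (Suc n)"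
  using upoly.subspace_0[OF form_chain_subspace, of V n] by (force simp: step_space_Suc)

lemma step_space_y: "form_chain V \<Longrightarrow> p \<in> V n \<Longrightarrow> pCons 0 p \<in> step_space V (Suc n)"
  using upoly.subspace_0[OF form_chain_subspace, of V n] by (force simp: step_space_Suc)

lemma subspace_step_space:
  assumes V: "form_chain V"
  shows "upoly.subspace (step_space V n)"
proof (cases n)
  case (Suc m)
  note sub = form_chain_subspace[OF V, of m]
  show ?thesis unfolding Suc
  proof (rule upoly.subspaceI)
    show "0 \<in> step_space V (Suc m)" using step_space_x[OF V upoly.subspace_0[OF sub]] .
    fix p q assume "p \<in> step_space V (Suc m)" "q \<in> step_space V (Suc m)"
    then obtain p1 p2 q1 q2 where pq: "p1 \<in> V m" "p2 \<in> V m" "q1 \<in> V m" "q2 \<in> V m"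
      "p = p1 + pCons 0 p2" "q = q1 + pCons 0 q2" by (auto simp: step_space_Suc)
    have "p + q = (p1 + q1) + pCons 0 (p2 + q2)" using pq by simp
    then show "p + q \<in> step_space V (Suc m)"
      unfolding step_space_Suc using pq upoly.subspace_add[OF sub] by blast
  next
    fix c p assume "p \<in> step_space V (Suc m)"
    then obtain p1 p2 where p: "p1 \<in> V m" "p2 \<in> V m" "p = p1 + pCons 0 p2"
      by (auto simp: step_space_Suc)
    have "smult c p = smult c p1 + pCons 0 (smult c p2)" using p by (simp add: smult_add_right)
    then show "smult c p \<in> step_space V (Suc m)"
      unfolding step_space_Suc using p upoly.subspace_scale[OF sub] by blast
  qed
qed (simp add: upoly.subspace_single_0)

lemma step_space_subset:
  assumes "form_chain V"
  shows "step_space V n \<subseteq> V n"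
proof (cases n)
  case 0
  then show ?thesis using upoly.subspace_0[OF form_chain_subspace[OF assms]] by simp
next
  case (Suc m)
  then show ?thesis
    using form_chain_x[OF assms] form_chain_y[OF assms] upoly.subspace_add[OF form_chain_subspace[OF assms]]
    by (auto simp: step_space_Suc)
qed

lemma form_chain_step_space:
  assumes "form_chain V"
  shows "form_chain (step_space V)"
proof -
  note s = step_space_subset[OF assms]
  show ?thesis
    unfolding form_chain_def
    using subspace_step_space[OF assms] form_chain_degree[OF assms] s
      step_space_x[OF assms] step_space_y[OF assms] by (metis subsetD)
qed

lemma homogenization_sum: "homogenization n (sum f A) = (\<Sum>a\<in>A. homogenization n (f a))"
  by (induction A rule: infinite_finite_induct) (simp_all add: homogenization_add)

lemma degs_mono: "V \<subseteq> W \<Longrightarrow> degs V \<subseteq> degs W"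
  by (auto simp: degs_def)

lemma finite_degs: "form_chain V \<Longrightarrow> finite (degs (V n))"
  by (rule finite_subset[of _ "{..n}"]) (auto simp: degs_def form_chain_degree)

text \<open>
  Graded Nakayama. The dimension of a space of polynomials is the number of degrees occurring in
  it, so the number of generators needed in degree \<open>n\<close> can be read off from degrees.
\<close>
theorem min_generators_ideal_of:
  fixes V :: "nat \<Rightarrow> 'k::field poly set"
  assumes V: "form_chain V" and M: "\<And>n. M < n \<Longrightarrow> V n \<subseteq> step_space V n"
  shows "min_generators (ideal_of V) = (\<Sum>n\<le>M. card (degs (V n) - degs (step_space V n)))"
proof -
  let ?W = "step_space V" let ?I = "ideal_of V"
  define G where "G n = degs (V n) - degs (?W n)" for n
  have finG: "finite (G n)" for n unfolding G_def using finite_degs[OF V] by simp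
  note subV = form_chain_subspace[OF V] and subW = subspace_step_space[OF V]
  define p where "p n b = (SOME p. p \<in> V n \<and> p \<noteq> 0 \<and> degree p = b \<and> (b \<in> degs (?W n) \<longrightarrow> p \<in> ?W n))" for n b
  have ex: "\<exists>p. p \<in> V n \<and> p \<noteq> 0 \<and> degree p = b \<and> (b \<in> degs (?W n) \<longrightarrow> p \<in> ?W n)"
    if "b \<in> degs (V n)" for n b
  proof (cases "b \<in> degs (?W n)")
    case True
    then show ?thesis using step_space_subset[OF V, of n] by (auto simp: degs_def)
  next
    case False
    then show ?thesis using that by (auto simp: degs_def)
  qed
  have p: "p n b \<in> V n \<and> p n b \<noteq> 0 \<and> degree (p n b) = b \<and> (b \<in> degs (?W n) \<longrightarrow> p n b \<in> ?W n)"
    if "b \<in> degs (V n)" for n b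
    unfolding p_def by (rule someI_ex[OF ex[OF that]])
  have pG: "p n b \<in> V n" "p n b \<noteq> 0" "degree (p n b) = b" "degree (p n b) \<le> n" if "b \<in> G n" for n b
    using p[of b n] that form_chain_degree[OF V, of "p n b" n] by (auto simp: G_def)
  define Gens where "Gens = Sigma {..M} G"
  define e where "e = (\<lambda>(n, b). homogenization n (p n b))"
  have fin: "finite Gens" unfolding Gens_def using finG by blast
  have slice_e: "slice m (e (n, b)) = (if m = n then p n b else 0)" if "b \<in> G n" for m n b
    using pG[OF that] by (simp add: e_def slice_homogenization)
  have inj: "inj_on e Gens"
  proof (rule inj_onI)
    fix i i' assume i: "i \<in> Gens" "i' \<in> Gens" "e i = e i'"
    obtain n b n' b' where ii: "i = (n, b)" "i' = (n', b')" by fastforce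
    have b: "b \<in> G n" "b' \<in> G n'" using i by (auto simp: ii Gens_def)
    have "slice n (e (n, b)) = slice n (e (n', b'))" using i ii by simp
    then have "p n b = (if n = n' then p n' b' else 0)" using slice_e b by simp
    then have "n = n'" "p n b = p n' b'" using pG(2)[OF b(1)] by (auto split: if_splits)
    moreover have "b = b'" using pG(3)[OF b(1)] pG(3)[OF b(2)] calculation(2) by metis
    ultimately show "i = i'" by (simp only: ii)
  qed
  have card: "card (e ` Gens) = (\<Sum>n\<le>M. card (G n))"
    using card_image[OF inj] finG by (simp add: Gens_def card_SigmaI)
  have eI: "e i \<in> ?I" if "i \<in> Gens" for i
    using that pG homogenization_in_ideal_of[OF V] by (auto simp: Gens_def e_def)
  note idealI = subspace_ideal_of[OF V]
  note idealW = subspace_ideal_of[OF form_chain_step_space[OF V]]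
  have WI: "ideal_of ?W \<subseteq> ?I" using step_space_subset[OF V] by (simp add: ideal_of_def subset_iff)
  have k_subspace: "bipoly.subspace J" if "ring_module.subspace J" for J :: "'k bipoly set"
    using ring_module.subspace_0[OF that] ring_module.subspace_add[OF that] ring_module.subspace_scale[OF that]
    by (intro bipoly.subspaceI)
  \<comment> \<open>The chosen forms generate, by induction on the degree: the degrees of \<open>V n\<close> not covered by them
    are realised in the step space.\<close>
  have step: "homogenization n q \<in> ring_module.span (e ` Gens)"
    if W: "\<And>r. r \<in> ?W n \<Longrightarrow> homogenization n r \<in> ring_module.span (e ` Gens)"
      and q: "q \<in> V n" for n q
    proof (cases "n \<le> M")
      case True
      have "p n b \<in> V n \<and> p n b \<noteq> 0 \<and> degree (p n b) = b" if "b \<in> degs (V n)" for b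
        using p[OF that] by blast
      from expand_by_degrees[OF subV this q] obtain c where
        c: "\<And>l. c l \<noteq> 0 \<Longrightarrow> l \<in> degs (V n)" and qc: "q = (\<Sum>l\<le>degree q. smult (c l) (p n l))"
        by blast
      have "homogenization n (smult (c l) (p n l)) \<in> ring_module.span (e ` Gens)" for l
      proof (cases "c l = 0")
        case False
        then have l: "l \<in> degs (V n)" by (rule c)
        have "homogenization n (p n l) \<in> ring_module.span (e ` Gens)"
        proof (cases "l \<in> degs (?W n)")
          case True then show ?thesis using W p[OF l] by blast
        next
          case False
          then have "(n, l) \<in> Gens" using l True by (simp add: Gens_def G_def)
          then have "e (n, l) \<in> ring_module.span (e ` Gens)" by (intro ring_module.span_base imageI)
          then show ?thesis by (simp add: e_def)
        qed
        then show ?thesis unfolding homogenization_scale by (rule ring_module.span_scale)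
      qed (simp add: ring_module.span_zero)
      then have "homogenization n (\<Sum>l\<le>degree q. smult (c l) (p n l)) \<in> ring_module.span (e ` Gens)"
        unfolding homogenization_sum by (intro ring_module.span_sum)
      then show ?thesis using qc by metis
    next
      case False
      then show ?thesis using M[of n] q W by auto
    qed
  have gen: "homogenization n q \<in> ring_module.span (e ` Gens)" if "q \<in> V n" for n q
    using that
  proof (induction n arbitrary: q)
    case 0
    show ?case by (rule step[OF _ 0]) (simp add: ring_module.span_zero)
  next
    case (Suc n)
    show ?case
    proof (rule step[OF _ Suc.prems])
      fix r assume "r \<in> ?W (Suc n)"
      then obtain r1 r2 where r: "r1 \<in> V n" "r2 \<in> V n" "r = r1 + pCons 0 r2" by (auto simp: step_space_Suc)
      have "homogenization (Suc n) r = var_x * homogenization n r1 + var_y * homogenization n r2"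
        using form_chain_degree[OF V r(1)]
        by (simp add: r(3) homogenization_add homogenization_x homogenization_y)
      then show "homogenization (Suc n) r \<in> ring_module.span (e ` Gens)"
        using Suc.IH r by (simp add: ring_module.span_add ring_module.span_scale)
    qed
  qed
  have "?I \<subseteq> ring_module.span (e ` Gens)"
  proof
    fix f assume f: "f \<in> ?I"
    have "(\<Sum>n\<le>N. homogenization n (slice n f)) \<in> ring_module.span (e ` Gens)" for N
    proof (rule ring_module.span_sum)
      fix n show "homogenization n (slice n f) \<in> ring_module.span (e ` Gens)"
        using f by (intro gen) (simp add: ideal_of_def)
    qed
    then show "f \<in> ring_module.span (e ` Gens)" using sum_of_components[of f] by metis
  qed
  moreover have "ring_module.span (e ` Gens) \<subseteq> ?I"
    using eI idealI by (intro ring_module.span_minimal) auto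
  ultimately have span: "ring_module.span (e ` Gens) = ?I" by blast
  \<comment> \<open>No generating set is smaller: modulo the forms whose slices lie in the step spaces, multiplying by a
    variable gives zero, so a generating set spans the quotient already over the field.\<close>
  have lower: "card (e ` Gens) \<le> card S" if S: "finite S" "ring_module.span S = ?I" for S
  proof (rule bipoly.card_independent_modulo_le[OF k_subspace[OF idealW] S(1)])
    show "finite (e ` Gens)" using fin by simp
    let ?J = "bipoly.span (S \<union> ideal_of ?W)"
    have JI: "?J \<subseteq> ?I"
    proof (rule bipoly.span_minimal[OF _ k_subspace[OF idealI]])
      show "S \<union> ideal_of ?W \<subseteq> ?I" using WI S(2) ring_module.span_superset[of S] by blast
    qed
    have "ring_module.subspace ?J"
    proof (rule ideal_criterion)
      fix f assume "f \<in> ?J"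
      then have "f \<in> ?I" using JI by blast
      then have f: "slice n f \<in> V n" for n by (simp add: ideal_of_def)
      have "slice n (var_x * f) \<in> ?W n" for n
        using step_space_x[OF V f] by (cases n) (simp_all add: slice_times_x)
      moreover have "slice n (var_y * f) \<in> ?W n" for n
        using step_space_y[OF V f] by (cases n) (simp_all add: slice_times_y)
      ultimately have "var_x * f \<in> ideal_of ?W" "var_y * f \<in> ideal_of ?W" by (simp_all add: ideal_of_def)
      then show "var_x * f \<in> ?J" "var_y * f \<in> ?J" by (simp_all add: bipoly.span_base)
    qed (simp_all add: bipoly.span_zero bipoly.span_add bipoly.span_scale)
    moreover have "S \<subseteq> ?J" using bipoly.span_superset[of "S \<union> ideal_of ?W"] by blast
    ultimately have "?I \<subseteq> ?J" unfolding S(2)[symmetric] by (intro ring_module.span_minimal)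
    then show "e ` Gens \<subseteq> ?J" using eI by blast
    fix c f assume sum: "(\<Sum>f\<in>e ` Gens. scale (c f) f) \<in> ideal_of ?W" and f: "f \<in> e ` Gens"
    obtain n b where nb: "n \<le> M" "b \<in> G n" "f = e (n, b)" using f by (auto simp: Gens_def)
    define q where "q = (\<Sum>b\<in>G n. smult (c (e (n, b))) (p n b))"
    have "slice n (\<Sum>f\<in>e ` Gens. scale (c f) f) = (\<Sum>i\<in>Gens. smult (c (e i)) (slice n (e i)))"
      unfolding sum.reindex[OF inj] slice_sum by (simp add: slice_scale)
    also have "\<dots> = (\<Sum>m\<le>M. \<Sum>b\<in>G m. smult (c (e (m, b))) (slice n (e (m, b))))"
      unfolding Gens_def using finG by (subst sum.Sigma) auto
    also have "\<dots> = (\<Sum>m\<le>M. if m = n then q else 0)"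
    proof (rule sum.cong)
      fix m show "(\<Sum>b\<in>G m. smult (c (e (m, b))) (slice n (e (m, b)))) = (if m = n then q else 0)"
        by (cases "m = n") (simp_all add: slice_e q_def)
    qed simp
    also have "\<dots> = q" using nb by simp
    finally have "slice n (\<Sum>f\<in>e ` Gens. scale (c f) f) = q" .
    moreover have "slice n (\<Sum>f\<in>e ` Gens. scale (c f) f) \<in> ?W n"
      using sum unfolding ideal_of_def by blast
    ultimately have qW: "q \<in> ?W n" by simp
    show "c f = 0"
    proof (rule ccontr)
      assume "c f \<noteq> 0"
      then have "q \<noteq> 0 \<and> degree q \<in> G n"
        unfolding q_def using nb pG by (intro combination_of_distinct_degrees[of _ _ b] finG) auto
      then show False using degsI[OF qW] by (simp add: G_def)
    qed
  qed
  have "min_generators ?I = card (e ` Gens)"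
    unfolding min_generators_def
  proof (rule Least_equality)
    show "\<exists>S. finite S \<and> card S = card (e ` Gens) \<and> ring_module.span S = ?I"
      using fin span by blast
  qed (use lower in blast)
  then show ?thesis using card by (simp add: G_def)
qed

section \<open>Adapted bases and their structure constants\<close>

text \<open>
  Independence of an indexed family, so that vectors of different origin can be handled together
  without first checking that they are distinct.
\<close>
lemma independent_family:
  fixes h :: "'i \<Rightarrow> 'k::field poly"
  assumes J: "finite J"
    and ind0: "\<forall>c. (\<Sum>i\<in>J. smult (c i) (h i)) = 0 \<longrightarrow> (\<forall>i\<in>J. c i = 0)"
  shows "inj_on h J" and "upoly.independent (h ` J)"
proof -
  have ind: "c i = 0" if "(\<Sum>i\<in>J. smult (c i) (h i)) = 0" "i \<in> J" for c i
    using ind0 that by blast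
  show inj: "inj_on h J"
  proof (rule inj_onI, rule ccontr)
    fix x y assume xy: "x \<in> J" "y \<in> J" "h x = h y" "x \<noteq> y"
    define c where "c i = (if i = x then 1 else if i = y then - 1 else (0::'k))" for i
    have "(\<Sum>i\<in>J. smult (c i) (h i)) = (\<Sum>i\<in>{x, y}. smult (c i) (h i))"
      using xy J by (intro sum.mono_neutral_right) (auto simp: c_def)
    also have "\<dots> = 0" using xy by (simp add: c_def)
    finally show False using ind[of c x] xy by (simp add: c_def)
  qed
  show "upoly.independent (h ` J)"
  proof (rule upoly.independent_if_scalars_zero)
    fix f x assume 0: "(\<Sum>x\<in>h ` J. smult (f x) x) = 0" and "x \<in> h ` J"
    then obtain i where i: "i \<in> J" "x = h i" by blast
    have "(\<Sum>i\<in>J. smult (f (h i)) (h i)) = 0" using 0 by (simp add: sum.reindex[OF inj])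
    then show "f x = 0" using ind[of "\<lambda>i. f (h i)" i] i by simp
  qed (use J in simp)
qed

lemma distinct_degrees_independent:
  fixes g :: "nat \<Rightarrow> 'k::field poly"
  assumes "finite A" "\<And>l. l \<in> A \<Longrightarrow> g l \<noteq> 0 \<and> degree (g l) = l"
    and "(\<Sum>l\<in>A. smult (c l) (g l)) = 0" "l \<in> A"
  shows "c l = 0"
  using combination_of_distinct_degrees[of A g l c] assms by blast

lemma span_family:
  fixes g :: "nat \<Rightarrow> 'k::field poly"
  assumes A: "finite A" and g: "\<And>l. l \<in> A \<Longrightarrow> degree (g l) = l"
    and p: "p \<in> upoly.span (g ` A)"
  obtains c where "p = (\<Sum>l\<in>A. smult (c l) (g l))"
proof -
  have inj: "inj_on g A" by (rule inj_onI) (metis g)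
  obtain u where "p = (\<Sum>v\<in>g ` A. smult (u v) v)"
    using p upoly.span_finite[of "g ` A"] A by auto
  then have "p = (\<Sum>l\<in>A. smult (u (g l)) (g l))" by (simp add: sum.reindex[OF inj])
  then show ?thesis by (rule that)
qed

lemma degs_span:
  fixes g :: "nat \<Rightarrow> 'k::field poly"
  assumes A: "finite A" and g: "\<And>l. l \<in> A \<Longrightarrow> g l \<noteq> 0 \<and> degree (g l) = l"
  shows "degs (upoly.span (g ` A)) = A"
proof
  show "degs (upoly.span (g ` A)) \<subseteq> A"
  proof
    fix b assume "b \<in> degs (upoly.span (g ` A))"
    then obtain p where p: "p \<in> upoly.span (g ` A)" "p \<noteq> 0" "b = degree p" by (auto simp: degs_def)
    have "\<And>l. l \<in> A \<Longrightarrow> degree (g l) = l" using g by blast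
    then obtain c where c: "p = (\<Sum>l\<in>A. smult (c l) (g l))" using span_family[OF A _ p(1)] by blast
    obtain l where "l \<in> A" "c l \<noteq> 0"
    proof (rule ccontr)
      assume "\<not> thesis"
      then have "\<And>l. l \<in> A \<Longrightarrow> c l = 0" using that by blast
      then have "p = 0" unfolding c by simp
      then show False using p by simp
    qed
    then show "b \<in> A" using combination_of_distinct_degrees[of A g l c, OF A g] p c by simp
  qed
  show "A \<subseteq> degs (upoly.span (g ` A))"
  proof
    fix l assume l: "l \<in> A"
    have "degree (g l) \<in> degs (upoly.span (g ` A))"
      using l g by (intro degsI upoly.span_base) auto
    then show "l \<in> degs (upoly.span (g ` A))" using g[OF l] by simp
  qed
qed

lemma representatives_of_degs:
  obtains g where "\<And>b. b \<in> degs V \<Longrightarrow> g b \<in> V \<and> g b \<noteq> 0 \<and> degree (g b) = b"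
proof -
  define g where "g b = (SOME p. p \<in> V \<and> p \<noteq> 0 \<and> degree p = b)" for b
  have "g b \<in> V \<and> g b \<noteq> 0 \<and> degree (g b) = b" if "b \<in> degs V" for b
    unfolding g_def by (rule someI_ex) (use that in \<open>auto simp: degs_def\<close>)
  then show ?thesis by (rule that)
qed

lemma independent_card_le_degs:
  assumes W: "upoly.subspace W" "finite (degs W)" and B: "upoly.independent B" "B \<subseteq> W"
  shows "card B \<le> card (degs W)"
proof -
  obtain g where g: "\<And>b. b \<in> degs W \<Longrightarrow> g b \<in> W \<and> g b \<noteq> 0 \<and> degree (g b) = b"
    using representatives_of_degs by blast
  have "B \<subseteq> upoly.span (g ` degs W)" using expand_in_span[OF W(1) g] B(2) by blast
  then have "card B \<le> card (g ` degs W)"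
    using upoly.independent_span_bound[OF _ B(1)] W(2) by blast
  then show ?thesis using card_image_le[OF W(2), of g] by simp
qed

lemma degs_card_le_spanning:
  assumes B: "finite B" "W \<subseteq> upoly.span B" and W: "finite (degs W)"
  shows "card (degs W) \<le> card B"
proof -
  obtain g where g: "\<And>b. b \<in> degs W \<Longrightarrow> g b \<in> W \<and> g b \<noteq> 0 \<and> degree (g b) = b"
    using representatives_of_degs by blast
  have ind: "\<forall>c. (\<Sum>b\<in>degs W. smult (c b) (g b)) = 0 \<longrightarrow> (\<forall>b\<in>degs W. c b = 0)"
    using distinct_degrees_independent[OF W, of g] g by blast
  have "g ` degs W \<subseteq> upoly.span B" using g B(2) by blast
  then have "card (g ` degs W) \<le> card B"
    using upoly.independent_span_bound[OF B(1) independent_family(2)[OF W ind]] by blast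
  then show ?thesis using card_image[OF independent_family(1)[OF W ind]] by simp
qed

lemma subset_if_degs_subset:
  assumes U: "upoly.subspace U" "U \<subseteq> V" and V: "upoly.subspace V" "degs V \<subseteq> degs U"
  shows "V \<subseteq> U"
proof
  fix p assume p: "p \<in> V"
  obtain g where g: "\<And>b. b \<in> degs U \<Longrightarrow> g b \<in> U \<and> g b \<noteq> 0 \<and> degree (g b) = b"
    using representatives_of_degs by blast
  have "p \<in> upoly.span (g ` degs V)"
    using g U V by (intro expand_in_span[OF V(1) _ p]) blast
  moreover have "upoly.span (g ` degs V) \<subseteq> U"
    using g V by (intro upoly.span_minimal[OF _ U(1)]) auto
  ultimately show "p \<in> U" by blast
qed

text \<open>
  The sequences \<open>generator_degree P\<close>, with a number \<open>M\<close> beyond which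
  they are the identity. The last condition also bounds the values at smaller indices by
  \<open>M\<close>, because a large part of the partition is a generator of high degree at a small
  index.
\<close>
definition staircase :: "nat \<Rightarrow> (nat \<Rightarrow> nat) \<Rightarrow> bool" where
  "staircase M D \<longleftrightarrow>
     (\<forall>b. D (Suc b) \<le> Suc (D b)) \<and> D M = M \<and> (\<forall>n>M. \<forall>l. D l = n \<longleftrightarrow> l = n)"

lemma staircase_Suc: "staircase M D \<Longrightarrow> D (Suc b) \<le> Suc (D b)"
  by (simp add: staircase_def)

lemma staircase_fixed:
  assumes "staircase M D" "M \<le> b" shows "D b = b"
  using assms unfolding staircase_def by (cases "b = M") auto

lemma staircase_ge:
  assumes D: "staircase M D"
  shows "b \<le> D b"
proof (cases "M \<le> b")
  case True
  then show ?thesis using staircase_fixed[OF D True] by simp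
next
  case False
  have "D (b + i) \<le> D b + i" for i
    by (induction i) (use staircase_Suc[OF D, of "b + _"] in \<open>auto intro: order_trans\<close>)
  from this[of "M - b"] show ?thesis using False staircase_fixed[OF D, of M] by simp
qed

lemma finite_le_staircase:
  assumes "staircase M D" shows "finite {b. D b \<le> n}"
proof (rule finite_subset)
  show "{b. D b \<le> n} \<subseteq> {..n}" using staircase_ge[OF assms] order_trans by fastforce
qed simp

lemma finite_eq_staircase:
  assumes "staircase M D" shows "finite {b. D b = n}"
  by (rule finite_subset[OF _ finite_le_staircase[OF assms, of n]]) auto

text \<open>
  The basis with prescribed structure constants for multiplication by $y$.
\<close>
fun flag_basis :: "(nat \<Rightarrow> nat \<Rightarrow> 'k::field) \<Rightarrow> nat \<Rightarrow> 'k poly" where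
  "flag_basis \<alpha> 0 = 1"
| "flag_basis \<alpha> (Suc b) = pCons 0 (flag_basis \<alpha> b) - (\<Sum>l\<le>b. smult (\<alpha> l b) (flag_basis \<alpha> l))"

lemma flag_basis_monic: "degree (flag_basis \<alpha> b) = b \<and> coeff (flag_basis \<alpha> b) b = 1"
proof (induction b rule: less_induct)
  case (less b)
  show ?case
  proof (cases b)
    case (Suc b')
    define s where "s = (\<Sum>l\<le>b'. smult (\<alpha> l b') (flag_basis \<alpha> l))"
    have "degree s \<le> b'" unfolding s_def
    proof (rule degree_sum_le)
      fix l assume l: "l \<in> {..b'}"
      then have "degree (flag_basis \<alpha> l) = l" using less Suc by simp
      then show "degree (smult (\<alpha> l b') (flag_basis \<alpha> l)) \<le> b'"
        using l order_trans[OF degree_smult_le] by simp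
    qed simp
    then have s: "coeff s n = 0" if "b' < n" for n using that by (intro coeff_eq_0) simp
    have eq: "flag_basis \<alpha> b = pCons 0 (flag_basis \<alpha> b') - s" by (simp add: Suc s_def)
    have IH: "degree (flag_basis \<alpha> b') = b'" "coeff (flag_basis \<alpha> b') b' = 1" using less Suc by simp_all
    have "coeff (flag_basis \<alpha> b) b = 1" unfolding eq using s[of "Suc b'"] IH by (simp add: Suc)
    moreover have "coeff (flag_basis \<alpha> b) n = 0" if "b < n" for n
    proof (cases n)
      case (Suc n')
      then show ?thesis unfolding eq using that \<open>b = Suc b'\<close> IH s[of n] coeff_eq_0[of "flag_basis \<alpha> b'" n'] by simp
    qed (use that in simp)
    then have "degree (flag_basis \<alpha> b) \<le> b" by (intro degree_le) simp
    ultimately show ?thesis using le_degree[of "flag_basis \<alpha> b" b] by simp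
  qed simp
qed

lemma degree_flag_basis [simp]: "degree (flag_basis \<alpha> b) = b"
  and coeff_flag_basis [simp]: "coeff (flag_basis \<alpha> b) b = 1"
  using flag_basis_monic by blast+

lemma flag_basis_nz [simp]: "flag_basis \<alpha> b \<noteq> 0"
  using coeff_flag_basis[of \<alpha> b] by (metis coeff_0 zero_neq_one)

text \<open>
  The matrix of multiplication by $y$ in the basis \<open>flag_basis \<alpha>\<close>.
\<close>
definition structure_matrix :: "(nat \<Rightarrow> nat \<Rightarrow> 'k::field) \<Rightarrow> nat \<Rightarrow> nat \<Rightarrow> 'k" where
  "structure_matrix \<alpha> l b = (if l \<le> b then \<alpha> l b else if l = Suc b then 1 else 0)"

lemma pCons_flag_basis:
  "pCons 0 (flag_basis \<alpha> b) = (\<Sum>l\<le>Suc b. smult (structure_matrix \<alpha> l b) (flag_basis \<alpha> l))"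
proof -
  have "(\<Sum>l\<le>Suc b. smult (structure_matrix \<alpha> l b) (flag_basis \<alpha> l))
      = (\<Sum>l\<le>b. smult (\<alpha> l b) (flag_basis \<alpha> l)) + flag_basis \<alpha> (Suc b)"
    by (simp add: structure_matrix_def)
  then show ?thesis by simp
qed

text \<open>
  Multiplication by $y$ raises the degree of forms by one, so it can only involve basis elements
  whose generator degree is at most one larger.
\<close>
definition admissible :: "(nat \<Rightarrow> nat) \<Rightarrow> (nat \<Rightarrow> nat \<Rightarrow> 'k::field) \<Rightarrow> bool" where
  "admissible D \<alpha> \<longleftrightarrow> (\<forall>l b. l \<le> b \<longrightarrow> Suc (D b) < D l \<longrightarrow> \<alpha> l b = 0)"

definition flag_chain :: "(nat \<Rightarrow> nat) \<Rightarrow> (nat \<Rightarrow> nat \<Rightarrow> 'k::field) \<Rightarrow> nat \<Rightarrow> 'k poly set" where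
  "flag_chain D \<alpha> n = upoly.span (flag_basis \<alpha> ` {b. D b \<le> n})"

lemma structure_matrix_admissible:
  assumes "staircase M D" "admissible D \<alpha>" "structure_matrix \<alpha> l b \<noteq> 0"
  shows "D l \<le> Suc (D b)"
  using assms staircase_Suc[OF assms(1), of b]
  by (auto simp: structure_matrix_def admissible_def split: if_splits intro: leI)

lemma subspace_pCons_preimage:
  assumes "upoly.subspace W"
  shows "upoly.subspace {q. pCons 0 q \<in> W}"
proof (rule upoly.subspaceI)
  fix c p q assume p: "p \<in> {q. pCons 0 q \<in> W}"
  have "smult c (pCons 0 p) \<in> W" using p upoly.subspace_scale[OF assms] by blast
  then show "smult c p \<in> {q. pCons 0 q \<in> W}" by simp
  assume "q \<in> {q. pCons 0 q \<in> W}"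
  then have "pCons 0 p + pCons 0 q \<in> W" using p upoly.subspace_add[OF assms] by blast
  then show "p + q \<in> {q. pCons 0 q \<in> W}" by simp
qed (use upoly.subspace_0[OF assms] in simp)

lemma subspace_degree_le: "upoly.subspace {p :: 'k::field poly. degree p \<le> n}"
  by (rule upoly.subspaceI) (auto intro: degree_add_le order_trans[OF degree_smult_le])

lemma cell_chain_flag_chain:
  assumes D: "staircase M D" and \<alpha>: "admissible D \<alpha>"
  shows "cell_chain D (flag_chain D \<alpha>)"
  unfolding cell_chain_def form_chain_def
proof (intro conjI allI ballI)
  let ?g = "flag_basis \<alpha>"
  fix n
  show "upoly.subspace (flag_chain D \<alpha> n)" by (simp add: flag_chain_def)
  show "degs (flag_chain D \<alpha> n) = {b. D b \<le> n}"
    unfolding flag_chain_def by (rule degs_span[OF finite_le_staircase[OF D]]) simp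
  fix p assume p: "p \<in> flag_chain D \<alpha> n"
  have "flag_chain D \<alpha> n \<subseteq> {p. degree p \<le> n}"
    unfolding flag_chain_def
    using staircase_ge[OF D] order_trans by (intro upoly.span_minimal subspace_degree_le) fastforce
  then show "degree p \<le> n" using p by blast
  have "flag_chain D \<alpha> n \<subseteq> flag_chain D \<alpha> (Suc n)"
    unfolding flag_chain_def by (intro upoly.span_mono image_mono) auto
  then show "p \<in> flag_chain D \<alpha> (Suc n)" using p by blast
  have "flag_chain D \<alpha> n \<subseteq> {q. pCons 0 q \<in> flag_chain D \<alpha> (Suc n)}"
    unfolding flag_chain_def
  proof (rule upoly.span_minimal[OF _ subspace_pCons_preimage[OF upoly.subspace_span]], clarify)
    fix b assume b: "D b \<le> n"
    have "smult (structure_matrix \<alpha> l b) (?g l) \<in> upoly.span (?g ` {b. D b \<le> Suc n})" for l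
    proof (cases "structure_matrix \<alpha> l b = 0")
      case False
      then have "D l \<le> Suc n" using structure_matrix_admissible[OF D \<alpha> False] b by simp
      then show ?thesis by (intro upoly.span_scale upoly.span_base) simp
    qed (simp add: upoly.span_zero)
    then show "pCons 0 (?g b) \<in> upoly.span (?g ` {b. D b \<le> Suc n})"
      unfolding pCons_flag_basis by (intro upoly.span_sum)
  qed
  then show "pCons 0 p \<in> flag_chain D \<alpha> (Suc n)" using p by blast
qed

text \<open>
  Any choice of monic \<open>g b\<close> of degree \<open>b\<close> in \<open>V (D b)\<close> is
  an adapted basis: it spans each \<open>V n\<close> by comparison of degrees, and expanding $y
  g_b - g_{b+1}$ in \<open>V (D b + 1)\<close> yields the structure constants.
\<close>
lemma cell_chain_is_flag_chain:
  assumes D: "staircase M D" and V: "cell_chain D V"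
  obtains \<alpha> where "admissible D \<alpha>" "V = flag_chain D \<alpha>"
proof -
  have chain: "form_chain V" and degs: "degs (V n) = {b. D b \<le> n}" for n
    using V by (auto simp: cell_chain_def)
  note sub = form_chain_subspace[OF chain]
  have mono: "V m \<subseteq> V n" if "m \<le> n" for m n
    using that by (induction n rule: dec_induct) (use form_chain_x[OF chain] in blast)+
  define g where "g b = (SOME p. p \<in> V (D b) \<and> degree p = b \<and> coeff p b = 1)" for b
  have ex: "\<exists>p. p \<in> V (D b) \<and> degree p = b \<and> coeff p b = 1" for b
  proof -
    have "b \<in> degs (V (D b))" by (simp add: degs)
    then obtain p where p: "p \<in> V (D b)" "p \<noteq> 0" "degree p = b" by (auto simp: degs_def)
    have "smult (inverse (coeff p b)) p \<in> V (D b)" using p upoly.subspace_scale[OF sub] by blast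
    moreover have "coeff p b \<noteq> 0" using p leading_coeff_0_iff[of p] by auto
    ultimately show ?thesis using p
      by (intro exI[of _ "smult (inverse (coeff p b)) p"]) simp
  qed
  have g: "g b \<in> V (D b)" "degree (g b) = b" "coeff (g b) b = 1" for b
    using someI_ex[OF ex[of b]] by (auto simp: g_def)
  have gnz: "g b \<noteq> 0" for b using g(3)[of b] by auto
  have gV: "g b \<in> V n \<and> g b \<noteq> 0 \<and> degree (g b) = b" if "b \<in> degs (V n)" for b n
    using that g(1)[of b] g(2)[of b] gnz[of b] mono[of "D b" n] by (auto simp: degs)
  have "\<exists>c. (\<forall>l. c l \<noteq> 0 \<longrightarrow> D l \<le> Suc (D b)) \<and>
      pCons 0 (g b) - g (Suc b) = (\<Sum>l\<le>b. smult (c l) (g l))" for b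
  proof -
    define q where "q = pCons 0 (g b) - g (Suc b)"
    have "pCons 0 (g b) \<in> V (Suc (D b))" using form_chain_y[OF chain g(1)] .
    moreover have "g (Suc b) \<in> V (Suc (D b))"
      using g(1)[of "Suc b"] mono[OF staircase_Suc[OF D, of b]] by blast
    ultimately have q: "q \<in> V (Suc (D b))" unfolding q_def using upoly.subspace_diff[OF sub] by blast
    obtain c where c: "\<And>l. c l \<noteq> 0 \<Longrightarrow> l \<in> degs (V (Suc (D b))) \<and> l \<le> degree q"
      and qc: "q = (\<Sum>l\<le>degree q. smult (c l) (g l))"
      using expand_by_degrees[OF sub gV q] by blast
    have "degree q \<le> b"
    proof (rule degree_le, intro allI impI)
      fix i assume i: "b < i"
      show "coeff q i = 0"
      proof (cases "i = Suc b")
        case True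
        then show ?thesis by (simp add: q_def g)
      next
        case False
        then obtain i' where i': "i = Suc i'" "b < i'" using i by (cases i) auto
        then show ?thesis using g(2)[of b] g(2)[of "Suc b"] by (simp add: q_def coeff_eq_0)
      qed
    qed
    then have "(\<Sum>l\<le>degree q. smult (c l) (g l)) = (\<Sum>l\<le>b. smult (c l) (g l))"
      using c by (intro sum.mono_neutral_left) fastforce+
    then have "q = (\<Sum>l\<le>b. smult (c l) (g l))" using qc by simp
    moreover have "D l \<le> Suc (D b)" if "c l \<noteq> 0" for l using c[OF that] by (simp add: degs)
    ultimately show ?thesis unfolding q_def by blast
  qed
  then obtain c where c: "\<And>b l. c b l \<noteq> 0 \<Longrightarrow> D l \<le> Suc (D b)"
    and gc: "\<And>b. pCons 0 (g b) - g (Suc b) = (\<Sum>l\<le>b. smult (c b l) (g l))" by metis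
  define \<alpha> where "\<alpha> l b = c b l" for l b
  have "admissible D \<alpha>" unfolding admissible_def \<alpha>_def using c by (meson not_le)
  have fg: "flag_basis \<alpha> b = g b" for b
  proof (induction b rule: less_induct)
    case (less b)
    show ?case
    proof (cases b)
      case 0
      obtain a where a: "g 0 = [:a:]" using g(2)[of 0] by (rule degree_eq_zeroE)
      have "g 0 = 1" using g(3)[of 0] unfolding a by simp
      then show ?thesis using 0 by simp
    next
      case (Suc b')
      have "(\<Sum>l\<le>b'. smult (\<alpha> l b') (flag_basis \<alpha> l)) = (\<Sum>l\<le>b'. smult (c b' l) (g l))"
      proof (rule sum.cong)
        fix l assume "l \<in> {..b'}"
        then have "flag_basis \<alpha> l = g l" using less.IH Suc by simp
        then show "smult (\<alpha> l b') (flag_basis \<alpha> l) = smult (c b' l) (g l)" by (simp add: \<alpha>_def)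
      qed simp
      moreover have "flag_basis \<alpha> b' = g b'" using less.IH Suc by simp
      ultimately have "flag_basis \<alpha> b = pCons 0 (g b') - (pCons 0 (g b') - g (Suc b'))"
        unfolding gc[of b'] by (simp only: Suc flag_basis.simps)
      then show ?thesis using Suc by simp
    qed
  qed
  have "V n = flag_chain D \<alpha> n" for n
  proof
    have "upoly.span (g ` degs (V n)) \<subseteq> V n"
      using gV by (intro upoly.span_minimal[OF _ sub]) auto
    then show "flag_chain D \<alpha> n \<subseteq> V n" by (simp add: flag_chain_def fg degs)
    show "V n \<subseteq> flag_chain D \<alpha> n"
      using expand_in_span[OF sub gV] by (auto simp: flag_chain_def fg degs)
  qed
  then show ?thesis using that \<open>admissible D \<alpha>\<close> by blast
qed

section \<open>The generic rank\<close>

text \<open>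
  The shape of the blocks of \<open>structure_matrix\<close>: free on and above the diagonal, ones
  just below it, zeros further down.
\<close>
definition ascent_pattern :: "(nat \<Rightarrow> nat \<Rightarrow> 'k::field) \<Rightarrow> bool" where
  "ascent_pattern A \<longleftrightarrow> (\<forall>b. A (Suc b) b = 1 \<and> (\<forall>l > Suc b. A l b = 0))"

definition independent_columns :: "(nat \<Rightarrow> nat \<Rightarrow> 'k::field) \<Rightarrow> nat set \<Rightarrow> nat set \<Rightarrow> bool" where
  "independent_columns A R B \<longleftrightarrow>
     (\<forall>c. (\<forall>l\<in>R. (\<Sum>b\<in>B. c b * A l b) = 0) \<longrightarrow> (\<forall>b\<in>B. c b = 0))"

text \<open>
  The largest rank of the block with rows \<open>R\<close> and columns \<open>C\<close> over all
  matrices of the given shape. In this form it is visibly invariant under reindexing.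
\<close>
definition generic_rank :: "'k::field itself \<Rightarrow> nat set \<Rightarrow> nat set \<Rightarrow> nat" where
  "generic_rank K R C =
     Max {card B | B. B \<subseteq> C \<and> (\<exists>A :: nat \<Rightarrow> nat \<Rightarrow> 'k. ascent_pattern A \<and> independent_columns A R B)}"

lemma ascent_pattern_structure_matrix: "ascent_pattern (structure_matrix \<alpha>)"
  by (auto simp: ascent_pattern_def structure_matrix_def)

lemma finite_generic_rank_set:
  "finite C \<Longrightarrow> finite {card B | B. B \<subseteq> C \<and> P B}"
  by (rule finite_subset[of _ "card ` Pow C"]) auto

lemma generic_rank_ge:
  fixes A :: "nat \<Rightarrow> nat \<Rightarrow> 'k::field"
  assumes "finite C" "B \<subseteq> C" "ascent_pattern A" "independent_columns A R B"
  shows "card B \<le> generic_rank TYPE('k) R C"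
  unfolding generic_rank_def by (rule Max_ge[OF finite_generic_rank_set]) (use assms in auto)

lemma generic_rank_attained:
  assumes "finite C"
  obtains A :: "nat \<Rightarrow> nat \<Rightarrow> 'k::field" and B
  where "B \<subseteq> C" "ascent_pattern A" "independent_columns A R B" "card B = generic_rank TYPE('k) R C"
proof -
  let ?S = "{card B | B. B \<subseteq> C \<and> (\<exists>A :: nat \<Rightarrow> nat \<Rightarrow> 'k. ascent_pattern A \<and> independent_columns A R B)}"
  have "card {} \<in> ?S"
    using ascent_pattern_structure_matrix[of "\<lambda>_ _. 0 :: 'k"]
    by (intro CollectI exI[of _ "{}"]) (auto simp: independent_columns_def)
  then have "generic_rank TYPE('k) R C \<in> ?S"
    unfolding generic_rank_def using assms by (intro Max_in finite_generic_rank_set) auto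
  then show ?thesis using that by auto
qed

definition rank_at :: "'k::field itself \<Rightarrow> (nat \<Rightarrow> nat) \<Rightarrow> nat \<Rightarrow> nat" where
  "rank_at K D n = generic_rank K {l. D l = Suc n} {b. D b = n}"

context
  fixes M :: nat and D :: "nat \<Rightarrow> nat" and \<alpha> :: "nat \<Rightarrow> nat \<Rightarrow> 'k::field"
  assumes D: "staircase M D" and \<alpha>: "admissible D \<alpha>"
begin

text \<open>
  The class of $y g_b$ modulo \<open>V n\<close>, written in the basis elements of generator
  degree \<open>n + 1\<close>.
\<close>
definition new_column :: "nat \<Rightarrow> nat \<Rightarrow> 'k poly" where
  "new_column n b = (\<Sum>l\<in>{l. D l = Suc n}. smult (structure_matrix \<alpha> l b) (flag_basis \<alpha> l))"

lemma pCons_flag_basis_new_column: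
  assumes "D b = n"
  shows "pCons 0 (flag_basis \<alpha> b) - new_column n b \<in> flag_chain D \<alpha> n"
proof -
  let ?f = "\<lambda>l. smult (structure_matrix \<alpha> l b) (flag_basis \<alpha> l)"
  let ?R = "{l. D l = Suc n}"
  have zero: "structure_matrix \<alpha> l b = 0" if "l > Suc b" for l
    using that by (simp add: structure_matrix_def)
  have fin: "finite ({..Suc b} \<union> ?R)" using finite_eq_staircase[OF D] by simp
  have "(\<Sum>l\<in>{..Suc b} \<union> ?R. ?f l) = (\<Sum>l\<le>Suc b. ?f l)"
    using fin zero by (intro sum.mono_neutral_right) (auto simp: not_le)
  then have "pCons 0 (flag_basis \<alpha> b) = (\<Sum>l\<in>{..Suc b} \<union> ?R. ?f l)"
    unfolding pCons_flag_basis by (rule sym)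
  also have "\<dots> = (\<Sum>l\<in>({..Suc b} \<union> ?R) - ?R. ?f l) + (\<Sum>l\<in>?R. ?f l)"
    using fin by (intro sum.subset_diff) auto
  finally have eq: "pCons 0 (flag_basis \<alpha> b) - new_column n b = (\<Sum>l\<in>({..Suc b} \<union> ?R) - ?R. ?f l)"
    by (simp add: new_column_def)
  have "?f l \<in> flag_chain D \<alpha> n" if "l \<in> ({..Suc b} \<union> ?R) - ?R" for l
  proof (cases "structure_matrix \<alpha> l b = 0")
    case False
    then have "D l \<le> n" using structure_matrix_admissible[OF D \<alpha> False] that assms by simp
    then show ?thesis unfolding flag_chain_def by (intro upoly.span_scale upoly.span_base) simp
  qed (simp add: flag_chain_def upoly.span_zero)
  then show ?thesis unfolding eq flag_chain_def by (intro upoly.span_sum)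
qed

lemma step_space_flag_chain:
  "step_space (flag_chain D \<alpha>) (Suc n) =
     upoly.span (flag_basis \<alpha> ` {b. D b \<le> n} \<union> new_column n ` {b. D b = n})" (is "?W = ?S")
proof
  let ?V = "flag_chain D \<alpha>"
  have chain: "form_chain ?V" using cell_chain_flag_chain[OF D \<alpha>] by (simp add: cell_chain_def)
  have VS: "?V n \<subseteq> ?S" unfolding flag_chain_def by (intro upoly.span_mono) simp
  have "?V n \<subseteq> {q. pCons 0 q \<in> ?S}"
    unfolding flag_chain_def[of D \<alpha> n]
  proof (rule upoly.span_minimal[OF _ subspace_pCons_preimage[OF upoly.subspace_span]], clarify)
    fix b assume b: "D b \<le> n"
    show "pCons 0 (flag_basis \<alpha> b) \<in> ?S"
    proof (cases "D b = n")
      case True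
      have "pCons 0 (flag_basis \<alpha> b) - new_column n b \<in> ?S"
        using pCons_flag_basis_new_column[OF True] VS by blast
      moreover have "new_column n b \<in> ?S" using True by (intro upoly.span_base) simp
      ultimately have "(pCons 0 (flag_basis \<alpha> b) - new_column n b) + new_column n b \<in> ?S"
        by (rule upoly.span_add)
      then show ?thesis by simp
    next
      case False
      have "flag_basis \<alpha> b \<in> ?V (n - 1)"
        unfolding flag_chain_def using b False by (intro upoly.span_base) auto
      then have "pCons 0 (flag_basis \<alpha> b) \<in> ?V (Suc (n - 1))" by (rule form_chain_y[OF chain])
      then show ?thesis using VS b False by auto
    qed
  qed
  then show "?W \<subseteq> ?S" using VS by (auto simp: step_space_Suc intro: upoly.span_add)
  have sub: "upoly.subspace ?W" by (rule subspace_step_space[OF chain])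
  have VW: "?V n \<subseteq> ?W" using step_space_x[OF chain] by blast
  show "?S \<subseteq> ?W"
  proof (rule upoly.span_minimal[OF _ sub], rule Un_least)
    have "flag_basis \<alpha> ` {b. D b \<le> n} \<subseteq> ?V n" by (simp add: flag_chain_def upoly.span_superset)
    then show "flag_basis \<alpha> ` {b. D b \<le> n} \<subseteq> ?W" using VW by (rule subset_trans)
    show "new_column n ` {b. D b = n} \<subseteq> ?W"
    proof clarify
      fix b assume b: "n = D b"
      have "flag_basis \<alpha> b \<in> ?V n" unfolding flag_chain_def using b by (intro upoly.span_base) simp
      then have "pCons 0 (flag_basis \<alpha> b) \<in> ?W" by (rule step_space_y[OF chain])
      moreover have "pCons 0 (flag_basis \<alpha> b) - new_column n b \<in> ?W"
        using pCons_flag_basis_new_column[OF b[symmetric]] VW by blast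
      ultimately have "pCons 0 (flag_basis \<alpha> b) - (pCons 0 (flag_basis \<alpha> b) - new_column n b) \<in> ?W"
        by (rule upoly.subspace_diff[OF sub])
      then show "new_column (D b) b \<in> step_space (flag_chain D \<alpha>) (Suc (D b))" using b by simp
    qed
  qed
qed

lemma finite_degs_step_space: "finite (degs (step_space (flag_chain D \<alpha>) n))"
  using cell_chain_flag_chain[OF D \<alpha>] unfolding cell_chain_def
  by (intro finite_degs form_chain_step_space) blast

lemma new_column_combination:
  "(\<Sum>b\<in>B. smult (c b) (new_column n b)) =
     (\<Sum>l\<in>{l. D l = Suc n}. smult (\<Sum>b\<in>B. c b * structure_matrix \<alpha> l b) (flag_basis \<alpha> l))"
  unfolding new_column_def upoly.scale_sum_right smult_sum smult_smult by (rule sum.swap)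

lemma step_space_degs_le:
  "card (degs (step_space (flag_chain D \<alpha>) (Suc n))) \<le> card {b. D b \<le> n} + rank_at TYPE('k) D n"
proof -
  let ?C = "{b. D b = n}" let ?R = "{l. D l = Suc n}"
  obtain X where X: "X \<subseteq> new_column n ` ?C" "upoly.independent X" "new_column n ` ?C \<subseteq> upoly.span X"
    using upoly.maximal_independent_subset by blast
  obtain B where B: "B \<subseteq> ?C" "inj_on (new_column n) B" "X = new_column n ` B"
    using X(1) unfolding subset_image_inj by blast
  have finB: "finite B" using B(1) finite_eq_staircase[OF D] finite_subset by blast
  have "independent_columns (structure_matrix \<alpha>) ?R B"
    unfolding independent_columns_def
  proof (intro allI impI ballI)
    fix c b assume 0: "\<forall>l\<in>?R. (\<Sum>b\<in>B. c b * structure_matrix \<alpha> l b) = 0" and b: "b \<in> B"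
    have "(\<Sum>b\<in>B. smult (c b) (new_column n b)) = 0" unfolding new_column_combination using 0 by simp
    then have "(\<Sum>x\<in>X. smult (c (the_inv_into B (new_column n) x)) x) = 0"
      unfolding B(3) sum.reindex[OF B(2)] using the_inv_into_f_f[OF B(2)] by simp
    moreover have "finite X" "new_column n b \<in> X" using b B(3) finB by simp_all
    ultimately have "c (the_inv_into B (new_column n) (new_column n b)) = 0"
      using upoly.independentD[OF X(2), of X "\<lambda>x. c (the_inv_into B (new_column n) x)" "new_column n b"] by blast
    then show "c b = 0" using the_inv_into_f_f[OF B(2) b] by simp
  qed
  then have "card B \<le> rank_at TYPE('k) D n"
    unfolding rank_at_def using B(1) finite_eq_staircase[OF D] ascent_pattern_structure_matrix
    by (intro generic_rank_ge)
  moreover have "card X = card B" unfolding B(3) by (rule card_image[OF B(2)])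
  moreover have "card (degs (step_space (flag_chain D \<alpha>) (Suc n))) \<le> card (flag_basis \<alpha> ` {b. D b \<le> n} \<union> X)"
  proof (rule degs_card_le_spanning[OF _ _ finite_degs_step_space])
    show "finite (flag_basis \<alpha> ` {b. D b \<le> n} \<union> X)"
      using finite_le_staircase[OF D] finB B(3) by simp
    have "X \<subseteq> flag_basis \<alpha> ` {b. D b \<le> n} \<union> X" by simp
    from upoly.span_mono[OF this] have "new_column n ` ?C \<subseteq> upoly.span (flag_basis \<alpha> ` {b. D b \<le> n} \<union> X)"
      using X(3) by blast
    then show "step_space (flag_chain D \<alpha>) (Suc n) \<subseteq> upoly.span (flag_basis \<alpha> ` {b. D b \<le> n} \<union> X)"
      unfolding step_space_flag_chain
      using upoly.span_superset[of "flag_basis \<alpha> ` {b. D b \<le> n} \<union> X"]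
      by (intro upoly.span_minimal) auto
  qed
  moreover have "card (flag_basis \<alpha> ` {b. D b \<le> n} \<union> X) \<le> card {b. D b \<le> n} + card X"
    using card_Un_le[of "flag_basis \<alpha> ` {b. D b \<le> n}" X] card_image_le[OF finite_le_staircase[OF D], of "flag_basis \<alpha>" n]
    by linarith
  ultimately show ?thesis by linarith
qed

lemma step_space_degs_ge:
  assumes B: "B \<subseteq> {b. D b = n}" and ind: "independent_columns (structure_matrix \<alpha>) {l. D l = Suc n} B"
  shows "card {b. D b \<le> n} + card B \<le> card (degs (step_space (flag_chain D \<alpha>) (Suc n)))"
proof -
  let ?S = "{b. D b \<le> n}" let ?R = "{l. D l = Suc n}"
  have fin: "finite ?S" "finite ?R" "finite B"
    using finite_le_staircase[OF D] finite_eq_staircase[OF D] B finite_subset by blast+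
  define h where "h = case_sum (flag_basis \<alpha>) (new_column n)"
  have J: "finite (?S <+> B)" using fin by simp
  have fam: "\<forall>c. (\<Sum>i\<in>?S <+> B. smult (c i) (h i)) = 0 \<longrightarrow> (\<forall>i\<in>?S <+> B. c i = 0)"
  proof (intro allI impI)
    fix c assume 0: "(\<Sum>i\<in>?S <+> B. smult (c i) (h i)) = 0"
    \<comment> \<open>The coefficient of \<open>flag_basis \<alpha> l\<close> after expanding the columns.\<close>
    define e where "e l = (if D l \<le> n then c (Inl l) else (\<Sum>b\<in>B. c (Inr b) * structure_matrix \<alpha> l b))" for l
    have "(\<Sum>i\<in>?S <+> B. smult (c i) (h i))
        = (\<Sum>l\<in>?S. smult (c (Inl l)) (flag_basis \<alpha> l)) + (\<Sum>b\<in>B. smult (c (Inr b)) (new_column n b))"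
      using fin by (simp add: sum.Plus h_def)
    also have "\<dots> = (\<Sum>l\<in>?S. smult (e l) (flag_basis \<alpha> l)) + (\<Sum>l\<in>?R. smult (e l) (flag_basis \<alpha> l))"
      unfolding new_column_combination by (simp add: e_def)
    also have "\<dots> = (\<Sum>l\<in>?S \<union> ?R. smult (e l) (flag_basis \<alpha> l))"
      using fin by (intro sum.union_disjoint[symmetric]) auto
    finally have sum: "(\<Sum>l\<in>?S \<union> ?R. smult (e l) (flag_basis \<alpha> l)) = 0" using 0 by simp
    have e: "e l = 0" if "l \<in> ?S \<union> ?R" for l
      using distinct_degrees_independent[OF _ _ sum that] fin by simp
    have "(\<Sum>b\<in>B. c (Inr b) * structure_matrix \<alpha> l b) = 0" if "l \<in> ?R" for l
      using e[of l] that by (simp add: e_def)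
    then have "\<forall>b\<in>B. c (Inr b) = 0"
      using ind[unfolded independent_columns_def, rule_format, of "\<lambda>b. c (Inr b)"] by blast
    moreover have "c (Inl l) = 0" if "l \<in> ?S" for l using e[of l] that by (simp add: e_def)
    ultimately show "\<forall>i\<in>?S <+> B. c i = 0" by auto
  qed
  have chain: "form_chain (flag_chain D \<alpha>)" using cell_chain_flag_chain[OF D \<alpha>] by (simp add: cell_chain_def)
  have "h ` (?S <+> B) \<subseteq> step_space (flag_chain D \<alpha>) (Suc n)"
  proof -
    have "h ` (?S <+> B) \<subseteq> flag_basis \<alpha> ` {b. D b \<le> n} \<union> new_column n ` {b. D b = n}"
      using B by (auto simp: h_def)
    from subset_trans[OF this upoly.span_superset] show ?thesis unfolding step_space_flag_chain .
  qed
  then have "card (h ` (?S <+> B)) \<le> card (degs (step_space (flag_chain D \<alpha>) (Suc n)))"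
    by (intro independent_card_le_degs[OF subspace_step_space[OF chain] finite_degs_step_space
        independent_family(2)[OF J fam]])
  moreover have "card (h ` (?S <+> B)) = card ?S + card B"
    using card_image[OF independent_family(1)[OF J fam]] fin by (simp add: card_Plus)
  ultimately show ?thesis by simp
qed

end

text \<open>
  The free entries of the blocks for different \<open>n\<close> are different structure constants,
  so a matrix of maximal rank can be chosen for each block independently.
\<close>
lemma generic_chain_exists:
  assumes D: "staircase M D"
  obtains \<alpha> :: "nat \<Rightarrow> nat \<Rightarrow> 'k::field" where "admissible D \<alpha>"
    "\<And>n. card (degs (step_space (flag_chain D \<alpha>) (Suc n))) = card {b. D b \<le> n} + rank_at TYPE('k) D n"
proof -
  define generic where "generic n A B \<longleftrightarrow> B \<subseteq> {b. D b = n} \<and> ascent_pattern A \<and>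
      independent_columns A {l. D l = Suc n} B \<and> card B = rank_at TYPE('k) D n"
    for n B and A :: "nat \<Rightarrow> nat \<Rightarrow> 'k"
  have "\<exists>A B. generic n A B" for n
    unfolding generic_def rank_at_def
    by (rule generic_rank_attained[OF finite_eq_staircase[OF D, of n], of "{l. D l = Suc n}", where 'k = 'k]) blast
  then obtain A B where "\<And>n. generic n (A n) (B n)" by metis
  then have AB: "\<And>n. B n \<subseteq> {b. D b = n}" "\<And>n. ascent_pattern (A n)"
      "\<And>n. independent_columns (A n) {l. D l = Suc n} (B n)" "\<And>n. card (B n) = rank_at TYPE('k) D n"
    by (simp_all add: generic_def)
  \<comment> \<open>Structure constants with \<open>D l \<le> D b\<close> enter no block and are set to zero.\<close>
  define \<alpha> where "\<alpha> l b = (if D l = Suc (D b) then A (D b) l b else 0)" for l b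
  have \<alpha>: "admissible D \<alpha>" by (auto simp: admissible_def \<alpha>_def)
  have eq: "structure_matrix \<alpha> l b = A n l b" if "D l = Suc n" "D b = n" for l b n
    using that AB(2)[of n] by (auto simp: structure_matrix_def \<alpha>_def ascent_pattern_def)
  have "independent_columns (structure_matrix \<alpha>) {l. D l = Suc n} (B n)" for n
  proof -
    have "(\<Sum>b\<in>B n. c b * structure_matrix \<alpha> l b) = (\<Sum>b\<in>B n. c b * A n l b)" if "D l = Suc n" for c l
      using AB(1)[of n] eq[OF that] by (intro sum.cong) auto
    then show ?thesis using AB(3)[of n] by (simp add: independent_columns_def)
  qed
  then have "card {b. D b \<le> n} + rank_at TYPE('k) D n \<le> card (degs (step_space (flag_chain D \<alpha>) (Suc n)))" for n
    using step_space_degs_ge[OF D \<alpha> AB(1)] AB(4) by metis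
  then show ?thesis using that[OF \<alpha>] step_space_degs_le[OF D \<alpha>] by (meson le_antisym)
qed

section \<open>Generic behaviour on a cell\<close>

lemma polynomial_functions_diff:
  assumes "g \<in> polynomial_functions P" "h \<in> polynomial_functions P"
  shows "(\<lambda>I. g I - h I) \<in> polynomial_functions P"
  using polynomial_functions.add[OF assms(1) polynomial_functions.mult[OF polynomial_functions.const[of "- 1"] assms(2)]]
  by simp

lemma polynomial_functions_prod:
  assumes "finite A" "\<And>i. i \<in> A \<Longrightarrow> g i \<in> polynomial_functions P"
  shows "(\<lambda>I. \<Prod>i\<in>A. g i I) \<in> polynomial_functions P"
  using assms
proof (induction A rule: finite_induct)
  case empty
  then show ?case using polynomial_functions.const[of 1] by simp
next
  case (insert i A)
  then show ?case using polynomial_functions.mult[of "g i" P "\<lambda>I. \<Prod>i\<in>A. g i I"] by simp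
qed

text \<open>
  Openness of linear independence by fraction-free elimination, in place of minors: if the entry
  of vector \<open>j\<close> at \<open>s0\<close> is nonzero, it is used to clear position
  \<open>s0\<close> in the other vectors, the remaining family is treated by induction, and
  \<open>g\<close> is the product of the pivots.
\<close>
lemma independence_is_open:
  fixes w :: "'i \<Rightarrow> nat \<Rightarrow> 'k::field bipoly set \<Rightarrow> 'k"
  assumes "finite J" "\<And>i s. i \<in> J \<Longrightarrow> w i s \<in> polynomial_functions P"
    and "\<forall>c. (\<forall>s. (\<Sum>i\<in>J. c i * w i s I0) = 0) \<longrightarrow> (\<forall>i\<in>J. c i = 0)"
  shows "\<exists>g \<in> polynomial_functions P. g I0 \<noteq> 0 \<and>
    (\<forall>I. g I \<noteq> 0 \<longrightarrow> (\<forall>c. (\<forall>s. (\<Sum>i\<in>J. c i * w i s I) = 0) \<longrightarrow> (\<forall>i\<in>J. c i = 0)))"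
  using assms
proof (induction J arbitrary: w rule: finite_induct)
  case empty
  show ?case using polynomial_functions.const[of 1 P] by (intro bexI[of _ "\<lambda>_. 1"]) auto
next
  case (insert j J)
  have "\<exists>s0. w j s0 I0 \<noteq> 0"
  proof (rule ccontr)
    assume "\<not> (\<exists>s0. w j s0 I0 \<noteq> 0)"
    then have "\<forall>s. (\<Sum>i\<in>insert j J. (if i = j then 1 else 0) * w i s I0) = 0"
      by (intro allI sum.neutral) auto
    then have "(if j = j then 1 else (0 :: 'k)) = 0"
      using insert.prems(2)[THEN spec, of "\<lambda>i. if i = j then 1 else 0"] by blast
    then show False by simp
  qed
  then obtain s0 where s0: "w j s0 I0 \<noteq> 0" ..
  define w' where "w' i s I = w j s0 I * w i s I - w i s0 I * w j s I" for i s I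
  have sum: "(\<Sum>i\<in>J. c i * w' i s I) = w j s0 I * (\<Sum>i\<in>J. c i * w i s I) - (\<Sum>i\<in>J. c i * w i s0 I) * w j s I"
    for c s I
  proof -
    have "c i * w' i s I = w j s0 I * (c i * w i s I) - (c i * w i s0 I) * w j s I" for i
      by (simp only: w'_def right_diff_distrib ac_simps)
    then show ?thesis by (simp add: sum_subtractf sum_distrib_left sum_distrib_right)
  qed
  have "w' i s \<in> polynomial_functions P" if "i \<in> J" for i s
  proof -
    have "(\<lambda>I. w j s0 I * w i s I - w i s0 I * w j s I) \<in> polynomial_functions P"
      using that by (intro polynomial_functions_diff polynomial_functions.mult insert.prems(1)) auto
    then show ?thesis by (simp add: w'_def[abs_def])
  qed
  moreover have "\<forall>c. (\<forall>s. (\<Sum>i\<in>J. c i * w' i s I0) = 0) \<longrightarrow> (\<forall>i\<in>J. c i = 0)"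
  proof (intro allI impI)
    fix c assume 0: "\<forall>s. (\<Sum>i\<in>J. c i * w' i s I0) = 0"
    \<comment> \<open>The relation among the reduced vectors, written as a relation among the original ones.\<close>
    define c' where "c' i = (if i = j then - (\<Sum>i\<in>J. c i * w i s0 I0) else w j s0 I0 * c i)" for i
    have "(\<Sum>i\<in>insert j J. c' i * w i s I0) = (\<Sum>i\<in>J. c i * w' i s I0)" for s
    proof -
      have "(\<Sum>i\<in>J. c' i * w i s I0) = w j s0 I0 * (\<Sum>i\<in>J. c i * w i s I0)"
        unfolding sum_distrib_left using insert.hyps by (intro sum.cong) (auto simp: c'_def)
      then show ?thesis unfolding sum using insert.hyps by (simp add: c'_def)
    qed
    then have "\<forall>s. (\<Sum>i\<in>insert j J. c' i * w i s I0) = 0" using 0 by simp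
    then have c': "\<forall>i\<in>insert j J. c' i = 0" using insert.prems(2) by blast
    show "\<forall>i\<in>J. c i = 0"
    proof
      fix i assume "i \<in> J"
      then have "c' i = 0" "i \<noteq> j" using c' insert.hyps by auto
      then show "c i = 0" using s0 by (simp add: c'_def)
    qed
  qed
  ultimately obtain g where g: "g \<in> polynomial_functions P" "g I0 \<noteq> 0"
    "\<And>I c. g I \<noteq> 0 \<Longrightarrow> (\<forall>s. (\<Sum>i\<in>J. c i * w' i s I) = 0) \<Longrightarrow> (\<forall>i\<in>J. c i = 0)"
    using insert.IH[of w'] by blast
  show ?case
  proof (intro bexI conjI allI impI)
    show "(\<lambda>I. w j s0 I * g I) \<in> polynomial_functions P"
      using g(1) insert.prems(1) by (intro polynomial_functions.mult) auto
    show "w j s0 I0 * g I0 \<noteq> 0" using s0 g(2) by simp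
    fix I c assume gI: "w j s0 I * g I \<noteq> 0" and 0: "\<forall>s. (\<Sum>i\<in>insert j J. c i * w i s I) = 0"
    have e: "(\<Sum>i\<in>J. c i * w i s I) = - (c j * w j s I)" for s
    proof -
      have "c j * w j s I + (\<Sum>i\<in>J. c i * w i s I) = 0"
        using 0[THEN spec, of s] insert.hyps by simp
      then show ?thesis by (rule add_eq_0_iff[THEN iffD1])
    qed
    have "\<forall>s. (\<Sum>i\<in>J. c i * w' i s I) = 0" unfolding sum e by (intro allI) algebra
    then have J: "\<forall>i\<in>J. c i = 0" using g(3)[of I c] gI by simp
    then have "c j * w j s0 I = 0" using e[of s0] by simp
    then show "\<forall>i\<in>insert j J. c i = 0" using J gI by simp
  qed
qed

text \<open>
  The reduced elements computed from an adapted basis by back substitution. The recursion uses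
  ring operations only, hence preserves polynomial dependence on parameters.
\<close>
fun reduced_basis :: "(nat \<Rightarrow> nat) \<Rightarrow> (nat \<Rightarrow> nat \<Rightarrow> 'k::field) \<Rightarrow> nat \<Rightarrow> nat \<Rightarrow> 'k poly" where
  "reduced_basis D \<alpha> n b = flag_basis \<alpha> b -
     (\<Sum>l\<in>{l. l < b \<and> D l \<le> n}. smult (coeff (flag_basis \<alpha> b) l) (reduced_basis D \<alpha> n l))"

declare reduced_basis.simps [simp del]

lemma reduced_basis_props:
  assumes "D b \<le> n"
  shows "reduced_basis D \<alpha> n b \<in> flag_chain D \<alpha> n" "degree (reduced_basis D \<alpha> n b) \<le> b"
    "\<And>s. D s \<le> n \<Longrightarrow> coeff (reduced_basis D \<alpha> n b) s = (if s = b then 1 else 0)"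
proof -
  have "reduced_basis D \<alpha> n b \<in> flag_chain D \<alpha> n \<and> degree (reduced_basis D \<alpha> n b) \<le> b \<and>
    (\<forall>s. D s \<le> n \<longrightarrow> coeff (reduced_basis D \<alpha> n b) s = (if s = b then 1 else 0))"
    using assms
  proof (induction b rule: less_induct)
    case (less b)
    let ?L = "{l. l < b \<and> D l \<le> n}" let ?r = "reduced_basis D \<alpha> n"
    have IH: "?r l \<in> flag_chain D \<alpha> n" "degree (?r l) \<le> l"
      "\<And>s. D s \<le> n \<Longrightarrow> coeff (?r l) s = (if s = l then 1 else 0)" if "l \<in> ?L" for l
      using less.IH[of l] that by auto
    define S where "S = (\<Sum>l\<in>?L. smult (coeff (flag_basis \<alpha> b) l) (?r l))"
    have eq: "?r b = flag_basis \<alpha> b - S" unfolding S_def by (rule reduced_basis.simps)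
    have "S \<in> flag_chain D \<alpha> n" unfolding S_def using IH(1)
      unfolding flag_chain_def by (intro upoly.span_sum upoly.span_scale)
    moreover have "flag_basis \<alpha> b \<in> flag_chain D \<alpha> n"
      unfolding flag_chain_def using less.prems by (intro upoly.span_base) simp
    ultimately have 1: "?r b \<in> flag_chain D \<alpha> n"
      unfolding eq flag_chain_def by (intro upoly.span_diff)
    have "degree S \<le> b" unfolding S_def
    proof (rule degree_sum_le)
      fix l assume l: "l \<in> ?L"
      then show "degree (smult (coeff (flag_basis \<alpha> b) l) (?r l)) \<le> b"
        using IH(2)[OF l] order_trans[OF degree_smult_le] by simp
    qed simp
    then have 2: "degree (?r b) \<le> b" unfolding eq by (intro degree_diff_le) simp_all
    have S: "coeff S s = (if s < b then coeff (flag_basis \<alpha> b) s else 0)" if s: "D s \<le> n" for s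
    proof -
      have "coeff S s = (\<Sum>l\<in>?L. if l = s then coeff (flag_basis \<alpha> b) l else 0)"
        unfolding S_def coeff_sum using IH(3)[OF _ s] by (intro sum.cong) auto
      then show ?thesis using s by simp
    qed
    have 3: "coeff (?r b) s = (if s = b then 1 else 0)" if s: "D s \<le> n" for s
      unfolding eq coeff_diff S[OF s] by (auto simp: coeff_eq_0)
    show ?case using 1 2 3 by blast
  qed
  then show "reduced_basis D \<alpha> n b \<in> flag_chain D \<alpha> n" "degree (reduced_basis D \<alpha> n b) \<le> b"
    "\<And>s. D s \<le> n \<Longrightarrow> coeff (reduced_basis D \<alpha> n b) s = (if s = b then 1 else 0)"
    by auto
qed

lemma reduced_form_reduced_basis:
  assumes "D b \<le> n"
  shows "reduced_form D (flag_chain D \<alpha>) n b (reduced_basis D \<alpha> n b)"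
  unfolding reduced_form_def
  using reduced_basis_props[where D = "D" and b = b and n = n and \<alpha> = \<alpha>, OF assms] assms by (metis not_le)

text \<open>
  The coefficient of $y^s$ in the reduced element of degree \<open>b\<close> of the slice
  \<open>n\<close>, as a function on the cell.
\<close>
definition reduced_coordinate :: "nat list \<Rightarrow> nat \<Rightarrow> nat \<Rightarrow> nat \<Rightarrow> 'k::field bipoly set \<Rightarrow> 'k" where
  "reduced_coordinate P n b s =
     (if s = b then (\<lambda>_. 1)
      else if generator_degree P s \<le> n \<or> n < s then (\<lambda>_. 0)
      else cell_coordinate P (n - b, b) (n - s, s))"

lemma reduced_coordinate_polynomial:
  assumes "generator_degree P b \<le> n"
  shows "reduced_coordinate P n b s \<in> polynomial_functions P"
proof -
  have "b \<le> n" using assms generator_degree_ge[of b P] by simp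
  then show ?thesis using assms
    by (auto simp: reduced_coordinate_def C_set_iff intro!: polynomial_functions.const polynomial_functions.coordinate)
qed

lemma coeff_reduced_basis:
  assumes D: "staircase M (generator_degree P)" and \<alpha>: "admissible (generator_degree P) \<alpha>"
    and b: "generator_degree P b \<le> n"
  shows "coeff (reduced_basis (generator_degree P) \<alpha> n b) s =
    reduced_coordinate P n b s (ideal_of (flag_chain (generator_degree P) \<alpha>))"
proof -
  let ?D = "generator_degree P" let ?r = "reduced_basis ?D \<alpha> n b"
  note props = reduced_basis_props[where D = "?D" and b = b and n = n and \<alpha> = \<alpha>, OF b]
  have bn: "b \<le> n" using b generator_degree_ge[of b P] by simp
  consider "s = b" | "s \<noteq> b" "?D s \<le> n" | "s \<noteq> b" "n < s" | "s \<noteq> b" "n < ?D s" "s \<le> n" by linarith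
  then show ?thesis
  proof cases
    case 4
    have "cell_coordinate P (n - b, b) (n - s, s) (ideal_of (flag_chain ?D \<alpha>))
        = Poly_Mapping.lookup (homogenization (n - b + b) ?r) (n - s, s)"
      using reduced_form_reduced_basis[of ?D b n \<alpha>, OF b] bn
      by (intro cell_coordinate_eq cell_chain_flag_chain[OF D \<alpha>]) simp
    then show ?thesis using 4 bn by (simp add: reduced_coordinate_def lookup_homogenization)
  qed (use props b bn in \<open>simp_all add: reduced_coordinate_def coeff_eq_0\<close>)
qed

lemma span_reduced_basis:
  assumes D: "staircase M D" and \<alpha>: "admissible D \<alpha>"
  shows "upoly.span (reduced_basis D \<alpha> n ` {b. D b \<le> n}) = flag_chain D \<alpha> n"
proof
  have V: "cell_chain D (flag_chain D \<alpha>)" by (rule cell_chain_flag_chain[OF D \<alpha>])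
  then have sub: "upoly.subspace (flag_chain D \<alpha> n)" and degs: "degs (flag_chain D \<alpha> n) = {b. D b \<le> n}"
    by (auto simp: cell_chain_def form_chain_def)
  have r: "reduced_basis D \<alpha> n b \<in> flag_chain D \<alpha> n \<and> reduced_basis D \<alpha> n b \<noteq> 0 \<and> degree (reduced_basis D \<alpha> n b) = b"
    if "b \<in> degs (flag_chain D \<alpha> n)" for b
  proof -
    have b: "D b \<le> n" using that degs by simp
    note props = reduced_basis_props[where D = "D" and b = b and n = n and \<alpha> = \<alpha>, OF b]
    have "coeff (reduced_basis D \<alpha> n b) b = 1" using props(3)[OF b] by simp
    then have "b \<le> degree (reduced_basis D \<alpha> n b)" "reduced_basis D \<alpha> n b \<noteq> 0" by (auto intro: le_degree)
    then show ?thesis using props by simp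
  qed
  show "upoly.span (reduced_basis D \<alpha> n ` {b. D b \<le> n}) \<subseteq> flag_chain D \<alpha> n"
    using r degs by (intro upoly.span_minimal[OF _ sub]) auto
  show "flag_chain D \<alpha> n \<subseteq> upoly.span (reduced_basis D \<alpha> n ` {b. D b \<le> n})"
    using expand_in_span[OF sub r] unfolding degs by blast
qed

text \<open>
  The step space is spanned by the reduced elements of the slice \<open>n\<close> and their
  multiples by $y$, whose coefficients are coordinates of the cell. A subfamily that is a basis at
  one ideal stays independent on an open neighbourhood.
\<close>
lemma step_dimension_is_open:
  fixes \<alpha>0 :: "nat \<Rightarrow> nat \<Rightarrow> 'k::field"
  assumes D: "staircase M (generator_degree P)" and \<alpha>0: "admissible (generator_degree P) \<alpha>0"
  defines "V \<equiv> flag_chain (generator_degree P)"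
  shows "\<exists>g \<in> polynomial_functions P. g (ideal_of (V \<alpha>0)) \<noteq> 0 \<and>
    (\<forall>\<alpha>. admissible (generator_degree P) \<alpha> \<longrightarrow> g (ideal_of (V \<alpha>)) \<noteq> 0 \<longrightarrow>
       card (degs (step_space (V \<alpha>0) (Suc n))) \<le> card (degs (step_space (V \<alpha>) (Suc n))))"
proof -
  let ?D = "generator_degree P" let ?S = "{b. ?D b \<le> n}"
  define h where "h \<alpha> = case_sum (reduced_basis ?D \<alpha> n) (\<lambda>b. pCons 0 (reduced_basis ?D \<alpha> n b))"
    for \<alpha> :: "nat \<Rightarrow> nat \<Rightarrow> 'k"
  define w :: "nat + nat \<Rightarrow> nat \<Rightarrow> 'k bipoly set \<Rightarrow> 'k" where
    "w i s = (case i of Inl b \<Rightarrow> reduced_coordinate P n b s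
       | Inr b \<Rightarrow> (case s of 0 \<Rightarrow> (\<lambda>_. 0) | Suc s' \<Rightarrow> reduced_coordinate P n b s'))" for i s
  let ?J0 = "?S <+> ?S"
  have w_poly: "w i s \<in> polynomial_functions P" if "i \<in> ?J0" for i s
    using that reduced_coordinate_polynomial polynomial_functions.const[of 0]
    by (auto simp: w_def split: nat.split)
  have w: "coeff (h \<alpha> i) s = w i s (ideal_of (V \<alpha>))" if "i \<in> ?J0" "admissible ?D \<alpha>" for i s \<alpha>
    using that(1) coeff_reduced_basis[OF D that(2)]
    by (auto simp: w_def h_def V_def coeff_pCons split: nat.split)
  have chain: "form_chain (V \<alpha>)" if "admissible ?D \<alpha>" for \<alpha> :: "nat \<Rightarrow> nat \<Rightarrow> 'k"
    using cell_chain_flag_chain[OF D that] by (simp add: cell_chain_def V_def)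
  have rV: "reduced_basis ?D \<alpha> n b \<in> V \<alpha> n" if "?D b \<le> n" for \<alpha> :: "nat \<Rightarrow> nat \<Rightarrow> 'k" and b
    unfolding V_def by (rule reduced_basis_props(1)) (rule that)
  have hW: "h \<alpha> ` ?J0 \<subseteq> step_space (V \<alpha>) (Suc n)" if "admissible ?D \<alpha>" for \<alpha>
    using step_space_x[OF chain[OF that] rV] step_space_y[OF chain[OF that] rV] by (auto simp: h_def)
  have fin_degs: "finite (degs (step_space (V \<alpha>) m))" if "admissible ?D \<alpha>" for \<alpha> :: "nat \<Rightarrow> nat \<Rightarrow> 'k" and m
    by (rule finite_degs[OF form_chain_step_space[OF chain[OF that]]])
  have Wh: "step_space (V \<alpha>) (Suc n) \<subseteq> upoly.span (h \<alpha> ` ?J0)" if "admissible ?D \<alpha>" for \<alpha>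
  proof -
    have V: "V \<alpha> n = upoly.span (reduced_basis ?D \<alpha> n ` ?S)"
      unfolding V_def by (rule span_reduced_basis[OF D that, symmetric])
    have "reduced_basis ?D \<alpha> n ` ?S \<subseteq> h \<alpha> ` ?J0" by (force simp: h_def)
    then have 1: "V \<alpha> n \<subseteq> upoly.span (h \<alpha> ` ?J0)" unfolding V by (rule upoly.span_mono)
    have "V \<alpha> n \<subseteq> {q. pCons 0 q \<in> upoly.span (h \<alpha> ` ?J0)}"
      unfolding V
    proof (rule upoly.span_minimal[OF _ subspace_pCons_preimage[OF upoly.subspace_span]], clarify)
      fix b assume "?D b \<le> n"
      then have "h \<alpha> (Inr b) \<in> upoly.span (h \<alpha> ` ?J0)" by (intro upoly.span_base imageI) auto
      then show "pCons 0 (reduced_basis ?D \<alpha> n b) \<in> upoly.span (h \<alpha> ` ?J0)" by (simp add: h_def)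
    qed
    then show ?thesis using 1 by (auto simp: step_space_Suc intro: upoly.span_add)
  qed
  obtain X where X: "X \<subseteq> h \<alpha>0 ` ?J0" "upoly.independent X" "h \<alpha>0 ` ?J0 \<subseteq> upoly.span X"
    using upoly.maximal_independent_subset by blast
  obtain J where J: "J \<subseteq> ?J0" "inj_on (h \<alpha>0) J" "X = h \<alpha>0 ` J"
    using X(1) unfolding subset_image_inj by blast
  have finJ: "finite J" using J(1) finite_le_staircase[OF D] finite_subset finite_Plus by metis
  have "step_space (V \<alpha>0) (Suc n) \<subseteq> upoly.span X"
    using Wh[OF \<alpha>0] upoly.span_minimal[OF X(3) upoly.subspace_span] by blast
  then have cardJ: "card (degs (step_space (V \<alpha>0) (Suc n))) \<le> card J"
    using degs_card_le_spanning[of X, OF _ _ fin_degs[OF \<alpha>0]] finJ J(3) card_image[OF J(2)] by simp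
  have coeffs: "(\<forall>s. (\<Sum>i\<in>J. c i * w i s (ideal_of (V \<alpha>))) = 0) \<longleftrightarrow> (\<Sum>i\<in>J. smult (c i) (h \<alpha> i)) = 0"
    if "admissible ?D \<alpha>" for c \<alpha>
  proof -
    have "(\<Sum>i\<in>J. c i * w i s (ideal_of (V \<alpha>))) = coeff (\<Sum>i\<in>J. smult (c i) (h \<alpha> i)) s" for s
      unfolding coeff_sum
    proof (rule sum.cong)
      fix i assume "i \<in> J"
      then have "coeff (h \<alpha> i) s = w i s (ideal_of (V \<alpha>))" using J(1) by (intro w[OF _ that]) blast
      then show "c i * w i s (ideal_of (V \<alpha>)) = coeff (smult (c i) (h \<alpha> i)) s" by simp
    qed simp
    then show ?thesis by (simp add: poly_eq_iff)
  qed
  have ind0: "\<forall>c. (\<forall>s. (\<Sum>i\<in>J. c i * w i s (ideal_of (V \<alpha>0))) = 0) \<longrightarrow> (\<forall>i\<in>J. c i = 0)"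
    unfolding coeffs[OF \<alpha>0]
  proof (intro allI impI ballI)
    fix c i assume 0: "(\<Sum>i\<in>J. smult (c i) (h \<alpha>0 i)) = 0" and i: "i \<in> J"
    have "(\<Sum>x\<in>X. smult (c (the_inv_into J (h \<alpha>0) x)) x) = 0"
      unfolding J(3) sum.reindex[OF J(2)] using the_inv_into_f_f[OF J(2)] 0 by simp
    moreover have "finite X" "h \<alpha>0 i \<in> X" using i J(3) finJ by simp_all
    ultimately have "c (the_inv_into J (h \<alpha>0) (h \<alpha>0 i)) = 0"
      using upoly.independentD[OF X(2), of X "\<lambda>x. c (the_inv_into J (h \<alpha>0) x)" "h \<alpha>0 i"] by blast
    then show "c i = 0" using the_inv_into_f_f[OF J(2) i] by simp
  qed
  obtain g where g: "g \<in> polynomial_functions P" "g (ideal_of (V \<alpha>0)) \<noteq> 0"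
    "\<And>I. g I \<noteq> 0 \<Longrightarrow> \<forall>c. (\<forall>s. (\<Sum>i\<in>J. c i * w i s I) = 0) \<longrightarrow> (\<forall>i\<in>J. c i = 0)"
  proof -
    have "w i s \<in> polynomial_functions P" if "i \<in> J" for i s using w_poly J(1) that by blast
    from independence_is_open[OF finJ this ind0] show ?thesis using that by blast
  qed
  have "card (degs (step_space (V \<alpha>0) (Suc n))) \<le> card (degs (step_space (V \<alpha>) (Suc n)))"
    if \<alpha>: "admissible ?D \<alpha>" and "g (ideal_of (V \<alpha>)) \<noteq> 0" for \<alpha>
  proof -
    have fam: "\<forall>c. (\<Sum>i\<in>J. smult (c i) (h \<alpha> i)) = 0 \<longrightarrow> (\<forall>i\<in>J. c i = 0)"
      using g(3)[OF that(2)] unfolding coeffs[OF \<alpha>] .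
    have "h \<alpha> ` J \<subseteq> step_space (V \<alpha>) (Suc n)" using hW[OF \<alpha>] J(1) by blast
    then have "card (h \<alpha> ` J) \<le> card (degs (step_space (V \<alpha>) (Suc n)))"
      by (intro independent_card_le_degs[OF subspace_step_space[OF chain[OF \<alpha>]] fin_degs[OF \<alpha>]
          independent_family(2)[OF finJ fam]])
    then show ?thesis using cardJ card_image[OF independent_family(1)[OF finJ fam]] by simp
  qed
  then show ?thesis using g(1,2) by blast
qed

text \<open>
  The sum over all degrees of the generic number of generators. It starts with the generators of
  degree zero, which exist only for the empty partition, and stops at degree \<open>M\<close>.
\<close>
definition generic_generators :: "'k::field itself \<Rightarrow> nat \<Rightarrow> (nat \<Rightarrow> nat) \<Rightarrow> nat" where
  "generic_generators K M D =
     card {b. D b = 0} + (\<Sum>n<M. card {b. D b = Suc n} - rank_at K D n)"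

lemma min_generators_cell:
  fixes V :: "nat \<Rightarrow> 'k::field poly set"
  assumes D: "staircase M D" and V: "cell_chain D V"
    and r: "\<And>n. n < M \<Longrightarrow> card (degs (step_space V (Suc n))) = card {b. D b \<le> n} + rank_at TYPE('k) D n"
  shows "min_generators (ideal_of V) = generic_generators TYPE('k) M D"
proof -
  have chain: "form_chain V" and degs: "degs (V n) = {b. D b \<le> n}" for n
    using V by (auto simp: cell_chain_def)
  have "V n \<subseteq> step_space V n" if n: "M < n" for n
  proof (rule subset_if_degs_subset[OF subspace_step_space[OF chain] step_space_subset[OF chain] form_chain_subspace[OF chain]])
    obtain m where m: "n = Suc m" "M \<le> m" using n by (cases n) auto
    have "m \<in> degs (V m)" using staircase_fixed[OF D m(2)] by (simp add: degs)
    then obtain p where p: "p \<in> V m" "p \<noteq> 0" "degree p = m" by (auto simp: degs_def)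
    have "Suc m \<in> degs (step_space V n)"
      using degsI[OF step_space_y[OF chain p(1)]] p by (simp add: m)
    moreover have "degs (V m) \<subseteq> degs (step_space V n)"
      unfolding m by (rule degs_mono) (use step_space_x[OF chain] in blast)
    moreover have "b = Suc m" if "D b = Suc m" for b
      using D that m n unfolding staircase_def by blast
    ultimately show "degs (V n) \<subseteq> degs (step_space V n)"
      unfolding degs by (auto simp: m le_Suc_eq)
  qed
  then have "min_generators (ideal_of V) = (\<Sum>n\<le>M. card (degs (V n) - degs (step_space V n)))"
    by (rule min_generators_ideal_of[OF chain])
  also have "\<dots> = card (degs (V 0) - degs (step_space V 0))
      + (\<Sum>n<M. card (degs (V (Suc n)) - degs (step_space V (Suc n))))"
    unfolding lessThan_Suc_atMost[symmetric] sum.lessThan_Suc_shift by simp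
  also have "degs (V 0) - degs (step_space V 0) = {b. D b = 0}" by (auto simp: degs degs_def[of "{0}"])
  also have "(\<Sum>n<M. card (degs (V (Suc n)) - degs (step_space V (Suc n))))
      = (\<Sum>n<M. card {b. D b = Suc n} - rank_at TYPE('k) D n)"
  proof (rule sum.cong)
    fix n assume "n \<in> {..<M}"
    have "card (degs (V (Suc n)) - degs (step_space V (Suc n)))
        = card (degs (V (Suc n))) - card (degs (step_space V (Suc n)))"
      using degs_mono[OF step_space_subset[OF chain]] finite_degs[OF form_chain_step_space[OF chain]]
      by (intro card_Diff_subset)
    also have "{b. D b \<le> Suc n} = {b. D b \<le> n} \<union> {b. D b = Suc n}" by auto
    then have "card (degs (V (Suc n))) = card {b. D b \<le> n} + card {b. D b = Suc n}"
      unfolding degs using finite_le_staircase[OF D] finite_eq_staircase[OF D]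
      by (simp add: card_Un_disjoint disjoint_iff)
    finally show "card (degs (V (Suc n)) - degs (step_space V (Suc n))) = card {b. D b = Suc n} - rank_at TYPE('k) D n"
      using r[of n] \<open>n \<in> {..<M}\<close> by simp
  qed simp
  finally show ?thesis by (simp add: generic_generators_def)
qed

text \<open>
  The ideal \<open>I0\<close> has maximal rank in every degree. Where \<open>g\<close> does not
  vanish the ranks are at least those of \<open>I0\<close> by semicontinuity, and at most those by
  maximality.
\<close>
lemma generic_open_set:
  assumes P: "is_partition P" and D: "staircase M (generator_degree P)"
  obtains g I0 where "g \<in> polynomial_functions P" "I0 \<in> jordan_cell P" "g I0 \<noteq> (0 :: 'k::field)"
    "\<And>I. I \<in> jordan_cell P \<Longrightarrow> g I \<noteq> 0 \<Longrightarrow> min_generators I = generic_generators TYPE('k) M (generator_degree P)"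
proof -
  let ?D = "generator_degree P" let ?V = "flag_chain (generator_degree P)"
  obtain \<alpha>0 :: "nat \<Rightarrow> nat \<Rightarrow> 'k" where \<alpha>0: "admissible ?D \<alpha>0"
    and r0: "\<And>n. card (degs (step_space (?V \<alpha>0) (Suc n))) = card {b. ?D b \<le> n} + rank_at TYPE('k) ?D n"
    using generic_chain_exists[OF D] by blast
  define good where "good n g \<longleftrightarrow> g \<in> polynomial_functions P \<and> g (ideal_of (?V \<alpha>0)) \<noteq> 0 \<and>
    (\<forall>\<alpha>. admissible ?D \<alpha> \<longrightarrow> g (ideal_of (?V \<alpha>)) \<noteq> 0 \<longrightarrow>
       card (degs (step_space (?V \<alpha>0) (Suc n))) \<le> card (degs (step_space (?V \<alpha>) (Suc n))))" for n and g :: "'k bipoly set \<Rightarrow> 'k"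
  have "\<exists>g. good n g" for n
    using step_dimension_is_open[OF D \<alpha>0, of n] unfolding good_def by blast
  then obtain g where "\<And>n. good n (g n)" by metis
  then have g: "\<And>n. g n \<in> polynomial_functions P" "\<And>n. g n (ideal_of (?V \<alpha>0)) \<noteq> 0"
    "\<And>n \<alpha>. admissible ?D \<alpha> \<Longrightarrow> g n (ideal_of (?V \<alpha>)) \<noteq> 0 \<Longrightarrow>
       card (degs (step_space (?V \<alpha>0) (Suc n))) \<le> card (degs (step_space (?V \<alpha>) (Suc n)))"
    by (auto simp: good_def)
  define G where "G I = (\<Prod>n<M. g n I)" for I
  show ?thesis
  proof (rule that)
    have "(\<lambda>I. \<Prod>n<M. g n I) \<in> polynomial_functions P" using g(1) by (intro polynomial_functions_prod) auto
    then show "G \<in> polynomial_functions P" by (simp add: G_def[abs_def])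
    show "ideal_of (?V \<alpha>0) \<in> jordan_cell P"
      using cell_chain_flag_chain[OF D \<alpha>0] unfolding jordan_cell_iff[OF P] by blast
    show "G (ideal_of (?V \<alpha>0)) \<noteq> 0" using g(2) by (simp add: G_def)
    fix I :: "'k bipoly set" assume I: "I \<in> jordan_cell P" "G I \<noteq> 0"
    obtain V where V: "cell_chain ?D V" "I = ideal_of V" using I(1) unfolding jordan_cell_iff[OF P] by blast
    obtain \<alpha> where \<alpha>: "admissible ?D \<alpha>" "V = ?V \<alpha>" using cell_chain_is_flag_chain[OF D V(1)] by blast
    have "card (degs (step_space V (Suc n))) = card {b. ?D b \<le> n} + rank_at TYPE('k) ?D n" if "n < M" for n
    proof (rule antisym)
      show "card (degs (step_space V (Suc n))) \<le> card {b. ?D b \<le> n} + rank_at TYPE('k) ?D n"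
        unfolding \<alpha>(2) by (rule step_space_degs_le[OF D \<alpha>(1)])
      have "g n I \<noteq> 0" using I(2) that by (simp add: G_def)
      then show "card {b. ?D b \<le> n} + rank_at TYPE('k) ?D n \<le> card (degs (step_space V (Suc n)))"
        using g(3)[OF \<alpha>(1), of n] r0[of n] by (simp add: V(2) \<alpha>(2))
    qed
    then show "min_generators I = generic_generators TYPE('k) M ?D"
      unfolding V(2) by (intro min_generators_cell[OF D V(1)])
  qed
qed

section \<open>Irreducibility of the cells\<close>

text \<open>
  The name refers to its use: a family of ideals is a curve in the cell if every coordinate, as a
  function of the parameter \<open>t\<close>, satisfies this condition.
\<close>
definition polynomial_curve :: "('k::field \<Rightarrow> 'k) \<Rightarrow> bool" where
  "polynomial_curve f \<longleftrightarrow> (\<exists>p. \<forall>t. f t = poly p t)"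

lemma polynomial_curve_const: "polynomial_curve (\<lambda>_. c)"
  unfolding polynomial_curve_def by (rule exI[of _ "[:c:]"]) simp

lemma polynomial_curve_ident: "polynomial_curve (\<lambda>t. t)"
  unfolding polynomial_curve_def by (rule exI[of _ "[:0, 1:]"]) simp

lemma polynomial_curve_add:
  assumes "polynomial_curve f" "polynomial_curve g" shows "polynomial_curve (\<lambda>t. f t + g t)"
  using assms unfolding polynomial_curve_def by (metis poly_add)

lemma polynomial_curve_diff:
  assumes "polynomial_curve f" "polynomial_curve g" shows "polynomial_curve (\<lambda>t. f t - g t)"
  using assms unfolding polynomial_curve_def by (metis poly_diff)

lemma polynomial_curve_mult:
  assumes "polynomial_curve f" "polynomial_curve g" shows "polynomial_curve (\<lambda>t. f t * g t)"
  using assms unfolding polynomial_curve_def by (metis poly_mult)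

lemma polynomial_curve_sum:
  assumes "\<And>i. i \<in> A \<Longrightarrow> polynomial_curve (f i)" shows "polynomial_curve (\<lambda>t. \<Sum>i\<in>A. f i t)"
  using assms by (induction A rule: infinite_finite_induct)
    (simp_all add: polynomial_curve_const polynomial_curve_add)

lemma polynomial_curve_flag_basis:
  assumes \<alpha>: "\<And>l b. polynomial_curve (\<lambda>t. \<alpha> t l b)"
  shows "polynomial_curve (\<lambda>t. coeff (flag_basis (\<alpha> t) b) s)"
proof (induction b arbitrary: s rule: less_induct)
  case (less b)
  show ?case
  proof (cases b)
    case 0
    then show ?thesis by (simp add: polynomial_curve_const)
  next
    case (Suc b')
    have "polynomial_curve (\<lambda>t. coeff (pCons 0 (flag_basis (\<alpha> t) b')) s)"
      using less[of b'] Suc by (cases s) (simp_all add: polynomial_curve_const)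
    moreover have "polynomial_curve (\<lambda>t. \<Sum>l\<le>b'. \<alpha> t l b' * coeff (flag_basis (\<alpha> t) l) s)"
      using less Suc \<alpha> by (intro polynomial_curve_sum polynomial_curve_mult) auto
    ultimately show ?thesis
      unfolding Suc flag_basis.simps coeff_diff coeff_sum coeff_smult by (rule polynomial_curve_diff)
  qed
qed

lemma polynomial_curve_reduced_basis:
  assumes \<alpha>: "\<And>l b. polynomial_curve (\<lambda>t. \<alpha> t l b)"
  shows "polynomial_curve (\<lambda>t. coeff (reduced_basis D (\<alpha> t) n b) s)"
proof (induction b arbitrary: s rule: less_induct)
  case (less b)
  show ?case
    unfolding reduced_basis.simps[of D _ n b] coeff_diff coeff_sum coeff_smult
    using less polynomial_curve_flag_basis[OF \<alpha>]
    by (intro polynomial_curve_diff polynomial_curve_sum polynomial_curve_mult) auto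
qed

lemma polynomial_curve_polynomial_function:
  assumes D: "staircase M (generator_degree P)"
    and \<alpha>: "\<And>l b. polynomial_curve (\<lambda>t. \<alpha> t l b)" "\<And>t. admissible (generator_degree P) (\<alpha> t)"
    and h: "h \<in> polynomial_functions P"
  shows "polynomial_curve (\<lambda>t. h (ideal_of (flag_chain (generator_degree P) (\<alpha> t))))"
  using h
proof induction
  case (const c)
  show ?case by (rule polynomial_curve_const)
next
  case (coordinate m m')
  obtain a b a' b' where m: "m = (a, b)" "m' = (a', b')" by fastforce
  have b: "generator_degree P b \<le> a + b" using coordinate by (simp add: m C_set_iff not_less)
  have "cell_coordinate P m m' (ideal_of (flag_chain (generator_degree P) (\<alpha> t)))
      = (if a' + b' = a + b then coeff (reduced_basis (generator_degree P) (\<alpha> t) (a + b) b) b' else 0)" for t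
    unfolding m using cell_coordinate_eq[OF cell_chain_flag_chain[OF D \<alpha>(2)]
      reduced_form_reduced_basis[of "generator_degree P" b "a + b" "\<alpha> t", OF b]]
    by (simp add: lookup_homogenization)
  then show ?case
    using polynomial_curve_reduced_basis[OF \<alpha>(1)] polynomial_curve_const[of 0] by (cases "a' + b' = a + b") simp_all
next
  case (add g h)
  then show ?case by (intro polynomial_curve_add)
next
  case (mult g h)
  then show ?case by (intro polynomial_curve_mult)
qed

text \<open>
  The structure constants of \<open>I0\<close> and \<open>I1\<close> are joined by a line, and
  admissibility is a linear condition. Along the line \<open>g\<close> and \<open>h\<close> are
  polynomials in the parameter, the first nonzero at 0 and the second at 1; over an infinite field
  their product has a non-root.
\<close>
lemma jordan_cell_irreducible:
  fixes g h :: "'k::field bipoly set \<Rightarrow> 'k"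
  assumes inf: "infinite (UNIV :: 'k set)"
    and P: "is_partition P" and D: "staircase M (generator_degree P)"
    and g: "g \<in> polynomial_functions P" "I0 \<in> jordan_cell P" "g I0 \<noteq> 0"
    and h: "h \<in> polynomial_functions P" "I1 \<in> jordan_cell P" "h I1 \<noteq> 0"
  shows "\<exists>I \<in> jordan_cell P. g I \<noteq> 0 \<and> h I \<noteq> 0"
proof -
  let ?D = "generator_degree P" let ?V = "flag_chain (generator_degree P)"
  have param: "\<exists>\<alpha>. admissible ?D \<alpha> \<and> I = ideal_of (?V \<alpha>)" if "I \<in> jordan_cell P" for I :: "'k bipoly set"
    using that cell_chain_is_flag_chain[OF D] unfolding jordan_cell_iff[OF P] by metis
  obtain \<alpha>0 \<alpha>1 where \<alpha>0: "admissible ?D \<alpha>0" "I0 = ideal_of (?V \<alpha>0)"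
    and \<alpha>1: "admissible ?D \<alpha>1" "I1 = ideal_of (?V \<alpha>1)"
    using param[OF g(2)] param[OF h(2)] by blast
  define \<alpha> where "\<alpha> t l b = \<alpha>0 l b + t * (\<alpha>1 l b - \<alpha>0 l b)" for t l b
  have line: "polynomial_curve (\<lambda>t. \<alpha> t l b)" for l b
    unfolding \<alpha>_def
    by (intro polynomial_curve_add polynomial_curve_mult polynomial_curve_const polynomial_curve_ident)
  have adm: "admissible ?D (\<alpha> t)" for t
    using \<alpha>0(1) \<alpha>1(1) by (simp add: admissible_def \<alpha>_def)
  obtain p q where p: "\<And>t. g (ideal_of (?V (\<alpha> t))) = poly p t" and q: "\<And>t. h (ideal_of (?V (\<alpha> t))) = poly q t"
    using polynomial_curve_polynomial_function[OF D line adm g(1)]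
      polynomial_curve_polynomial_function[OF D line adm h(1)] unfolding polynomial_curve_def by blast
  have "\<alpha> 0 = \<alpha>0" "\<alpha> 1 = \<alpha>1" by (auto simp: \<alpha>_def fun_eq_iff)
  then have "poly p 0 \<noteq> 0" "poly q 1 \<noteq> 0" using p[of 0] q[of 1] g(3) h(3) \<alpha>0(2) \<alpha>1(2) by auto
  then have "p * q \<noteq> 0" by auto
  then have "finite {t. poly (p * q) t = 0}" by (rule poly_roots_finite)
  then obtain t where "poly (p * q) t \<noteq> 0" using inf by (metis (mono_tags, lifting) UNIV_eq_I mem_Collect_eq)
  then have "g (ideal_of (?V (\<alpha> t))) \<noteq> 0" "h (ideal_of (?V (\<alpha> t))) \<noteq> 0" using p q by auto
  moreover have "ideal_of (?V (\<alpha> t)) \<in> jordan_cell P"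
    using cell_chain_flag_chain[OF D adm] unfolding jordan_cell_iff[OF P] by blast
  ultimately show ?thesis by blast
qed

lemma zariski_topspace: "topspace (zariski_topology P) = (jordan_cell P :: 'k::field bipoly set set)"
proof -
  let ?S = "{{I \<in> jordan_cell P. g I \<noteq> 0} | g. g \<in> polynomial_functions P} :: 'k bipoly set set set"
  have "\<exists>g. jordan_cell P = {I \<in> jordan_cell P. g I \<noteq> (0 :: 'k)} \<and> g \<in> polynomial_functions P"
    using polynomial_functions.const[of "1 :: 'k" P] by (intro exI[of _ "\<lambda>_. 1"]) simp
  then have "jordan_cell P \<in> ?S" by (rule CollectI)
  then have "jordan_cell P \<subseteq> \<Union>?S" by (rule Union_upper)
  moreover have "\<Union>?S \<subseteq> jordan_cell P" by (rule Union_least) blast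
  ultimately show ?thesis unfolding zariski_topology_def topology_generated_by_topspace by (rule subset_antisym[rotated])
qed

lemma zariski_open_contains_basic:
  assumes "openin (zariski_topology P) T" "I \<in> T"
  shows "\<exists>h \<in> polynomial_functions P. h I \<noteq> 0 \<and> {I \<in> jordan_cell P. h I \<noteq> 0} \<subseteq> T"
proof -
  have "generate_topology_on {{I \<in> jordan_cell P. g I \<noteq> 0} | g. g \<in> polynomial_functions P} T"
    using assms(1) unfolding zariski_topology_def openin_topology_generated_by_iff .
  then show ?thesis using assms(2)
  proof induction
    case (Int A B)
    then obtain h1 h2 where h: "h1 \<in> polynomial_functions P" "h1 I \<noteq> 0" "{I \<in> jordan_cell P. h1 I \<noteq> 0} \<subseteq> A"
      "h2 \<in> polynomial_functions P" "h2 I \<noteq> 0" "{I \<in> jordan_cell P. h2 I \<noteq> 0} \<subseteq> B" by blast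
    then show ?case
      by (intro bexI[OF _ polynomial_functions.mult[OF h(1) h(4)]]) auto
  next
    case (UN K)
    then obtain k where "k \<in> K" "I \<in> k" by blast
    then show ?case using UN.IH[of k] by blast
  next
    case (Basis S)
    then show ?case by blast
  qed simp
qed

text \<open>
  A nonempty open subset of an irreducible space is dense, and two dense open subsets meet, so the
  defining property of \<open>kappa\<close> singles out the generic value.
\<close>
theorem kappa_eq_generic_generators:
  assumes inf: "infinite (UNIV :: 'k::field set)"
    and P: "is_partition P" and D: "staircase M (generator_degree P)"
  shows "kappa TYPE('k) P = generic_generators TYPE('k) M (generator_degree P)"
proof -
  let ?Z = "zariski_topology P :: 'k bipoly set topology"
  obtain g I0 where g: "g \<in> polynomial_functions P" "I0 \<in> jordan_cell P" "g I0 \<noteq> (0 :: 'k)"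
    and gen: "\<And>I. I \<in> jordan_cell P \<Longrightarrow> g I \<noteq> 0 \<Longrightarrow>
      min_generators I = generic_generators TYPE('k) M (generator_degree P)"
    using generic_open_set[OF P D] by blast
  define U where "U = {I \<in> jordan_cell P. g I \<noteq> 0}"
  have openU: "openin ?Z U" unfolding zariski_topology_def U_def
    using g(1) by (intro topology_generated_by_Basis) blast
  have closure: "?Z closure_of U = jordan_cell P"
  proof
    show "?Z closure_of U \<subseteq> jordan_cell P"
      using closure_of_subset_topspace[of ?Z U] by (simp add: zariski_topspace)
    show "jordan_cell P \<subseteq> ?Z closure_of U"
    proof
      fix I1 :: "'k bipoly set" assume I1: "I1 \<in> jordan_cell P"
      have "\<exists>I. I \<in> U \<and> I \<in> T" if T: "I1 \<in> T" "openin ?Z T" for T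
      proof -
        obtain h where h: "h \<in> polynomial_functions P" "h I1 \<noteq> 0" "{I \<in> jordan_cell P. h I \<noteq> 0} \<subseteq> T"
          using zariski_open_contains_basic[OF T(2,1)] by blast
        show ?thesis using jordan_cell_irreducible[OF inf P D g h(1) I1 h(2)] h(3) by (auto simp: U_def)
      qed
      then show "I1 \<in> ?Z closure_of U" using I1 by (simp add: in_closure_of zariski_topspace)
    qed
  qed
  show ?thesis unfolding kappa_def
  proof (rule the_equality)
    show "\<exists>U. openin ?Z U \<and> U \<noteq> {} \<and> ?Z closure_of U = jordan_cell P \<and>
        (\<forall>I\<in>U. min_generators I = generic_generators TYPE('k) M (generator_degree P))"
    proof (intro exI[of _ U] conjI)
      show "U \<noteq> {}" using g unfolding U_def by blast
      show "\<forall>I\<in>U. min_generators I = generic_generators TYPE('k) M (generator_degree P)"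
        using gen unfolding U_def by blast
    qed (rule openU, rule closure)
    fix n assume "\<exists>U'. openin ?Z U' \<and> U' \<noteq> {} \<and> ?Z closure_of U' = jordan_cell P \<and> (\<forall>I\<in>U'. min_generators I = n)"
    then obtain U' I where U': "openin ?Z U'" "I \<in> U'" "\<forall>I\<in>U'. min_generators I = n" by blast
    have "I \<in> ?Z closure_of U"
      using openin_subset[OF U'(1)] U'(2) unfolding closure zariski_topspace by blast
    then obtain J where "J \<in> U" "J \<in> U'" using U' unfolding in_closure_of by blast
    then show "n = generic_generators TYPE('k) M (generator_degree P)" using gen[of J] U'(3) unfolding U_def by auto
  qed
qed

section \<open>Words with ascents of size one\<close>

text \<open>
  A matrix of the given shape is carried along \<open>f\<close> and extended by the entries that
  the shape forces; the hypothesis on \<open>f\<close> says that the forced entries inside the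
  block are the same before and after.
\<close>
lemma generic_rank_le_transport:
  assumes C: "finite C" and inj: "inj_on f (R \<union> C)"
    and shape: "\<And>l b. l \<in> R \<Longrightarrow> b \<in> C \<Longrightarrow> (f l = Suc (f b) \<longleftrightarrow> l = Suc b) \<and> (Suc (f b) < f l \<longleftrightarrow> Suc b < l)"
  shows "generic_rank TYPE('k::field) R C \<le> generic_rank TYPE('k) (f ` R) (f ` C)"
proof -
  obtain A :: "nat \<Rightarrow> nat \<Rightarrow> 'k" and B where B: "B \<subseteq> C" "ascent_pattern A"
    "independent_columns A R B" "card B = generic_rank TYPE('k) R C"
    using generic_rank_attained[OF C] by metis
  define g where "g = the_inv_into (R \<union> C) f"
  have g: "g (f x) = x" if "x \<in> R \<union> C" for x unfolding g_def using inj that by (rule the_inv_into_f_f)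
  \<comment> \<open>Outside the block only the entries forced by the shape matter.\<close>
  define A' where "A' l b = (if l \<in> f ` R \<and> b \<in> f ` C then A (g l) (g b) else if l = Suc b then 1 else 0)" for l b
  have "A' (Suc b) b = 1 \<and> (\<forall>l > Suc b. A' l b = 0)" for b
  proof (cases "b \<in> f ` C")
    case True
    then obtain b0 where b0: "b0 \<in> C" "b = f b0" by blast
    have "A' (Suc b) b = 1"
    proof (cases "Suc b \<in> f ` R")
      case True
      then obtain l0 where l0: "l0 \<in> R" "Suc b = f l0" by blast
      then have "l0 = Suc b0" using shape[OF l0(1) b0(1)] b0 by simp
      then show ?thesis using l0 b0 g[of l0] g[of b0] B(2) by (simp add: A'_def ascent_pattern_def)
    qed (simp add: A'_def)
    moreover have "A' l b = 0" if "Suc b < l" for l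
    proof (cases "l \<in> f ` R")
      case True
      then obtain l0 where l0: "l0 \<in> R" "l = f l0" by blast
      then have "Suc b0 < l0" using shape[OF l0(1) b0(1)] b0 that by simp
      then show ?thesis using l0 b0 g[of l0] g[of b0] B(2) by (simp add: A'_def ascent_pattern_def)
    qed (use that in \<open>simp add: A'_def\<close>)
    ultimately show ?thesis by blast
  qed (simp add: A'_def)
  then have pattern: "ascent_pattern A'" by (simp add: ascent_pattern_def)
  have injB: "inj_on f B" using inj B(1) by (meson inj_on_subset le_supI2)
  have "independent_columns A' (f ` R) (f ` B)"
    unfolding independent_columns_def
  proof (intro allI impI)
    fix c assume 0: "\<forall>l\<in>f ` R. (\<Sum>b\<in>f ` B. c b * A' l b) = 0"
    have "\<forall>l\<in>R. (\<Sum>b\<in>B. c (f b) * A l b) = 0"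
    proof
      fix l assume l: "l \<in> R"
      have "(\<Sum>b\<in>B. c (f b) * A l b) = (\<Sum>b\<in>B. c (f b) * A' (f l) (f b))"
      proof (rule sum.cong)
        fix b assume "b \<in> B"
        then have "b \<in> C" using B(1) by blast
        then show "c (f b) * A l b = c (f b) * A' (f l) (f b)" using l g[of l] g[of b] by (simp add: A'_def)
      qed simp
      also have "\<dots> = 0" using 0 l by (simp add: sum.reindex[OF injB])
      finally show "(\<Sum>b\<in>B. c (f b) * A l b) = 0" .
    qed
    then have "\<forall>b\<in>B. c (f b) = 0"
      using B(3)[unfolded independent_columns_def, rule_format, of "\<lambda>b. c (f b)"] by blast
    then show "\<forall>b\<in>f ` B. c b = 0" by blast
  qed
  then have "card (f ` B) \<le> generic_rank TYPE('k) (f ` R) (f ` C)"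
    using C B(1) pattern by (intro generic_rank_ge) auto
  then show ?thesis using card_image[OF injB] B(4) by simp
qed

lemma generic_rank_transport:
  assumes C: "finite C" and inj: "inj_on f (R \<union> C)"
    and shape: "\<And>l b. l \<in> R \<Longrightarrow> b \<in> C \<Longrightarrow> (f l = Suc (f b) \<longleftrightarrow> l = Suc b) \<and> (Suc (f b) < f l \<longleftrightarrow> Suc b < l)"
  shows "generic_rank TYPE('k::field) (f ` R) (f ` C) = generic_rank TYPE('k) R C"
proof (rule antisym)
  show "generic_rank TYPE('k) R C \<le> generic_rank TYPE('k) (f ` R) (f ` C)"
    by (rule generic_rank_le_transport[OF assms])
  define g where "g = the_inv_into (R \<union> C) f"
  have g: "g (f x) = x" if "x \<in> R \<union> C" for x unfolding g_def using inj that by (rule the_inv_into_f_f)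
  have gR: "g ` f ` R = R" and gC: "g ` f ` C = C" using g by (force simp: image_image)+
  have "generic_rank TYPE('k) (f ` R) (f ` C) \<le> generic_rank TYPE('k) (g ` f ` R) (g ` f ` C)"
  proof (rule generic_rank_le_transport)
    show "inj_on g (f ` R \<union> f ` C)" by (rule inj_on_inverseI[of _ f]) (use g in auto)
    fix l b assume "l \<in> f ` R" "b \<in> f ` C"
    then obtain l0 b0 where "l0 \<in> R" "l = f l0" "b0 \<in> C" "b = f b0" by blast
    then show "(g l = Suc (g b) \<longleftrightarrow> l = Suc b) \<and> (Suc (g b) < g l \<longleftrightarrow> Suc b < l)"
      using shape[of l0 b0] g[of l0] g[of b0] by simp
  qed (use C in simp)
  then show "generic_rank TYPE('k) (f ` R) (f ` C) \<le> generic_rank TYPE('k) R C" by (simp only: gR gC)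
qed

definition positions :: "nat list \<Rightarrow> nat \<Rightarrow> nat set" where
  "positions v n = {i. i < length v \<and> v ! i = n}"

text \<open>
  The generic number of generators of degree \<open>n + 1\<close>, for a word that lists generator
  degrees.
\<close>
definition generators_after :: "'k::field itself \<Rightarrow> nat \<Rightarrow> nat list \<Rightarrow> nat" where
  "generators_after K n v =
     card (positions v (Suc n)) - generic_rank K (positions v (Suc n)) (positions v n)"

abbreviation ascending :: "nat list \<Rightarrow> bool" where
  "ascending \<equiv> successively (\<lambda>a b. b \<le> Suc a)"

lemma finite_positions: "finite (positions v n)"
  by (simp add: positions_def)

lemma generators_after_shift: "generators_after K (n + s) (map ((+) s) v) = generators_after K n v"
proof -
  have "positions (map ((+) s) v) (m + s) = positions v m" for m
    by (auto simp: positions_def)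
  from this[of n] this[of "Suc n"] show ?thesis by (simp add: generators_after_def)
qed

lemma ascending_nth: "ascending v \<Longrightarrow> Suc i < length v \<Longrightarrow> v ! Suc i \<le> Suc (v ! i)"
  by (rule successively_nth) auto

text \<open>
  A word with ascents of size one takes all intermediate values on the way up.
\<close>
lemma ascending_passes:
  assumes v: "ascending v" and ik: "i < k" "k < length v" and n: "v ! i < n" "n < v ! k"
  shows "\<exists>m. i < m \<and> m < k \<and> v ! m = n"
proof (rule ccontr)
  assume no: "\<not> ?thesis"
  have "i + m < k \<Longrightarrow> v ! (i + m) < n" for m
  proof (induction m)
    case (Suc m)
    then have "v ! (i + Suc m) \<le> n" using ascending_nth[OF v, of "i + m"] ik by simp
    moreover have "v ! (i + Suc m) \<noteq> n" using no Suc.prems by auto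
    ultimately show ?case by simp
  qed (use n in simp)
  from this[of "k - 1 - i"] have "v ! (k - 1) < n" using ik by simp
  then show False using ascending_nth[OF v, of "k - 1"] ik n by simp
qed

text \<open>
  Deleting the other letters preserves the order of the letters \<open>n\<close> and \<open>n +
  1\<close>. It also preserves the positions where \<open>n + 1\<close> follows \<open>n\<close>
  immediately: between a letter \<open>n\<close> and the next relevant letter \<open>n + 1\<close>
  there is nothing else, since the word could leave \<open>n\<close> only downwards and would have
  to pass \<open>n\<close> again to reach \<open>n + 1\<close>.
\<close>
lemma generators_after_filter:
  assumes v: "ascending v"
  shows "generators_after TYPE('k::field) n (filter (\<lambda>a. a \<in> {n, Suc n}) v) = generators_after TYPE('k) n v"
proof -
  define P where "P = (\<lambda>a. a \<in> {n, Suc n})"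
  define idx where "idx = filter (\<lambda>i. P (v ! i)) [0..<length v]"
  define w where "w = filter P v"
  have "filter P (map ((!) v) [0..<length v]) = map ((!) v) idx"
    unfolding filter_map idx_def comp_def by simp
  then have w: "w = map ((!) v) idx" by (simp only: map_nth w_def)
  have sorted: "sorted_wrt (<) idx" unfolding idx_def by (intro sorted_wrt_filter) simp
  have mono: "idx ! i < idx ! k" if "i < k" "k < length idx" for i k
    using sorted that by (simp add: sorted_wrt_iff_nth_less)
  have set_idx: "set idx = {i. i < length v \<and> P (v ! i)}" by (auto simp: idx_def)
  have idx_lt: "idx ! k < length v" "P (v ! (idx ! k))" if "k < length idx" for k
    using nth_mem[OF that] unfolding set_idx by auto
  have img: "(!) idx ` positions w m = positions v m" if "P m" for m
  proof
    show "(!) idx ` positions w m \<subseteq> positions v m"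
      using idx_lt by (auto simp: positions_def w)
    show "positions v m \<subseteq> (!) idx ` positions w m"
    proof
      fix i assume i: "i \<in> positions v m"
      then have "i \<in> set idx" using that by (simp add: set_idx positions_def)
      then obtain k where "k < length idx" "i = idx ! k" by (auto simp: in_set_conv_nth)
      then show "i \<in> (!) idx ` positions w m" using i by (auto simp: positions_def w)
    qed
  qed
  have strict: "idx ! i < idx ! k \<longleftrightarrow> i < k" if "i < length idx" "k < length idx" for i k
    using mono[of i k] mono[of k i] that by (metis less_asym less_irrefl linorder_neqE_nat)
  have inj: "inj_on ((!) idx) (positions w (Suc n) \<union> positions w n)"
    using strict by (intro inj_onI) (auto simp: positions_def w intro: ccontr, (metis less_irrefl linorder_neqE_nat)+)
  have next_iff: "idx ! l = Suc (idx ! b) \<longleftrightarrow> l = Suc b"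
    if l: "l \<in> positions w (Suc n)" and b: "b \<in> positions w n" for l b
  proof
    have len: "l < length idx" "b < length idx" and vals: "v ! (idx ! l) = Suc n" "v ! (idx ! b) = n"
      using l b by (auto simp: positions_def w)
    assume eq: "idx ! l = Suc (idx ! b)"
    then have "b < l" using strict[OF len(2,1)] by simp
    then show "l = Suc b" using mono[of b "Suc b"] mono[of "Suc b" l] eq len by (cases "l = Suc b") simp_all
  next
    have len: "l < length idx" "b < length idx" and vals: "v ! (idx ! l) = Suc n" "v ! (idx ! b) = n"
      using l b by (auto simp: positions_def w)
    assume eq: "l = Suc b"
    have lt: "idx ! b < idx ! l" using mono[of b l] eq len by simp
    have gap: False if i: "idx ! b < i" "i < idx ! l" "P (v ! i)" for i
    proof -
      have "i \<in> set idx" using i idx_lt(1)[OF len(1)] by (simp add: set_idx)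
      then obtain k where k: "k < length idx" "i = idx ! k" by (auto simp: in_set_conv_nth)
      then have "b < k" "k < l" using i strict len by auto
      then show False using eq by simp
    qed
    show "idx ! l = Suc (idx ! b)"
    proof (rule ccontr)
      assume "idx ! l \<noteq> Suc (idx ! b)"
      then have far: "Suc (idx ! b) < idx ! l" using lt by simp
      have llen: "idx ! l < length v" by (rule idx_lt(1)[OF len(1)])
      have "v ! Suc (idx ! b) \<le> Suc n" using ascending_nth[OF v, of "idx ! b"] far llen vals by simp
      moreover have "\<not> P (v ! Suc (idx ! b))" using gap[of "Suc (idx ! b)"] far by auto
      ultimately have "v ! Suc (idx ! b) < n" by (auto simp: P_def le_Suc_eq)
      then obtain m where "Suc (idx ! b) < m" "m < idx ! l" "v ! m = n"
        using ascending_passes[OF v far llen, of n] vals by auto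
      then show False using gap[of m] by (simp add: P_def)
    qed
  qed
  have shape: "(idx ! l = Suc (idx ! b) \<longleftrightarrow> l = Suc b) \<and> (Suc (idx ! b) < idx ! l \<longleftrightarrow> Suc b < l)"
    if lb: "l \<in> positions w (Suc n)" "b \<in> positions w n" for l b
  proof -
    have "l < length idx" "b < length idx" using lb by (auto simp: positions_def w)
    from strict[OF this(2,1)] next_iff[OF lb] show ?thesis by linarith
  qed
  have P: "P (Suc n)" "P n" by (simp_all add: P_def)
  have "generic_rank TYPE('k) (positions v (Suc n)) (positions v n)
      = generic_rank TYPE('k) (positions w (Suc n)) (positions w n)"
    unfolding img[OF P(1), symmetric] img[OF P(2), symmetric]
    by (rule generic_rank_transport[OF finite_positions inj shape])
  moreover have "card (positions v (Suc n)) = card (positions w (Suc n))"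
    unfolding img[OF P(1), symmetric] using inj by (intro card_image) (rule inj_on_subset, auto)
  ultimately show ?thesis unfolding generators_after_def w_def P_def by simp
qed

text \<open>
  The last letter of such a word is its largest possible one. For the word of a partition this
  expresses that the sequence continues with \<open>N + 1\<close>, \<open>N + 2\<close>, and so
  on.
\<close>
definition words :: "(nat \<Rightarrow> nat) \<Rightarrow> nat \<Rightarrow> nat \<Rightarrow> nat list set" where
  "words c d N = {v. set v \<subseteq> {d..N} \<and> (\<forall>n\<in>{d..N}. count_list v n = c n) \<and>
     ascending v \<and> v \<noteq> [] \<and> last v = N}"

lemma count_list_filter: "count_list (filter P v) n = (if P n then count_list v n else 0)"
  by (induction v) auto

lemma last_filter: "v \<noteq> [] \<Longrightarrow> P (last v) \<Longrightarrow> last (filter P v) = last v"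
  by (induction v rule: rev_induct) auto

lemma ascending_Cons: "ascending (p # v) \<longleftrightarrow> ascending v \<and> (v = [] \<or> hd v \<le> Suc p)"
  by (cases v) auto

lemma ascending_filter_le: "ascending (p # v) \<Longrightarrow> ascending (p # filter (\<lambda>a. a \<le> N) v)"
proof (induction v arbitrary: p)
  case (Cons e v)
  then have e: "e \<le> Suc p" and IH: "ascending (e # filter (\<lambda>a. a \<le> N) v)" by auto
  show ?case
  proof (cases "e \<le> N")
    case False
    have "hd (filter (\<lambda>a. a \<le> N) v) \<le> N" if "filter (\<lambda>a. a \<le> N) v \<noteq> []"
      using hd_in_set[OF that] by simp
    then show ?thesis using IH e False
      by (cases "filter (\<lambda>a. a \<le> N) v = []") (simp_all add: ascending_Cons)
  qed (use IH e in simp)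
qed simp

text \<open>
  The letter before the first of the final large letters cannot be smaller than \<open>N\<close>.
\<close>
lemma last_filter_le:
  assumes "ascending v" "v \<noteq> []" "N < last v" "filter (\<lambda>a. a \<le> N) v \<noteq> []"
  shows "last (filter (\<lambda>a. a \<le> N) v) = N"
  using assms
proof (induction v)
  case (Cons a v)
  have "v \<noteq> []" using Cons.prems by (auto split: if_splits)
  then have IH: "filter (\<lambda>a. a \<le> N) v \<noteq> [] \<Longrightarrow> last (filter (\<lambda>a. a \<le> N) v) = N"
    using Cons.IH Cons.prems by (simp add: ascending_Cons)
  show ?case
  proof (cases "filter (\<lambda>a. a \<le> N) v = []")
    case True
    then have "a \<le> N" using Cons.prems(4) by (simp split: if_splits)
    moreover have "N < hd v" using True hd_in_set[OF \<open>v \<noteq> []\<close>] by (auto simp: filter_empty_conv)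
    ultimately show ?thesis using True Cons.prems(1) \<open>v \<noteq> []\<close> by (simp add: ascending_Cons)
  qed (use IH in simp)
qed simp

lemma ascending_two_letters: "set w \<subseteq> {N, Suc N} \<Longrightarrow> ascending w"
proof (induction w)
  case (Cons a w)
  have "hd w \<le> Suc N" if "w \<noteq> []" using hd_in_set[OF that] Cons.prems by auto
  then show ?case using Cons by (cases "w = []") (auto simp: ascending_Cons)
qed simp

lemma words_filter_le:
  assumes v: "v \<in> words c d (Suc N)" and d: "d \<le> N" and c: "0 < c N"
  shows "filter (\<lambda>a. a \<le> N) v \<in> words c d N"
proof -
  have v': "set v \<subseteq> {d..Suc N}" "\<And>n. n \<in> {d..Suc N} \<Longrightarrow> count_list v n = c n"
    "ascending v" "v \<noteq> []" "last v = Suc N" using v by (auto simp: words_def)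
  have "count_list v N \<noteq> 0" using v'(2)[of N] d c by simp
  then have ne: "filter (\<lambda>a. a \<le> N) v \<noteq> []"
    by (auto simp: filter_empty_conv count_list_0_iff)
  obtain p v1 where pv: "v = p # v1" using v'(4) by (cases v) auto
  have "ascending (p # filter (\<lambda>a. a \<le> N) v1)" using ascending_filter_le v'(3) pv by blast
  then have "ascending (filter (\<lambda>a. a \<le> N) v)" by (simp add: pv ascending_Cons)
  then show ?thesis unfolding words_def
    using v' ne last_filter_le[OF v'(3,4) _ ne] by (auto simp: count_list_filter)
qed

lemma words_filter_two:
  assumes v: "v \<in> words c d (Suc N)" and d: "d \<le> N"
  shows "filter (\<lambda>a. a \<in> {N, Suc N}) v \<in> words c N (Suc N)"
proof -
  have v': "set v \<subseteq> {d..Suc N}" "\<And>n. n \<in> {d..Suc N} \<Longrightarrow> count_list v n = c n"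
    "v \<noteq> []" "last v = Suc N" using v by (auto simp: words_def)
  let ?w = "filter (\<lambda>a. a \<in> {N, Suc N}) v"
  have "last ?w = Suc N" using last_filter[of v "\<lambda>a. a \<in> {N, Suc N}"] v' by simp
  moreover have "?w \<noteq> []" using last_in_set[OF v'(3)] v'(4) by (auto simp: filter_empty_conv)
  moreover have "ascending ?w" by (rule ascending_two_letters[of _ N]) auto
  moreover have "count_list ?w n = c n" if "n \<in> {N..Suc N}" for n
  proof -
    have "n = N \<or> n = Suc N" using that by auto
    then show ?thesis using v'(2)[of n] d by (auto simp: count_list_filter)
  qed
  ultimately show ?thesis by (auto simp: words_def)
qed

text \<open>
  Inserts the letters \<open>N + 1\<close> of \<open>w\<close> into \<open>u\<close>, where
  \<open>w\<close> records their position relative to the letters \<open>N\<close> of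
  \<open>u\<close>. They are placed as early as possible, that is, at the start or after a letter
  \<open>N\<close> and previously inserted letters; any later place would create an ascent of size
  at least two or pass another \<open>N\<close>.
\<close>
fun merge :: "nat \<Rightarrow> nat list \<Rightarrow> nat list \<Rightarrow> nat list" where
  "merge N u [] = u"
| "merge N [] (c # w) = c # w"
| "merge N (a # u) (c # w) =
     (if c = Suc N then c # merge N (a # u) w
      else if a = N then a # merge N u w
      else a # merge N u (c # w))"

lemma merge_Nil [simp]: "merge N [] w = w"
  by (cases w) auto

lemma filter_merge:
  assumes "set u \<subseteq> {..N}" "set w \<subseteq> {N, Suc N}" "count_list u N = count_list w N"
  shows "filter (\<lambda>a. a \<le> N) (merge N u w) = u \<and> filter (\<lambda>a. a \<in> {N, Suc N}) (merge N u w) = w"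
  using assms
proof (induction N u w rule: merge.induct)
  case (1 N u)
  then have "N \<notin> set u" by (simp add: count_list_0_iff)
  then show ?case using 1 by (auto simp: filter_empty_conv intro!: filter_True)
next
  case (2 N c w)
  then have "N \<notin> set (c # w)" using count_list_0_iff[of "c # w" N] by (metis count_list.simps(1))
  then have "set (c # w) \<subseteq> {Suc N}" using 2 by auto
  then show ?case using 2 by (auto simp: filter_empty_conv intro!: filter_True)
next
  case (3 N a u c w)
  show ?case
  proof (cases "c = Suc N")
    case True
    then show ?thesis using 3 by simp
  next
    case False
    then have "c = N" using 3 by simp
    then show ?thesis using 3 by (cases "a = N") auto
  qed
qed

text \<open>
  The induction carries the preceding letter \<open>p\<close> along: a letter \<open>N + 1\<close>
  can be next only if \<open>p\<close> is at least \<open>N\<close>.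
\<close>
lemma ascending_merge:
  assumes "ascending u" "set u \<subseteq> {..N}" "set w \<subseteq> {N, Suc N}" "count_list u N = count_list w N"
    and "N \<le> p \<or> (w = [] \<or> hd w = N) \<and> (u = [] \<or> hd u \<le> Suc p)"
  shows "ascending (p # merge N u w)"
  using assms
proof (induction N u w arbitrary: p rule: merge.induct)
  case (1 N u)
  have "hd u \<le> N" if "u \<noteq> []" using hd_in_set[OF that] 1 by auto
  then show ?case using 1 by (cases "u = []") (auto simp: ascending_Cons)
next
  case (2 N c w)
  then have "N \<notin> set (c # w)" using count_list_0_iff[of "c # w" N] by (metis count_list.simps(1))
  then have "c = Suc N" "N \<le> p" using 2 by auto
  then show ?case using ascending_two_letters[OF 2(3)] by simp
next
  case (3 N a u c w)
  show ?case
  proof (cases "c = Suc N")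
    case True
    then have "N \<le> p" using 3 by auto
    moreover have "ascending (c # merge N (a # u) w)" using 3(4-) True by (intro 3(1)) auto
    ultimately show ?thesis using True by simp
  next
    case False
    then have c: "c = N" using 3 by simp
    show ?thesis
    proof (cases "a = N")
      case True
      have "ascending (a # merge N u w)" using 3(4-) True c by (intro 3(2)) (auto simp: ascending_Cons)
      moreover have "a \<le> Suc p" using 3 True by auto
      ultimately show ?thesis using True c by simp
    next
      case False
      have "ascending (a # merge N u (c # w))" using 3(4-) False c by (intro 3(3)) (auto simp: ascending_Cons)
      moreover have "a \<le> Suc p" using 3 by auto
      ultimately show ?thesis using False c by simp
    qed
  qed
qed

lemma words_merge:
  assumes u: "u \<in> words c d N" and w: "w \<in> words c N (Suc N)" and d: "d \<le> N"
  shows "merge N u w \<in> words c d (Suc N) \<and>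
    filter (\<lambda>a. a \<le> N) (merge N u w) = u \<and> filter (\<lambda>a. a \<in> {N, Suc N}) (merge N u w) = w"
proof -
  have u': "set u \<subseteq> {d..N}" "\<And>n. n \<in> {d..N} \<Longrightarrow> count_list u n = c n" "ascending u" "u \<noteq> []" "last u = N"
    using u by (auto simp: words_def)
  have w': "set w \<subseteq> {N, Suc N}" "count_list w N = c N" "count_list w (Suc N) = c (Suc N)" "w \<noteq> []" "last w = Suc N"
    using w by (auto simp: words_def)
  have uN: "set u \<subseteq> {..N}" using u' by auto
  have cnt: "count_list u N = count_list w N" using u'(2)[of N] w' d by simp
  let ?m = "merge N u w"
  note f = filter_merge[OF uN w'(1) cnt]
  have f1: "filter (\<lambda>a. a \<le> N) ?m = u" and f2: "filter (\<lambda>a. a \<in> {N, Suc N}) ?m = w" using f by auto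
  have set: "a \<in> set u \<or> a \<in> set w" if "a \<in> set ?m" for a
  proof -
    have "set ?m \<subseteq> set u \<union> set w" by (induction N u w rule: merge.induct) auto
    then show ?thesis using that by blast
  qed
  have "set ?m \<subseteq> {d..Suc N}" using set u'(1) w'(1) d by fastforce
  moreover have "count_list ?m n = c n" if "n \<in> {d..Suc N}" for n
  proof (cases "n \<le> N")
    case True
    have "count_list ?m n = count_list (filter (\<lambda>a. a \<le> N) ?m) n" using True by (simp add: count_list_filter)
    then show ?thesis using f1 u'(2)[of n] True that by simp
  next
    case False
    then have n: "n = Suc N" using that by simp
    have "count_list ?m n = count_list (filter (\<lambda>a. a \<in> {N, Suc N}) ?m) n" by (simp add: count_list_filter n)
    then show ?thesis using f2 w'(3) n by simp
  qed
  moreover have "ascending ?m"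
    using ascending_merge[OF u'(3) uN w'(1) cnt, of N] by (simp add: ascending_Cons)
  moreover have ne: "?m \<noteq> []" using f2 w'(4) by auto
  moreover have "last ?m = Suc N"
  proof (rule ccontr)
    assume no: "last ?m \<noteq> Suc N"
    have "last ?m \<in> set ?m" using ne by simp
    then have "last ?m \<le> N" using set u'(1) w'(1) no by fastforce
    then have "last ?m = N" using last_filter[OF ne, of "\<lambda>a. a \<le> N"] f1 u'(5) by simp
    then have "last w = N" using last_filter[OF ne, of "\<lambda>a. a \<in> {N, Suc N}"] f2 by simp
    then show False using w'(5) by simp
  qed
  ultimately show ?thesis using f1 f2 by (simp add: words_def)
qed

lemma ascending_first_large:
  "ascending (p # v) \<Longrightarrow> p < N \<Longrightarrow> filter (\<lambda>a. a \<in> {N, Suc N}) v = x # w \<Longrightarrow> x = N"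
proof (induction v arbitrary: p)
  case (Cons e v)
  then have "e \<le> N" "ascending (e # v)" by auto
  then show ?case using Cons.IH[of e] Cons.prems by (cases "e = N") auto
qed simp

text \<open>
  Since letters \<open>N + 1\<close> can only occur where \<open>merge\<close> puts them, a word
  is recovered from its two projections.
\<close>
lemma merge_filters:
  assumes "ascending v" "set v \<subseteq> {..Suc N}"
  shows "merge N (filter (\<lambda>a. a \<le> N) v) (filter (\<lambda>a. a \<in> {N, Suc N}) v) = v"
  using assms
proof (induction v)
  case (Cons e v)
  let ?u = "filter (\<lambda>a. a \<le> N) v" let ?w = "filter (\<lambda>a. a \<in> {N, Suc N}) v"
  have IH: "merge N ?u ?w = v" using Cons by (simp add: ascending_Cons)
  consider "e = Suc N" | "e = N" | "e < N" using Cons.prems by fastforce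
  then show ?case
  proof cases
    case 1
    then show ?thesis using IH by (cases ?u) auto
  next
    case 2
    then show ?thesis using IH by simp
  next
    case 3
    show ?thesis
    proof (cases ?w)
      case Nil
      then show ?thesis using 3 IH by simp
    next
      case (Cons x w)
      then have "x = N" using ascending_first_large[OF Cons.prems(1) 3] by blast
      then show ?thesis using 3 IH Cons by simp
    qed
  qed
qed simp

lemma words_projection:
  assumes "v \<in> words c d (Suc N)" "i \<in> {d..N}" "\<And>n. n \<in> {d..N} \<Longrightarrow> 0 < c n"
  shows "filter (\<lambda>a. a \<in> {i, Suc i}) v \<in> words c i (Suc i)"
  using assms
proof (induction N arbitrary: v)
  case 0
  then show ?case using words_filter_two[of v c d 0] by simp
next
  case (Suc N)
  show ?case
  proof (cases "i = Suc N")
    case True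
    then show ?thesis using words_filter_two[OF Suc.prems(1)] Suc.prems(2) by simp
  next
    case False
    have "filter (\<lambda>a. a \<in> {i, Suc i}) (filter (\<lambda>a. a \<le> Suc N) v) = filter (\<lambda>a. a \<in> {i, Suc i}) v"
      unfolding filter_filter using Suc.prems(2) False by (intro filter_cong) auto
    moreover have "filter (\<lambda>a. a \<le> Suc N) v \<in> words c d (Suc N)"
      using Suc.prems by (intro words_filter_le) auto
    then have "filter (\<lambda>a. a \<in> {i, Suc i}) (filter (\<lambda>a. a \<le> Suc N) v) \<in> words c i (Suc i)"
      using Suc.prems False by (intro Suc.IH) auto
    ultimately show ?thesis by simp
  qed
qed

text \<open>
  Induction on the largest letter: the word without its largest letter is determined by the other
  projections, and the last projection says where to insert that letter.
\<close>
lemma words_projections_inject: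
  assumes "v \<in> words c d (Suc N)" "v' \<in> words c d (Suc N)" "d \<le> N" "\<And>n. n \<in> {d..N} \<Longrightarrow> 0 < c n"
    and "\<And>i. i \<in> {d..N} \<Longrightarrow> filter (\<lambda>a. a \<in> {i, Suc i}) v = filter (\<lambda>a. a \<in> {i, Suc i}) v'"
  shows "v = v'"
  using assms(3,1,2,4,5)
proof (induction N arbitrary: v v' rule: dec_induct)
  case base
  have "filter (\<lambda>a. a \<in> {d, Suc d}) v = v" "filter (\<lambda>a. a \<in> {d, Suc d}) v' = v'"
    using base.prems(1,2) by (auto simp: words_def intro!: filter_True)
  then show ?case using base.prems(4)[of d] by simp
next
  case (step N)
  let ?f = "filter (\<lambda>a. a \<le> Suc N)"
  have f: "filter (\<lambda>a. a \<in> {i, Suc i}) (?f x) = filter (\<lambda>a. a \<in> {i, Suc i}) x" if "i \<in> {d..N}" for i x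
    unfolding filter_filter using that by (intro filter_cong) auto
  have "?f v = ?f v'"
  proof (rule step.IH)
    show "?f v \<in> words c d (Suc N)" "?f v' \<in> words c d (Suc N)"
      using step.prems step.hyps by (auto intro!: words_filter_le)
    show "filter (\<lambda>a. a \<in> {i, Suc i}) (?f v) = filter (\<lambda>a. a \<in> {i, Suc i}) (?f v')" if "i \<in> {d..N}" for i
      unfolding f[OF that] using step.prems(4)[of i] that by simp
  qed (use step.prems in simp)
  moreover have "merge (Suc N) (?f x) (filter (\<lambda>a. a \<in> {Suc N, Suc (Suc N)}) x) = x"
    if "x \<in> words c d (Suc (Suc N))" for x
    using that by (intro merge_filters) (auto simp: words_def)
  ultimately show ?case
    using step.prems(1,2) step.prems(4)[of "Suc N"] step.hyps by (metis atLeastAtMost_iff le_SucI order_refl)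
qed

lemma words_projections_surject:
  assumes "d \<le> N" "\<And>i. i \<in> {d..N} \<Longrightarrow> w i \<in> words c i (Suc i)"
  shows "\<exists>v \<in> words c d (Suc N). \<forall>i\<in>{d..N}. filter (\<lambda>a. a \<in> {i, Suc i}) v = w i"
  using assms
proof (induction N rule: dec_induct)
  case base
  have "filter (\<lambda>a. a \<in> {d, Suc d}) (w d) = w d"
    using base.prems[of d] by (auto simp: words_def intro!: filter_True)
  then show ?case using base.prems[of d] by (intro bexI[of _ "w d"]) auto
next
  case (step N)
  then obtain u where u: "u \<in> words c d (Suc N)" "\<And>i. i \<in> {d..N} \<Longrightarrow> filter (\<lambda>a. a \<in> {i, Suc i}) u = w i"
    by (metis atLeastAtMost_iff le_SucI)
  let ?m = "merge (Suc N) u (w (Suc N))"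
  have m: "?m \<in> words c d (Suc (Suc N))" "filter (\<lambda>a. a \<le> Suc N) ?m = u"
    "filter (\<lambda>a. a \<in> {Suc N, Suc (Suc N)}) ?m = w (Suc N)"
    using words_merge[OF u(1) step.prems[of "Suc N"]] step.hyps by auto
  have "filter (\<lambda>a. a \<in> {i, Suc i}) ?m = w i" if i: "i \<in> {d..Suc N}" for i
  proof (cases "i = Suc N")
    case False
    then have "filter (\<lambda>a. a \<in> {i, Suc i}) ?m = filter (\<lambda>a. a \<in> {i, Suc i}) (filter (\<lambda>a. a \<le> Suc N) ?m)"
      unfolding filter_filter using i by (intro filter_cong) auto
    then show ?thesis using m(2) u(2)[of i] i False by simp
  qed (use m(3) in simp)
  then show ?case using m(1) by blast
qed

lemma words_shift:
  "words c (d + s) (N + s) = map ((+) s) ` words (\<lambda>n. c (n + s)) d N"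
proof
  have cnt: "count_list (map ((+) s) v) (n + s) = count_list v n" for v n
    by (induction v) auto
  have asc: "ascending (map ((+) s) v) = ascending v" for v
    by (simp add: successively_map)
  show "map ((+) s) ` words (\<lambda>n. c (n + s)) d N \<subseteq> words c (d + s) (N + s)"
  proof
    fix v assume "v \<in> map ((+) s) ` words (\<lambda>n. c (n + s)) d N"
    then obtain u where u: "u \<in> words (\<lambda>n. c (n + s)) d N" "v = map ((+) s) u" by blast
    have "count_list v n = c n" if "n \<in> {d + s..N + s}" for n
    proof -
      have n: "n = (n - s) + s" "n - s \<in> {d..N}" using that by auto
      then have "count_list u (n - s) = c n" using u(1) by (simp add: words_def)
      then show ?thesis using cnt[of u "n - s"] n(1) u(2) by simp
    qed
    then show "v \<in> words c (d + s) (N + s)"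
      using u by (auto simp: words_def asc last_map)
  qed
  show "words c (d + s) (N + s) \<subseteq> map ((+) s) ` words (\<lambda>n. c (n + s)) d N"
  proof
    fix v assume v: "v \<in> words c (d + s) (N + s)"
    define u where "u = map (\<lambda>a. a - s) v"
    have vu: "v = map ((+) s) u"
      using v by (auto simp: u_def words_def intro!: map_idI[symmetric])
    have "u \<in> words (\<lambda>n. c (n + s)) d N"
    proof -
      have "last v = last u + s" using v vu by (auto simp: words_def last_map)
      then have "last u = N" using v by (simp add: words_def)
      moreover have "count_list u n = c (n + s)" if "n \<in> {d..N}" for n
        using cnt[of u n] v that by (simp add: words_def flip: vu)
      moreover have "set u \<subseteq> {d..N}"
      proof
        fix x assume "x \<in> set u"
        then obtain a where "a \<in> set v" "x = a - s" by (auto simp: u_def)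
        then show "x \<in> {d..N}" using v by (fastforce simp: words_def)
      qed
      moreover have "ascending u" using v asc[of u] by (simp add: words_def flip: vu)
      moreover have "u \<noteq> []" using v by (simp add: u_def words_def)
      ultimately show ?thesis by (simp add: words_def)
    qed
    then show "v \<in> map ((+) s) ` words (\<lambda>n. c (n + s)) d N" using vu by blast
  qed
qed

section \<open>Partitions with given diagonal lengths as words\<close>

text \<open>
  The Hilbert functions $T = (1, 2, \ldots, d, t_d, \ldots, t_{\mathsf j}, 0)$. The values from
  \<open>d\<close> on may vanish, so that the components $T_i$, including the zero sequence (with
  \<open>d = j = 0\<close>), are covered as well.
\<close>
definition order_sequence :: "(nat \<Rightarrow> nat) \<Rightarrow> nat \<Rightarrow> nat \<Rightarrow> bool" where
  "order_sequence T d j \<longleftrightarrow> d \<le> j \<and> (\<forall>i<d. T i = Suc i) \<and> T d \<le> d \<and>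
     (\<forall>i\<ge>d. T (Suc i) \<le> T i) \<and> (\<forall>i>j. T i = 0)"

text \<open>
  The number of generators $x^{q_b} y^b$ of degree \<open>n\<close>, the first difference of $n +
  1 - t_n$. The case \<open>n = d\<close> uses the convention $t_{d-1} = d$.
\<close>
definition letter_count :: "(nat \<Rightarrow> nat) \<Rightarrow> nat \<Rightarrow> nat \<Rightarrow> nat" where
  "letter_count T d n = (if n = d then Suc d - T d else Suc (T (n - 1)) - T n)"

text \<open>
  From index \<open>j + 2\<close> on the sequence of generator degrees is the identity and carries
  no information.
\<close>
definition partition_word :: "nat \<Rightarrow> nat list \<Rightarrow> nat list" where
  "partition_word j P = map (generator_degree P) [0..<j + 2]"

lemma order_sequence_le:
  assumes "order_sequence T d j"
  shows "T n \<le> Suc n" and "d \<le> n \<Longrightarrow> T n \<le> d"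
proof -
  show 1: "T n \<le> d" if "d \<le> n"
    using that assms by (induction n rule: dec_induct) (auto simp: order_sequence_def intro: order_trans)
  show "T n \<le> Suc n"
    using assms 1 by (cases "n < d") (auto simp: order_sequence_def)
qed

lemma sum_letter_count:
  assumes T: "order_sequence T d j" and n: "d \<le> n"
  shows "(\<Sum>i=d..n. letter_count T d i) = Suc n - T n"
  using n
proof (induction n rule: dec_induct)
  case base
  then show ?case by (simp add: letter_count_def)
next
  case (step n)
  have "T n \<le> d" "T (Suc n) \<le> T n"
    using order_sequence_le(2)[OF T] step.hyps T by (auto simp: order_sequence_def)
  then show ?case using step by (simp add: letter_count_def)
qed

lemma letter_count_pos:
  assumes T: "order_sequence T d j" and n: "d \<le> n"
  shows "0 < letter_count T d n"
proof (cases "n = d")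
  case True
  then show ?thesis using T by (simp add: letter_count_def order_sequence_def)
next
  case False
  then have "T (Suc (n - 1)) \<le> T (n - 1)" using T n unfolding order_sequence_def by (metis Suc_diff_1 gr_implies_not0 le_neq_implies_less less_Suc_eq_le neq0_conv)
  then show ?thesis using False n by (simp add: letter_count_def)
qed

lemma words_length:
  assumes "v \<in> words c d N" shows "length v = (\<Sum>n=d..N. c n)"
proof -
  have "sum (count_list v) {d..N} = length v"
    using assms by (intro sum_count_set) (auto simp: words_def)
  moreover have "sum (count_list v) {d..N} = (\<Sum>n=d..N. c n)"
    using assms by (intro sum.cong) (auto simp: words_def)
  ultimately show ?thesis by simp
qed

lemma finite_words: "finite (words c d N)"
proof (rule finite_subset)
  show "words c d N \<subseteq> {v. set v \<subseteq> {d..N} \<and> length v = (\<Sum>n=d..N. c n)}"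
    using words_length by (auto simp: words_def)
qed (intro finite_lists_length_eq finite_atLeastAtMost)

lemma count_list_positions: "count_list v n = card (positions v n)"
  unfolding positions_def count_list_eq_length_filter length_filter_conv_card by (intro arg_cong[of _ _ card]) auto

text \<open>
  The diagonal lengths are the numbers of monomials in \<open>C_set P\<close> of each degree, so
  the indices whose generator degree is at most \<open>n\<close> are counted by their complement
  in \<open>n + 1\<close>. All monomials of degree greater than \<open>j\<close> lie in the ideal,
  hence the sequence is the identity from \<open>j + 1\<close> on.
\<close>
lemma partition_of_diagonal_lengths:
  assumes P: "is_partition P" and diag: "diagonal_lengths TYPE('k::field) P = T" and T: "order_sequence T d j"
  shows "staircase (Suc j) (generator_degree P)" and "\<And>n. card {b. generator_degree P b \<le> n} = Suc n - T n"
    and "\<And>b. d \<le> generator_degree P b" and "\<And>b. b \<le> Suc j \<Longrightarrow> generator_degree P b \<le> Suc j"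
proof -
  let ?D = "generator_degree P"
  have S: "{b. ?D b \<le> n} \<subseteq> {..n}" for n using generator_degree_ge[of _ P] order_trans by fastforce
  show card: "card {b. ?D b \<le> n} = Suc n - T n" for n
  proof -
    have "card {b. ?D b \<le> n} \<le> Suc n" using card_mono[OF _ S, of n] by simp
    moreover have "T n = Suc n - card {b. ?D b \<le> n}"
      using diagonal_lengths_eq[OF P, where 'k = 'k] diag by metis
    ultimately show ?thesis by simp
  qed
  have full: "?D b \<le> n" if n: "j < n" "b \<le> n" for n b
  proof -
    have "card {b. ?D b \<le> n} = card {..n}" using card[of n] T n by (simp add: order_sequence_def)
    then have "{b. ?D b \<le> n} = {..n}" using S by (intro card_subset_eq) auto
    then show ?thesis using n by blast
  qed
  then have fixed: "?D b = b" if "j < b" for b using that generator_degree_ge[of b P] by (simp add: antisym)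
  show low: "?D b \<le> Suc j" if "b \<le> Suc j" for b using full[of "Suc j" b] that by simp
  show "staircase (Suc j) ?D" unfolding staircase_def
  proof (intro conjI allI impI)
    show "?D (Suc b) \<le> Suc (?D b)" for b by (rule generator_degree_Suc[OF P])
    show "?D (Suc j) = Suc j" by (rule fixed) simp
    show "?D l = n \<longleftrightarrow> l = n" if "Suc j < n" for n l
      using low[of l] fixed[of l] that by (cases "l \<le> Suc j") auto
  qed
  show "d \<le> ?D b" for b
  proof (rule ccontr)
    assume b: "\<not> d \<le> ?D b"
    have "card {b'. ?D b' \<le> ?D b} = 0" using card[of "?D b"] T b by (simp add: order_sequence_def)
    then have "{b'. ?D b' \<le> ?D b} = {}" using finite_subset[OF S] by simp
    then show False by blast
  qed
qed

lemma positions_partition_word: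
  assumes "staircase (Suc j) (generator_degree P)" "n \<le> Suc j"
  shows "positions (partition_word j P) n = {b. generator_degree P b = n}"
proof -
  have "b < j + 2" if "generator_degree P b = n" for b
    using generator_degree_ge[of b P] that assms(2) by simp
  then show ?thesis by (auto simp: positions_def partition_word_def simp del: upt_Suc)
qed

lemma card_generator_degree_eq:
  assumes P: "is_partition P" and diag: "diagonal_lengths TYPE('k::field) P = T" and T: "order_sequence T d j"
    and n: "d \<le> n"
  shows "card {b. generator_degree P b = n} = letter_count T d n"
proof -
  let ?D = "generator_degree P"
  note props = partition_of_diagonal_lengths[OF P diag T]
  show ?thesis
  proof (cases "n = d")
    case True
    have "{b. ?D b = d} = {b. ?D b \<le> d}" using props(3) by (auto intro: antisym)
    then show ?thesis using props(2)[of d] True by (simp add: letter_count_def)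
  next
    case False
    then obtain m where m: "n = Suc m" "d \<le> m" using n by (cases n) auto
    have "{b. ?D b = n} = {b. ?D b \<le> n} - {b. ?D b \<le> m}" by (auto simp: m)
    also have "card \<dots> = card {b. ?D b \<le> n} - card {b. ?D b \<le> m}"
      using finite_le_staircase[OF props(1)] by (intro card_Diff_subset) (auto simp: m)
    also have "\<dots> = letter_count T d n"
      using props(2) order_sequence_le(2)[OF T m(2)] m False by (simp add: letter_count_def)
    finally show ?thesis .
  qed
qed

lemma partition_word_in_words:
  assumes P: "is_partition P" and diag: "diagonal_lengths TYPE('k::field) P = T" and T: "order_sequence T d j"
  shows "partition_word j P \<in> words (letter_count T d) d (Suc j)"
proof -
  let ?D = "generator_degree P" let ?v = "partition_word j P"
  note props = partition_of_diagonal_lengths[OF P diag T]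
  have "set ?v \<subseteq> {d..Suc j}" using props(3,4) by (auto simp: partition_word_def simp del: upt_Suc)
  moreover have "count_list ?v n = letter_count T d n" if "n \<in> {d..Suc j}" for n
    using that card_generator_degree_eq[OF P diag T, of n]
    by (simp add: count_list_positions positions_partition_word[OF props(1)])
  moreover have "ascending ?v"
    unfolding partition_word_def successively_conv_nth
    using generator_degree_Suc[OF P] by (simp del: upt_Suc)
  moreover have "last ?v = Suc j"
    using staircase_fixed[OF props(1), of "Suc j"] by (simp add: partition_word_def)
  moreover have "?v \<noteq> []" by (simp add: partition_word_def)
  ultimately show ?thesis by (simp add: words_def)
qed

lemma partition_determined:
  assumes "is_partition P" "is_partition Q" "generator_degree P = generator_degree Q"
  shows "P = Q"
proof -
  have le: "length P \<le> length Q"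
    if "is_partition P" "generator_degree P = generator_degree Q" for P Q
  proof (rule ccontr)
    assume less: "\<not> length P \<le> length Q"
    then have "0 < P ! length Q" using that(1) by (simp add: is_partition_def)
    then show False using fun_cong[OF that(2), of "length Q"] less by (simp add: generator_degree_def)
  qed
  have len: "length P = length Q" using le[of P Q] le[of Q P] assms by simp
  then show ?thesis
  proof (rule nth_equalityI)
    fix i assume "i < length P"
    then show "P ! i = Q ! i" using fun_cong[OF assms(3), of i] len by (simp add: generator_degree_def)
  qed
qed

text \<open>
  The parts are recovered as letter minus position. They decrease because ascents have size at
  most one, and reach zero at position \<open>j + 1\<close>, where the last letter stands.
\<close>
lemma partition_with_word:
  assumes T: "order_sequence T d j" and v: "v \<in> words (letter_count T d) d (Suc j)"
  shows "\<exists>P. is_partition P \<and> diagonal_lengths TYPE('k::field) P = T \<and> partition_word j P = v"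
proof -
  have v': "set v \<subseteq> {d..Suc j}" "\<And>n. n \<in> {d..Suc j} \<Longrightarrow> count_list v n = letter_count T d n"
    "ascending v" "v \<noteq> []" "last v = Suc j" using v by (auto simp: words_def)
  have dj: "d \<le> j" "T (Suc j) = 0" using T by (auto simp: order_sequence_def)
  have len: "length v = j + 2" using words_length[OF v] sum_letter_count[OF T, of "Suc j"] dj by simp
  define D where "D b = (if b < j + 2 then v ! b else b)" for b
  have vb: "v ! b \<in> {d..Suc j}" if "b < j + 2" for b
    using that by (intro subsetD[OF v'(1)] nth_mem) (simp add: len)
  have top: "v ! Suc j = Suc j" using v'(4,5) len by (simp add: last_conv_nth)
  have D: "staircase (Suc j) D" unfolding staircase_def
  proof (intro conjI allI impI)
    fix b
    consider "Suc b < j + 2" | "b = Suc j" | "Suc j < b" by linarith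
    then show "D (Suc b) \<le> Suc (D b)"
      using ascending_nth[OF v'(3), of b] len top by cases (simp_all add: D_def)
    show "D l = n \<longleftrightarrow> l = n" if "Suc j < n" for n l
      using vb[of l] that by (auto simp: D_def)
  qed (simp add: D_def top)
  define q where "q b = D b - b" for b
  have Dq: "D b = q b + b" for b using staircase_ge[OF D, of b] by (simp add: q_def)
  have q_step: "q (Suc b) \<le> q b" for b using staircase_Suc[OF D, of b] by (simp add: q_def)
  have q_anti: "q b \<le> q a" if "a \<le> b" for a b using lift_Suc_antimono_le[of q a b] q_step that by blast
  define m where "m = (LEAST b. q b = 0)"
  have "q (Suc j) = 0" by (simp add: q_def D_def top)
  then have qm: "q m = 0" unfolding m_def by (rule LeastI)
  have q_pos: "0 < q b" if "b < m" for b using not_less_Least[of b "\<lambda>b. q b = 0"] that by (simp add: m_def)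
  define P where "P = map q [0..<m]"
  have P: "is_partition P"
    using q_pos q_anti by (auto simp: is_partition_def P_def sorted_wrt_iff_nth_less)
  have gen: "generator_degree P = D"
  proof
    fix b show "generator_degree P b = D b"
      using q_anti[of m b] qm by (cases "b < m") (simp_all add: generator_degree_def P_def Dq)
  qed
  have word: "partition_word j P = v"
    by (rule nth_equalityI) (simp_all add: partition_word_def gen len D_def del: upt_Suc)
  have cardD: "card {b. D b = n} = letter_count T d n" if "n \<in> {d..Suc j}" for n
    using v'(2)[OF that] positions_partition_word[of j P n] that D
    by (simp add: count_list_positions word gen)
  have Dd: "d \<le> D b" for b using vb[of b] dj by (simp add: D_def)
  have "Suc n - card {b. D b \<le> n} = T n" for n
  proof -
    consider "n < d" | "d \<le> n" "n \<le> Suc j" | "Suc j < n" by linarith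
    then show ?thesis
    proof cases
      case 1
      then have "{b. D b \<le> n} = {}" using Dd by (auto simp: not_le intro: less_le_trans)
      then have "card {b. D b \<le> n} = 0" by simp
      then show ?thesis using T 1 by (simp add: order_sequence_def)
    next
      case 2
      have "{b. D b \<le> n} = (\<Union>i\<in>{d..n}. {b. D b = i})" using Dd by auto
      also have "card \<dots> = (\<Sum>i=d..n. card {b. D b = i})"
        using finite_eq_staircase[OF D] by (intro card_UN_disjoint) auto
      also have "\<dots> = (\<Sum>i=d..n. letter_count T d i)" using 2 cardD by (intro sum.cong) auto
      also have "\<dots> = Suc n - T n" by (rule sum_letter_count[OF T 2(1)])
      finally show ?thesis using order_sequence_le(1)[OF T, of n] by simp
    next
      case 3
      have "{b. D b \<le> n} = {..n}"
      proof
        show "{b. D b \<le> n} \<subseteq> {..n}" using staircase_ge[OF D] order_trans by fastforce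
        show "{..n} \<subseteq> {b. D b \<le> n}" using vb 3 by (fastforce simp: D_def)
      qed
      then show ?thesis using T 3 by (simp add: order_sequence_def)
    qed
  qed
  then have "diagonal_lengths TYPE('k) P = T" by (intro ext) (simp add: diagonal_lengths_eq[OF P] gen)
  then show ?thesis using P word by blast
qed

lemma bij_betw_partition_word:
  assumes T: "order_sequence T d j"
  shows "bij_betw (partition_word j) {P. is_partition P \<and> diagonal_lengths TYPE('k::field) P = T}
    (words (letter_count T d) d (Suc j))"
  unfolding bij_betw_def
proof
  show "inj_on (partition_word j) {P. is_partition P \<and> diagonal_lengths TYPE('k) P = T}"
  proof (rule inj_onI, clarify)
    fix P Q assume PQ: "is_partition P" "is_partition Q" "diagonal_lengths TYPE('k) Q = diagonal_lengths TYPE('k) P"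
      and T': "T = diagonal_lengths TYPE('k) P" and eq: "partition_word j P = partition_word j Q"
    have sP: "staircase (Suc j) (generator_degree P)" "staircase (Suc j) (generator_degree Q)"
      using partition_of_diagonal_lengths(1)[of _ T d j, where 'k = 'k] PQ T T' by simp_all
    have "generator_degree P b = generator_degree Q b" for b
    proof (cases "b < j + 2")
      case True
      have "partition_word j P ! b = partition_word j Q ! b" using eq by simp
      then show ?thesis using True by (simp add: partition_word_def del: upt_Suc)
    next
      case False
      then show ?thesis using staircase_fixed[OF sP(1), of b] staircase_fixed[OF sP(2), of b] by simp
    qed
    then show "P = Q" using PQ by (intro partition_determined) auto
  qed
  show "partition_word j ` {P. is_partition P \<and> diagonal_lengths TYPE('k) P = T} = words (letter_count T d) d (Suc j)"
    using partition_word_in_words[where 'k = 'k, OF _ _ T] partition_with_word[where 'k = 'k, OF T] by blast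
qed

lemma generic_rank_no_columns: "generic_rank TYPE('k::field) R {} = 0"
  using generic_rank_attained[of "{}", where 'k = 'k and R = R] by (metis card.empty finite.emptyI subset_empty)

text \<open>
  There are no generators of degree below \<open>d\<close>, and no relations in degree
  \<open>d\<close>, so all generators $x^{q_b} y^b$ of degree \<open>d\<close> survive as minimal
  generators of the generic ideal.
\<close>
lemma kappa_eq_word:
  assumes inf: "infinite (UNIV :: 'k::field set)"
    and P: "is_partition P" and diag: "diagonal_lengths TYPE('k) P = T" and T: "order_sequence T d j"
  shows "kappa TYPE('k) P = letter_count T d d + (\<Sum>n=d..j. generators_after TYPE('k) n (partition_word j P))"
proof -
  let ?D = "generator_degree P"
  note props = partition_of_diagonal_lengths[OF P diag T]
  have dj: "d \<le> j" using T by (simp add: order_sequence_def)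
  define f where "f n = card {b. ?D b = Suc n} - rank_at TYPE('k) ?D n" for n
  have none: "{b. ?D b = n} = {}" if "n < d" for n using props(3) that by (auto simp: not_less[symmetric])
  have low: "f n = 0" if "Suc n < d" for n using none[OF that] by (simp add: f_def)
  have high: "f n = generators_after TYPE('k) n (partition_word j P)" if "n \<le> j" for n
    using that positions_partition_word[OF props(1)] by (simp add: f_def generators_after_def rank_at_def)
  have "kappa TYPE('k) P = card {b. ?D b = 0} + (\<Sum>n<Suc j. f n)"
    by (simp only: kappa_eq_generic_generators[OF inf P props(1)] generic_generators_def f_def)
  also have "(\<Sum>n<Suc j. f n) = (\<Sum>n<d. f n) + (\<Sum>n=d..j. f n)"
  proof -
    have "{..<Suc j} = {..<d} \<union> {d..j}" using dj by auto
    then show ?thesis by (simp add: sum.union_disjoint[of "{..<d}" "{d..j}"] disjoint_iff)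
  qed
  also have "(\<Sum>n=d..j. f n) = (\<Sum>n=d..j. generators_after TYPE('k) n (partition_word j P))"
    using high by (intro sum.cong) auto
  also have "card {b. ?D b = 0} + ((\<Sum>n<d. f n) + x) = letter_count T d d + x" for x
  proof (cases d)
    case 0
    then show ?thesis using card_generator_degree_eq[OF P diag T, of 0] by simp
  next
    case (Suc e)
    have "(\<Sum>n<d. f n) = f e" unfolding Suc using low Suc by simp
    also have "f e = card {b. ?D b = d}"
      using none[of e] by (simp add: f_def rank_at_def generic_rank_no_columns Suc)
    also have "\<dots> = letter_count T d d" by (rule card_generator_degree_eq[OF P diag T order_refl])
    finally have "(\<Sum>n<d. f n) = letter_count T d d" .
    moreover have "card {b. ?D b = 0} = 0" by (simp only: none[of 0] Suc zero_less_Suc card.empty)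
    ultimately show ?thesis by (simp only: add_0)
  qed
  finally show ?thesis .
qed

lemma mu_eq_words:
  assumes inf: "infinite (UNIV :: 'k::field set)" and T: "order_sequence T d j"
  shows "mu TYPE('k) T k = card {v \<in> words (letter_count T d) d (Suc j).
    int (letter_count T d d + (\<Sum>n=d..j. generators_after TYPE('k) n v)) = k}"
proof -
  let ?A = "{P. is_partition P \<and> diagonal_lengths TYPE('k) P = T}"
  let ?val = "\<lambda>v. int (letter_count T d d + (\<Sum>n=d..j. generators_after TYPE('k) n v))"
  note bij = bij_betw_partition_word[OF T, where 'k = 'k]
  have k: "int (kappa TYPE('k) P) = ?val (partition_word j P)" if "P \<in> ?A" for P
    using kappa_eq_word[OF inf _ _ T] that by simp
  have "bij_betw (partition_word j) {P \<in> ?A. int (kappa TYPE('k) P) = k} {v \<in> words (letter_count T d) d (Suc j). ?val v = k}"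
  proof (rule bij_betw_subset[OF bij])
    show "partition_word j ` {P \<in> ?A. int (kappa TYPE('k) P) = k} = {v \<in> words (letter_count T d) d (Suc j). ?val v = k}"
      using k bij unfolding bij_betw_def by fastforce
  qed blast
  then have "card {P \<in> ?A. int (kappa TYPE('k) P) = k} = card {v \<in> words (letter_count T d) d (Suc j). ?val v = k}"
    by (rule bij_betw_same_card)
  moreover have "{P \<in> ?A. int (kappa TYPE('k) P) = k}
      = {P. is_partition P \<and> diagonal_lengths TYPE('k) P = T \<and> int (kappa TYPE('k) P) = k}" by blast
  ultimately show ?thesis by (simp add: mu_def)
qed

section \<open>The components and the product formula\<close>

lemma words_cong: "(\<And>n. n \<in> {d..N} \<Longrightarrow> c n = c' n) \<Longrightarrow> words c d N = words c' d N"
  by (simp add: words_def)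

text \<open>
  With \<open>e\<close> the order of the component $T_i$, its letters \<open>e\<close> and
  \<open>e + 1\<close> occur as often as the letters \<open>i\<close> and \<open>i + 1\<close> do
  for \<open>T\<close>. Both sets of words are translates of the same set of words on the letters
  0 and 1.
\<close>
lemma mu_component:
  assumes inf: "infinite (UNIV :: 'k::field set)" and T: "order_sequence T d j"
    and Td: "0 < d" and i: "i \<in> {d..j}"
  defines "c \<equiv> letter_count T d"
  shows "mu TYPE('k) (T_component T i) k =
    card {w \<in> words c i (Suc i). int (c i + generators_after TYPE('k) i w) = k}"
proof -
  define e where "e = T (i - 1) - T (Suc i)"
  define T' where "T' = T_component T i"
  define c' where "c' = letter_count T' e"
  have T'n: "T' n = (if n < e then Suc n else if n = e then T i - T (Suc i) else 0)" for n
    by (simp add: T'_def T_component_def e_def Let_def)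
  have mono: "T (Suc i) \<le> T i" using T i by (simp add: order_sequence_def)
  have mono': "T i \<le> T (i - 1)"
  proof (cases "i = d")
    case True
    then show ?thesis using T Td by (auto simp: order_sequence_def)
  next
    case False
    then have "d \<le> i - 1" "Suc (i - 1) = i" using i by auto
    then show ?thesis using T unfolding order_sequence_def by metis
  qed
  have T': "order_sequence T' e e"
    using mono mono' by (simp add: order_sequence_def T'n e_def)
  have "T (d - 1) = d" using T Td by (simp add: order_sequence_def)
  then have ci: "c i = Suc (T (i - 1)) - T i" by (simp add: c_def letter_count_def)
  have c'e: "c' e = c i" using mono mono' by (simp add: c'_def letter_count_def T'n ci e_def)
  have c'e1: "c' (Suc e) = c (Suc i)" using i mono by (simp add: Suc_diff_le c'_def c_def letter_count_def T'n)
  let ?w = "words (\<lambda>n. c (n + i)) 0 (Suc 0)"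
  have W: "words c i (Suc i) = map ((+) i) ` ?w" using words_shift[of c 0 i "Suc 0"] by simp
  have "words (\<lambda>n. c' (n + e)) 0 (Suc 0) = ?w"
  proof (rule words_cong)
    fix n :: nat assume "n \<in> {0..Suc 0}"
    then have "n = 0 \<or> n = Suc 0" by auto
    then show "c' (n + e) = c (n + i)" using c'e c'e1 by auto
  qed
  then have W': "words c' e (Suc e) = map ((+) e) ` ?w" using words_shift[of c' 0 e "Suc 0"] by simp
  have inj: "inj_on (map ((+) s)) A" for s :: nat and A by (simp add: inj_on_def)
  have count: "card {w \<in> map ((+) s) ` ?w. int (c i + generators_after TYPE('k) s w) = k}
      = card {u \<in> ?w. int (c i + generators_after TYPE('k) 0 u) = k}" for s
  proof -
    have g: "generators_after TYPE('k) s (map ((+) s) u) = generators_after TYPE('k) 0 u" for u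
      using generators_after_shift[of "TYPE('k)" 0 s u] by simp
    have "{w \<in> map ((+) s) ` ?w. int (c i + generators_after TYPE('k) s w) = k}
        = map ((+) s) ` {u \<in> ?w. int (c i + generators_after TYPE('k) 0 u) = k}"
    proof (intro set_eqI iffI)
      fix w assume "w \<in> {w \<in> map ((+) s) ` ?w. int (c i + generators_after TYPE('k) s w) = k}"
      then obtain u where "u \<in> ?w" "w = map ((+) s) u" "int (c i + generators_after TYPE('k) s w) = k"
        by blast
      then show "w \<in> map ((+) s) ` {u \<in> ?w. int (c i + generators_after TYPE('k) 0 u) = k}"
        by (intro image_eqI[of _ _ u]) (simp_all add: g)
    next
      fix w assume "w \<in> map ((+) s) ` {u \<in> ?w. int (c i + generators_after TYPE('k) 0 u) = k}"
      then obtain u where "u \<in> ?w" "w = map ((+) s) u" "int (c i + generators_after TYPE('k) 0 u) = k"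
        by blast
      then show "w \<in> {w \<in> map ((+) s) ` ?w. int (c i + generators_after TYPE('k) s w) = k}"
        by (simp add: g)
    qed
    then show ?thesis by (simp only: card_image[OF inj])
  qed
  have "mu TYPE('k) T' k = card {v \<in> words c' e (Suc e). int (c' e + generators_after TYPE('k) e v) = k}"
    using mu_eq_words[OF inf T', of k] by (simp add: c'_def)
  then show ?thesis unfolding W W' c'e count T'_def .
qed

theorem theorem6p1:
  fixes T :: "nat \<Rightarrow> nat" and d j :: nat and k :: int
  assumes field: "CHAR('k::field) = 0 \<or> (infinite (UNIV :: 'k set) \<and> j < CHAR('k))"
    and "d \<le> j"
    and "\<forall>i < d. T i = i + 1"
    and "T d \<le> d"
    and "\<forall>i \<in> {d..<j}. T (i + 1) \<le> T i"
    and "0 < T j"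
    and "\<forall>i > j. T i = 0"
    and "0 < k"
  shows "mu TYPE('k) T k =
    (\<Sum>\<^sub>\<infinity>\<kappa> \<in> Q_set T d j k. \<Prod>i = d..j. mu TYPE('k) (T_component T i) (\<kappa> i))"
proof -
  have inf: "infinite (UNIV :: 'k set)"
    using field finite_imp_CHAR_pos[where 'a = 'k] by auto
  have T: "order_sequence T d j"
    unfolding order_sequence_def
  proof (intro conjI allI impI)
    fix i assume "d \<le> i"
    then show "T (Suc i) \<le> T i" using assms(5,7) by (cases "i < j") auto
  qed (use assms in auto)
  have d0: "0 < d"
  proof (rule ccontr)
    assume "\<not> 0 < d"
    then show False using order_sequence_le(2)[OF T, of j] assms(2,6) by simp
  qed
  define c where "c = letter_count T d"
  define g where "g = generators_after TYPE('k)"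
  define proj where "proj v = (\<lambda>i\<in>{d..j}. filter (\<lambda>a. a \<in> {i, Suc i}) v)" for v :: "nat list"
  define h where "h w = (\<lambda>i\<in>{d..j}. int (c i + g i (w i)))" for w :: "nat \<Rightarrow> nat list"
  let ?L = "words c d (Suc j)" let ?A = "\<Pi>\<^sub>E i\<in>{d..j}. words c i (Suc i)" let ?Q = "Q_set T d j k"
  have pos: "0 < c n" if "n \<in> {d..j}" for n using letter_count_pos[OF T] that by (simp add: c_def)
  have bij: "bij_betw proj ?L ?A"
    unfolding bij_betw_def
  proof
    show "inj_on proj ?L"
    proof (rule inj_onI)
      fix v v' assume v: "v \<in> ?L" "v' \<in> ?L" "proj v = proj v'"
      show "v = v'"
      proof (rule words_projections_inject[OF v(1,2) assms(2) pos])
        fix i assume "i \<in> {d..j}"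
        then show "filter (\<lambda>a. a \<in> {i, Suc i}) v = filter (\<lambda>a. a \<in> {i, Suc i}) v'"
          using fun_cong[OF v(3), of i] by (simp add: proj_def)
      qed
    qed
    show "proj ` ?L = ?A"
    proof
      show "proj ` ?L \<subseteq> ?A"
        using words_projection[of _ c d j] pos by (auto simp: proj_def PiE_iff)
      show "?A \<subseteq> proj ` ?L"
      proof
        fix w assume w: "w \<in> ?A"
        then obtain v where v: "v \<in> ?L" "\<forall>i\<in>{d..j}. filter (\<lambda>a. a \<in> {i, Suc i}) v = w i"
          using words_projections_surject[OF assms(2), of w c] by (auto simp: PiE_iff)
        have "w = proj v" using v(2) w by (intro ext) (auto simp: proj_def PiE_iff extensional_def)
        then show "w \<in> proj ` ?L" using v(1) by blast
      qed
    qed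
  qed
  \<comment> \<open>The sum over the components counts the letters \<open>i\<close> for every \<open>i\<close>, the value of \<open>kappa\<close> only the letters \<open>d\<close>; the shift in \<open>Q_set\<close> is the difference.\<close>
  have total: "h (proj v) \<in> ?Q \<longleftrightarrow> int (c d + (\<Sum>n=d..j. g n v)) = k" if v: "v \<in> ?L" for v
  proof -
    have "ascending v" using v by (simp add: words_def)
    then have "(\<Sum>i=d..j. h (proj v) i) = (\<Sum>i=d..j. int (c i + g i v))"
      using generators_after_filter by (intro sum.cong) (simp_all add: h_def proj_def g_def)
    also have "\<dots> = int (\<Sum>i=d..j. c i) + int (\<Sum>i=d..j. g i v)" by (simp add: sum.distrib)
    also have "(\<Sum>i=d..j. c i) = Suc j - T j"
      unfolding c_def by (rule sum_letter_count[OF T assms(2)])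
    finally have sum: "(\<Sum>i=d..j. h (proj v) i) = int (Suc j - T j) + int (\<Sum>i=d..j. g i v)" .
    have "c d = Suc d - T d" by (simp add: c_def letter_count_def)
    moreover have "T j \<le> Suc j" by (rule order_sequence_le(1)[OF T])
    ultimately have "(\<Sum>i=d..j. h (proj v) i) = k + (int (T d) - int d) - (int (T j) - int j)
        \<longleftrightarrow> int (c d + (\<Sum>n=d..j. g n v)) = k"
      unfolding sum using assms(4) by (simp add: of_nat_diff) linarith
    moreover have "h w \<in> {d..j} \<rightarrow>\<^sub>E UNIV" for w by (simp add: h_def)
    ultimately show ?thesis unfolding Q_set_def by simp
  qed
  have finA: "finite ?A" by (intro finite_PiE finite_words) simp
  \<comment> \<open>The product counts the tuples of subwords with prescribed numbers of generators.\<close>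
  have fiber: "(\<Prod>i=d..j. mu TYPE('k) (T_component T i) (\<kappa> i)) = card {w \<in> ?A. h w = \<kappa>}"
    if "\<kappa> \<in> ?Q" for \<kappa>
  proof -
    have \<kappa>: "\<kappa> \<in> extensional {d..j}" using that by (auto simp: Q_set_def PiE_iff)
    have "(\<Prod>i=d..j. mu TYPE('k) (T_component T i) (\<kappa> i))
        = (\<Prod>i=d..j. card {w \<in> words c i (Suc i). int (c i + g i w) = \<kappa> i})"
      using mu_component[OF inf T d0] by (intro prod.cong) (simp_all add: c_def g_def)
    also have "\<dots> = card (\<Pi>\<^sub>E i\<in>{d..j}. {w \<in> words c i (Suc i). int (c i + g i w) = \<kappa> i})"
      by (simp add: card_PiE)
    also have "(\<Pi>\<^sub>E i\<in>{d..j}. {w \<in> words c i (Suc i). int (c i + g i w) = \<kappa> i}) = {w \<in> ?A. h w = \<kappa>}"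
    proof (intro set_eqI iffI)
      fix w assume w: "w \<in> (\<Pi>\<^sub>E i\<in>{d..j}. {w \<in> words c i (Suc i). int (c i + g i w) = \<kappa> i})"
      then have "h w i = \<kappa> i" for i
        using \<kappa> by (cases "i \<in> {d..j}") (auto simp: h_def PiE_iff extensional_def)
      then show "w \<in> {w \<in> ?A. h w = \<kappa>}" using w by (auto simp: PiE_iff)
    next
      fix w assume w: "w \<in> {w \<in> ?A. h w = \<kappa>}"
      then have "int (c i + g i (w i)) = \<kappa> i" if "i \<in> {d..j}" for i
        using that by (auto simp: h_def)
      then show "w \<in> (\<Pi>\<^sub>E i\<in>{d..j}. {w \<in> words c i (Suc i). int (c i + g i w) = \<kappa> i})"
        using w by (auto simp: PiE_iff)
    qed
    finally show ?thesis .
  qed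
  have "(\<Sum>\<^sub>\<infinity>\<kappa>\<in>?Q. \<Prod>i=d..j. mu TYPE('k) (T_component T i) (\<kappa> i))
      = (\<Sum>\<^sub>\<infinity>\<kappa>\<in>?Q \<inter> h ` ?A. card {w \<in> ?A. h w = \<kappa>})"
  proof (rule infsum_cong_neutral)
    fix \<kappa> assume \<kappa>: "\<kappa> \<in> ?Q - (?Q \<inter> h ` ?A)"
    then have "{w \<in> ?A. h w = \<kappa>} = {}" by blast
    then have "card {w \<in> ?A. h w = \<kappa>} = 0" by (simp only: card.empty)
    then show "(\<Prod>i=d..j. mu TYPE('k) (T_component T i) (\<kappa> i)) = 0" using fiber \<kappa> by simp
  qed (use fiber in auto)
  also have "\<dots> = (\<Sum>\<kappa>\<in>?Q \<inter> h ` ?A. card {w \<in> ?A. h w = \<kappa>})"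
    using finA by (intro infsum_finite) simp
  also have "\<dots> = card (\<Union>\<kappa>\<in>?Q \<inter> h ` ?A. {w \<in> ?A. h w = \<kappa>})"
    using finA by (intro card_UN_disjoint[symmetric]) auto
  also have "(\<Union>\<kappa>\<in>?Q \<inter> h ` ?A. {w \<in> ?A. h w = \<kappa>}) = {w \<in> ?A. h w \<in> ?Q}" by (intro set_eqI) auto
  also have "card {w \<in> ?A. h w \<in> ?Q} = card {v \<in> ?L. int (c d + (\<Sum>n=d..j. g n v)) = k}"
  proof (rule bij_betw_same_card[symmetric], rule bij_betw_subset[OF bij])
    show "proj ` {v \<in> ?L. int (c d + (\<Sum>n=d..j. g n v)) = k} = {w \<in> ?A. h w \<in> ?Q}"
    proof -
      have "proj ` {v \<in> ?L. int (c d + (\<Sum>n=d..j. g n v)) = k} = {w \<in> proj ` ?L. h w \<in> ?Q}"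
        using total by auto
      then show ?thesis using bij by (simp only: bij_betw_def)
    qed
  qed blast
  also have "\<dots> = mu TYPE('k) T k" using mu_eq_words[OF inf T, of k] by (simp add: c_def g_def)
  finally show ?thesis by (rule sym)
qed

end
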